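(* The cone $\mathcal E^+_\kappa(\mathbf A)$ is a semimetric space with the semimetric $$\|\boldsymbol\mu_1-\boldsymbol\mu_2\|_{\mathcal E^+_\kappa(\mathbf A)}:=\Bigl[\sum_{i,j\in I}s_is_j\kappa(\mu_1^i-\mu_2^i,\mu_1^j-\mu_2^j)\Bigr]^{1/2},\qquad \boldsymbol\mu_1,\boldsymbol\mu_2\in\mathcal E^+_\kappa(\mathbf A),$$ and this space is isometric to its $R$-image (contained in $\mathcal E_\kappa(X)$ with the semimetric $\|\mu-\nu\|_\kappa$), that is, $\|\boldsymbol\mu_1-\boldsymbol\mu_2\|_{\mathcal E^+_\kappa(\mathbf A)}=\|R\boldsymbol\mu_1-R\boldsymbol\mu_2\|_\kappa$. Assume now $\kappa$ is strictly positive definite. Then $\|\boldsymbol\mu_1-\boldsymbol\mu_2\|_{\mathcal E^+_\kappa(\mathbf A)}$ becomes a metric if and only if $c_\kappa(A_i\cap A_j)=0$ for all $i\ne j$.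
   Context: $X$ is a locally compact Hausdorff space, $\mathfrak M(X)$ the space of real-valued (signed) Radon measures on $X$, $\mathfrak M^+(X)$ its positive elements. $\nu\in\mathfrak M^+(X)$ is carried by $Q\subset X$ if $X\setminus Q$ is locally $\nu$-negligible (equivalently, $Q$ is $\nu$-measurable and $\nu=\nu|_Q$); $\mathfrak M^+(Q)$ is the set of such $\nu$. A kernel is a symmetric l.s.c. function $\kappa:X\times X\to(-\infty,\infty]$, required to be nonnegative unless $X$ is compact. Write $\kappa(\mu,\nu):=\int\kappa\,d(\mu\otimes\nu)$. The kernel is assumed positive definite: $\kappa(\nu,\nu)\geqslant0$ for every $\nu\in\mathfrak M(X)$ for which it is defined (i.e. $\kappa(\nu^+,\nu^+)+\kappa(\nu^-,\nu^-)$ or $\kappa(\nu^+,\nu^-)$ is finite). $\mathcal E_\kappa(X):=\{\nu\in\mathfrak M(X):\kappa(\nu,\nu)\text{ finite}\}$ is a pre-Hilbert space with inner product $\kappa(\mu,\nu)$ and seminorm $\|\nu\|_\kappa:=\sqrt{\kappa(\nu,\nu)}$; $\kappa$ is strictly positive definite if $\|\cdot\|_\kappa$ is a norm. $\mathcal E^+_\kappa(Q):=\mathcal E_\kappa(X)\cap\mathfrak M^+(Q)$. The inner capacity is $c_\kappa(Q):=\bigl[\inf\{\kappa(\nu,\nu):\nu\in\mathcal E_\kappa^+(Q),\ \nu(Q)=1\}\bigr]^{-1}$ ($\inf\varnothing=+\infty$, $1/(+\infty)=0$, $1/0=+\infty$). $I=I^+\cup I^-$ is a countable index set, $I^+\cap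 I^-=\varnothing$ ($I^-$ may be empty), $s_i:=+1$ for $i\in I^+$, $s_i:=-1$ for $i\in I^-$. $\mathbf A=(A_i)_{i\in I}$ is a generalized condenser: nonempty Borel sets $A_i\subset X$ such that every compact set meets at most finitely many $A_i$, and $A_i\cap A_j=\varnothing$ for $i\in I^+$, $j\in I^-$. $\mathfrak M^+(\mathbf A):=\prod_{i\in I}\mathfrak M^+(A_i)$. A numerical series is finite iff it has finite terms and converges absolutely. The energy of $\boldsymbol\mu=(\mu^i)_{i\in I}\in\mathfrak M^+(\mathbf A)$ is $\kappa(\boldsymbol\mu,\boldsymbol\mu):=\sum_{i,j\in I}s_is_j\kappa(\mu^i,\mu^j)$; $\mathcal E^+_\kappa(\mathbf A)$ is the set of $\boldsymbol\mu\in\mathfrak M^+(\mathbf A)$ with finite energy. The map $R:\mathfrak M^+(\mathbf A)\to\mathfrak M(X)$ is $R\boldsymbol\mu:=\sum_{i\in I}s_i\mu^i$, i.e. $R\boldsymbol\mu(\varphi)=\sum_{i\in I}s_i\mu^i(\varphi)$ for every continuous $\varphi$ with compact support (a finite sum). A semimetric satisfies all axioms of a metric except that distinct points may be at distance zero. *)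

theory Defs
  imports "HOL-Analysis.Analysis"
begin

section \<open>Radon measures\<close>

text \<open>
  Radon measures are taken in Bourbaki's sense, as continuous linear functionals on the space
  of continuous functions with compact support.  The spaces are locally compact Hausdorff but not
  necessarily second countable, so Radon measures need not be sigma-finite and the Borel
  sigma-algebra of a product may exceed the product of the Borel sigma-algebras.
\<close>

definition Cc :: "('a::t2_space \<Rightarrow> real) set" where
  "Cc = {f. continuous_on UNIV f \<and> compact (closure {x. f x \<noteq> 0})}"

text \<open>
  Functionals are set to 0 outside \<open>Cc\<close>, so that equality, sums and differences of Radon measures
  are those of HOL functions.  The third clause is continuity for the inductive limit topology.
\<close>

definition radon_measures :: "(('a::t2_space \<Rightarrow> real) \<Rightarrow> real) set" where
  "radon_measures = {\<nu>.
     (\<forall>f\<in>Cc. \<forall>g\<in>Cc. \<nu> (\<lambda>x. f x + g x) = \<nu> f + \<nu> g) \<and>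
     (\<forall>c. \<forall>f\<in>Cc. \<nu> (\<lambda>x. c * f x) = c * \<nu> f) \<and>
     (\<forall>K. compact K \<longrightarrow>
        (\<exists>M. \<forall>f\<in>Cc. {x. f x \<noteq> 0} \<subseteq> K \<longrightarrow> \<bar>\<nu> f\<bar> \<le> M * (SUP x. \<bar>f x\<bar>))) \<and>
     (\<forall>f. f \<notin> Cc \<longrightarrow> \<nu> f = 0)}"

definition pos_radon_measures :: "(('a::t2_space \<Rightarrow> real) \<Rightarrow> real) set" where
  "pos_radon_measures = {\<nu> \<in> radon_measures. \<forall>f\<in>Cc. (\<forall>x. 0 \<le> f x) \<longrightarrow> 0 \<le> \<nu> f}"

text \<open>
  The Jordan decomposition: for \<open>0 \<le> f \<in> Cc\<close> the positive part is
  \<open>\<nu>\<^sup>+(f) = sup {\<nu>(g) | g \<in> Cc, 0 \<le> g \<le> f}\<close>, extended to all of \<open>Cc\<close> by linearity.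
\<close>

definition radon_pos_part ::
    "(('a::t2_space \<Rightarrow> real) \<Rightarrow> real) \<Rightarrow> ('a \<Rightarrow> real) \<Rightarrow> real" where
  "radon_pos_part \<nu> f =
     (let P = (\<lambda>h. SUP g\<in>{g \<in> Cc. \<forall>x. 0 \<le> g x \<and> g x \<le> h x}. \<nu> g)
      in if f \<in> Cc then P (\<lambda>x. max 0 (f x)) - P (\<lambda>x. max 0 (- f x)) else 0)"

definition radon_neg_part ::
    "(('a::t2_space \<Rightarrow> real) \<Rightarrow> real) \<Rightarrow> ('a \<Rightarrow> real) \<Rightarrow> real" where
  "radon_neg_part \<nu> = radon_pos_part (- \<nu>)"

definition radon_tensor ::
    "(('a::t2_space \<Rightarrow> real) \<Rightarrow> real) \<Rightarrow> (('b::t2_space \<Rightarrow> real) \<Rightarrow> real)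
      \<Rightarrow> ('a \<times> 'b \<Rightarrow> real) \<Rightarrow> real" where
  "radon_tensor \<mu> \<nu> F = (if F \<in> Cc then \<mu> (\<lambda>x. \<nu> (\<lambda>y. F (x, y))) else 0)"

text \<open>
  The property by which the product measure is usually characterised.
\<close>

lemma radon_tensor_product:
  assumes "\<mu> \<in> radon_measures" "\<nu> \<in> radon_measures" "f \<in> Cc" "g \<in> Cc"
  shows "radon_tensor \<mu> \<nu> (\<lambda>(x, y). f x * g y) = \<mu> f * \<nu> g"
proof -
  let ?h = "\<lambda>(x, y). f x * g y"
  let ?S = "closure {x. f x \<noteq> 0} \<times> closure {y. g y \<noteq> 0}"
  have S: "compact ?S"
    using assms(3,4) by (auto simp: Cc_def intro: compact_Times)
  have "{z. ?h z \<noteq> 0} \<subseteq> ?S"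
    using closure_subset[of "{x. f x \<noteq> 0}"] closure_subset[of "{y. g y \<noteq> 0}"] by auto
  then have "closure {z. ?h z \<noteq> 0} \<subseteq> ?S"
    by (intro closure_minimal) (auto intro: closed_Times)
  then have "compact (?S \<inter> closure {z. ?h z \<noteq> 0})" "?S \<inter> closure {z. ?h z \<noteq> 0} = closure {z. ?h z \<noteq> 0}"
    using compact_Int_closed[OF S closed_closure] by auto
  then have "compact (closure {z. ?h z \<noteq> 0})"
    by simp
  moreover have "continuous_on UNIV ?h"
  proof -
    have c: "continuous_on UNIV f" "continuous_on UNIV g"
      using assms(3,4) by (auto simp: Cc_def)
    have "continuous_on UNIV (\<lambda>z. f (fst z) * g (snd z))"
      by (intro continuous_intros continuous_on_compose2[OF c(1)] continuous_on_compose2[OF c(2)]) auto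
    then show ?thesis
      by (simp add: case_prod_beta')
  qed
  ultimately have "?h \<in> Cc"
    by (simp add: Cc_def)
  moreover have "(\<lambda>x. \<nu> (\<lambda>y. f x * g y)) = (\<lambda>x. \<nu> g * f x)"
    using assms(2,4) by (auto simp: radon_measures_def mult.commute)
  moreover have "\<mu> (\<lambda>x. \<nu> g * f x) = \<nu> g * \<mu> f"
    using assms(1,3) by (auto simp: radon_measures_def)
  ultimately show ?thesis
    by (simp add: radon_tensor_def mult.commute)
qed

text \<open>
  The integral of a lower semicontinuous \<open>g\<close> that is nonnegative or, on a compact space, bounded
  below, against a positive Radon measure.  Functions \<open>f\<close> of both signs are admitted below \<open>g\<close>;
  for \<open>g \<ge> 0\<close> this gives the same supremum as \<open>0 \<le> f \<le> g\<close>.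
\<close>

definition lsc_integral ::
    "('a::t2_space \<Rightarrow> ereal) \<Rightarrow> (('a \<Rightarrow> real) \<Rightarrow> real) \<Rightarrow> ereal" where
  "lsc_integral g \<nu> = (SUP f\<in>{f \<in> Cc. \<forall>x. ereal (f x) \<le> g x}. ereal (\<nu> f))"

definition radon_outer ::
    "(('a::t2_space \<Rightarrow> real) \<Rightarrow> real) \<Rightarrow> 'a set \<Rightarrow> ereal" where
  "radon_outer \<nu> E = (INF G\<in>{G. open G \<and> E \<subseteq> G}. lsc_integral (indicator G) \<nu>)"

definition locally_negligible ::
    "(('a::t2_space \<Rightarrow> real) \<Rightarrow> real) \<Rightarrow> 'a set \<Rightarrow> bool" where
  "locally_negligible \<nu> E \<longleftrightarrow> (\<forall>K. compact K \<longrightarrow> radon_outer \<nu> (E \<inter> K) = 0)"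

definition measures_carried_by :: "'a::t2_space set \<Rightarrow> (('a \<Rightarrow> real) \<Rightarrow> real) set" where
  "measures_carried_by Q = {\<nu> \<in> pos_radon_measures. locally_negligible \<nu> (- Q)}"

section \<open>Kernels, energy and inner capacity\<close>

definition energy_kernel :: "('a::t2_space \<times> 'a \<Rightarrow> ereal) \<Rightarrow> bool" where
  "energy_kernel \<kappa> \<longleftrightarrow>
     (\<forall>x y. \<kappa> (x, y) = \<kappa> (y, x)) \<and>
     (\<forall>a. open {z. a < \<kappa> z}) \<and>
     (\<forall>z. \<kappa> z \<noteq> - \<infinity>) \<and>
     (\<not> compact (UNIV :: 'a set) \<longrightarrow> (\<forall>z. 0 \<le> \<kappa> z))"

text \<open>
  The integral of \<open>\<kappa>\<close> against \<open>\<mu> \<otimes> \<nu>\<close>, whose positive and negative parts are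
  \<open>\<mu>\<^sup>+ \<otimes> \<nu>\<^sup>+ + \<mu>\<^sup>- \<otimes> \<nu>\<^sup>-\<close> and \<open>\<mu>\<^sup>+ \<otimes> \<nu>\<^sup>- + \<mu>\<^sup>- \<otimes> \<nu>\<^sup>+\<close>.
\<close>

definition energy_pos_part ::
    "('a::t2_space \<times> 'a \<Rightarrow> ereal) \<Rightarrow> (('a \<Rightarrow> real) \<Rightarrow> real) \<Rightarrow> (('a \<Rightarrow> real) \<Rightarrow> real) \<Rightarrow> ereal" where
  "energy_pos_part \<kappa> \<mu> \<nu> =
     lsc_integral \<kappa> (radon_tensor (radon_pos_part \<mu>) (radon_pos_part \<nu>)) +
     lsc_integral \<kappa> (radon_tensor (radon_neg_part \<mu>) (radon_neg_part \<nu>))"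

definition energy_neg_part ::
    "('a::t2_space \<times> 'a \<Rightarrow> ereal) \<Rightarrow> (('a \<Rightarrow> real) \<Rightarrow> real) \<Rightarrow> (('a \<Rightarrow> real) \<Rightarrow> real) \<Rightarrow> ereal" where
  "energy_neg_part \<kappa> \<mu> \<nu> =
     lsc_integral \<kappa> (radon_tensor (radon_pos_part \<mu>) (radon_neg_part \<nu>)) +
     lsc_integral \<kappa> (radon_tensor (radon_neg_part \<mu>) (radon_pos_part \<nu>))"

definition energy_defined ::
    "('a::t2_space \<times> 'a \<Rightarrow> ereal) \<Rightarrow> (('a \<Rightarrow> real) \<Rightarrow> real) \<Rightarrow> (('a \<Rightarrow> real) \<Rightarrow> real) \<Rightarrow> bool" where
  "energy_defined \<kappa> \<mu> \<nu> \<longleftrightarrow>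
     \<bar>energy_pos_part \<kappa> \<mu> \<nu>\<bar> \<noteq> \<infinity> \<or> \<bar>energy_neg_part \<kappa> \<mu> \<nu>\<bar> \<noteq> \<infinity>"

text \<open>Meaningful only under \<open>energy_defined\<close>.\<close>

definition mutual_energy ::
    "('a::t2_space \<times> 'a \<Rightarrow> ereal) \<Rightarrow> (('a \<Rightarrow> real) \<Rightarrow> real) \<Rightarrow> (('a \<Rightarrow> real) \<Rightarrow> real) \<Rightarrow> ereal" where
  "mutual_energy \<kappa> \<mu> \<nu> = energy_pos_part \<kappa> \<mu> \<nu> - energy_neg_part \<kappa> \<mu> \<nu>"

definition finite_energy_measures ::
    "('a::t2_space \<times> 'a \<Rightarrow> ereal) \<Rightarrow> (('a \<Rightarrow> real) \<Rightarrow> real) set" where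
  "finite_energy_measures \<kappa> =
     {\<nu> \<in> radon_measures. energy_defined \<kappa> \<nu> \<nu> \<and> \<bar>mutual_energy \<kappa> \<nu> \<nu>\<bar> \<noteq> \<infinity>}"

definition energy_norm ::
    "('a::t2_space \<times> 'a \<Rightarrow> ereal) \<Rightarrow> (('a \<Rightarrow> real) \<Rightarrow> real) \<Rightarrow> real" where
  "energy_norm \<kappa> \<nu> = sqrt (real_of_ereal (mutual_energy \<kappa> \<nu> \<nu>))"

definition positive_definite :: "('a::t2_space \<times> 'a \<Rightarrow> ereal) \<Rightarrow> bool" where
  "positive_definite \<kappa> \<longleftrightarrow>
     (\<forall>\<nu>\<in>radon_measures. energy_defined \<kappa> \<nu> \<nu> \<longrightarrow> 0 \<le> mutual_energy \<kappa> \<nu> \<nu>)"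

definition strictly_positive_definite :: "('a::t2_space \<times> 'a \<Rightarrow> ereal) \<Rightarrow> bool" where
  "strictly_positive_definite \<kappa> \<longleftrightarrow>
     positive_definite \<kappa> \<and>
     (\<forall>\<nu>\<in>finite_energy_measures \<kappa>. energy_norm \<kappa> \<nu> = 0 \<longrightarrow> \<nu> = (\<lambda>_. 0))"

text \<open>
  For \<open>\<nu>\<close> carried by \<open>Q\<close>, the condition \<open>radon_outer \<nu> Q = 1\<close> is \<open>\<nu>(Q) = 1\<close>.  The conventions
  \<open>inf \<emptyset> = \<infinity>\<close>, \<open>1/\<infinity> = 0\<close> and \<open>1/0 = \<infinity>\<close> are those of \<^typ>\<open>ereal\<close>.
\<close>

definition inner_capacity :: "('a::t2_space \<times> 'a \<Rightarrow> ereal) \<Rightarrow> 'a set \<Rightarrow> ereal" where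
  "inner_capacity \<kappa> Q =
     inverse (INF \<nu>\<in>{\<nu> \<in> finite_energy_measures \<kappa> \<inter> measures_carried_by Q. radon_outer \<nu> Q = 1}.
       mutual_energy \<kappa> \<nu> \<nu>)"

section \<open>Generalized condensers\<close>

definition generalized_condenser :: "'i set \<Rightarrow> 'i set \<Rightarrow> ('i \<Rightarrow> 'a::t2_space set) \<Rightarrow> bool" where
  "generalized_condenser Ipos Ineg A \<longleftrightarrow>
     countable (Ipos \<union> Ineg) \<and> Ipos \<inter> Ineg = {} \<and>
     (\<forall>i\<in>Ipos \<union> Ineg. A i \<in> sets borel \<and> A i \<noteq> {}) \<and>
     (\<forall>K. compact K \<longrightarrow> finite {i \<in> Ipos \<union> Ineg. A i \<inter> K \<noteq> {}}) \<and>
     (\<forall>i\<in>Ipos. \<forall>j\<in>Ineg. A i \<inter> A j = {})"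

definition plate_sign :: "'i set \<Rightarrow> 'i \<Rightarrow> real" where
  "plate_sign Ineg i = (if i \<in> Ineg then - 1 else 1)"

definition vector_measures ::
    "'i set \<Rightarrow> 'i set \<Rightarrow> ('i \<Rightarrow> 'a::t2_space set) \<Rightarrow> ('i \<Rightarrow> ('a \<Rightarrow> real) \<Rightarrow> real) set" where
  "vector_measures Ipos Ineg A = (\<Pi>\<^sub>E i\<in>Ipos \<union> Ineg. measures_carried_by (A i))"

text \<open>
  The series of the energies \<open>s\<^sub>i s\<^sub>j \<kappa>(\<sigma>\<^sup>i, \<sigma>\<^sup>j)\<close> of a family of signed measures: being finite
  means having finite terms and converging absolutely.
\<close>

definition vector_energy_finite ::
    "('a::t2_space \<times> 'a \<Rightarrow> ereal) \<Rightarrow> 'i set \<Rightarrow> 'i set \<Rightarrow> ('i \<Rightarrow> ('a \<Rightarrow> real) \<Rightarrow> real) \<Rightarrow> bool" where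
  "vector_energy_finite \<kappa> Ipos Ineg \<sigma> \<longleftrightarrow>
     (\<forall>i\<in>Ipos \<union> Ineg. \<forall>j\<in>Ipos \<union> Ineg.
        energy_defined \<kappa> (\<sigma> i) (\<sigma> j) \<and> \<bar>mutual_energy \<kappa> (\<sigma> i) (\<sigma> j)\<bar> \<noteq> \<infinity>) \<and>
     (\<lambda>(i, j). \<bar>plate_sign Ineg i * plate_sign Ineg j * real_of_ereal (mutual_energy \<kappa> (\<sigma> i) (\<sigma> j))\<bar>)
        summable_on ((Ipos \<union> Ineg) \<times> (Ipos \<union> Ineg))"

definition vector_energy ::
    "('a::t2_space \<times> 'a \<Rightarrow> ereal) \<Rightarrow> 'i set \<Rightarrow> 'i set \<Rightarrow> ('i \<Rightarrow> ('a \<Rightarrow> real) \<Rightarrow> real) \<Rightarrow> real" where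
  "vector_energy \<kappa> Ipos Ineg \<sigma> =
     (\<Sum>\<^sub>\<infinity>(i, j)\<in>(Ipos \<union> Ineg) \<times> (Ipos \<union> Ineg).
        plate_sign Ineg i * plate_sign Ineg j * real_of_ereal (mutual_energy \<kappa> (\<sigma> i) (\<sigma> j)))"

definition finite_energy_vectors ::
    "('a::t2_space \<times> 'a \<Rightarrow> ereal) \<Rightarrow> 'i set \<Rightarrow> 'i set \<Rightarrow> ('i \<Rightarrow> 'a set)
      \<Rightarrow> ('i \<Rightarrow> ('a \<Rightarrow> real) \<Rightarrow> real) set" where
  "finite_energy_vectors \<kappa> Ipos Ineg A =
     {\<mu> \<in> vector_measures Ipos Ineg A. vector_energy_finite \<kappa> Ipos Ineg \<mu>}"

text \<open>
  The value 0 off the cone is immaterial; it is there because \<^locale>\<open>Metric_space\<close> requires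
  nonnegativity and symmetry also outside the carrier.
\<close>

definition vector_dist ::
    "('a::t2_space \<times> 'a \<Rightarrow> ereal) \<Rightarrow> 'i set \<Rightarrow> 'i set \<Rightarrow> ('i \<Rightarrow> 'a set)
      \<Rightarrow> ('i \<Rightarrow> ('a \<Rightarrow> real) \<Rightarrow> real) \<Rightarrow> ('i \<Rightarrow> ('a \<Rightarrow> real) \<Rightarrow> real) \<Rightarrow> real" where
  "vector_dist \<kappa> Ipos Ineg A \<mu>1 \<mu>2 =
     (if \<mu>1 \<in> finite_energy_vectors \<kappa> Ipos Ineg A \<and> \<mu>2 \<in> finite_energy_vectors \<kappa> Ipos Ineg A
      then sqrt (vector_energy \<kappa> Ipos Ineg (\<lambda>i. \<mu>1 i - \<mu>2 i)) else 0)"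

text \<open>
  On families in \<^const>\<open>vector_measures\<close> over a generalized condenser, only finitely many terms of
  the sum are nonzero, since the support of \<open>f\<close> meets only finitely many \<open>A i\<close>.
\<close>

definition condenser_R ::
    "'i set \<Rightarrow> 'i set \<Rightarrow> ('i \<Rightarrow> ('a::t2_space \<Rightarrow> real) \<Rightarrow> real) \<Rightarrow> ('a \<Rightarrow> real) \<Rightarrow> real" where
  "condenser_R Ipos Ineg \<mu> f = (\<Sum>\<^sub>\<infinity>i\<in>Ipos \<union> Ineg. plate_sign Ineg i * \<mu> i f)"

text \<open>The axioms of \<^locale>\<open>Metric_space\<close>, except that distinct points may be at distance 0.\<close>

definition semimetric_space :: "'b set \<Rightarrow> ('b \<Rightarrow> 'b \<Rightarrow> real) \<Rightarrow> bool" where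
  "semimetric_space M d \<longleftrightarrow>
     (\<forall>x y. 0 \<le> d x y) \<and> (\<forall>x y. d x y = d y x) \<and> (\<forall>x\<in>M. d x x = 0) \<and>
     (\<forall>x\<in>M. \<forall>y\<in>M. \<forall>z\<in>M. d x z \<le> d x y + d y z)"

end

theory Submission
  imports Defs "HOL-Library.Function_Algebras"
begin

text \<open>
  On pairs of positive Radon measures the energy, after adding a constant to the kernel if \<open>X\<close> is
  compact, is a nonnegative biadditive function \<open>N\<close> that commutes with locally finite sums.  A
  vector measure of finite energy therefore has a sum \<open>\<Sigma>\<^sub>i \<mu>\<^sup>i\<close> of finite energy, all mutual
  energies are finite by positive definiteness, and the series defining the distance is the expansion
  of the energy of \<open>R \<mu>\<^sub>1 - R \<mu>\<^sub>2\<close>; the triangle inequality is Cauchy-Schwarz in \<open>\<E>\<^sub>\<kappa>(X)\<close>.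

  If \<open>c\<^sub>\<kappa>(A\<^sub>i \<inter> A\<^sub>j) > 0\<close>, a measure of finite energy on \<open>A\<^sub>i \<inter> A\<^sub>j\<close> may be placed on either plate
  without changing the \<open>R\<close>-image.  If all these capacities vanish, then for measures of finite energy
  carried by \<open>A\<^sub>i\<close> and \<open>A\<^sub>j\<close> the lattice infimum is carried by \<open>A\<^sub>i \<inter> A\<^sub>j\<close>, hence zero, and the Riesz
  decomposition property recovers the components from the \<open>R\<close>-image.
\<close>

section \<open>Continuous functions with compact support\<close>

text \<open>Measures are functionals on a space that may fail to be sigma-finite, so no Tonelli
  theorem is invoked: every integral of the kernel is a supremum over functions in
  \<open>Cc\<close>. That family is directed upwards, which gives biadditivity, and each of its
  members has compact support and hence sees only finitely many components, which gives the exchange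
  with sums.

  The obstacle is that energies of signed measures are defined through Jordan parts, which are not
  additive. \<open>mutual_energy_diff\<close> therefore computes the energy of a - b against c - d
  from arbitrary positive representatives, and all the linear algebra rests on it. Absolute
  convergence of the series needs no estimate: up to a term of finite support, it is a signed
  combination of four series whose terms are nonnegative, being values of \<open>N\<close>.

  For uniqueness, restrictions of measures to Borel sets are never formed. The lattice order of
  measures takes their place, and multiplication by a cutoff function takes the place of restriction
  to a compact set.\<close>

lemma CcI:
  assumes "continuous_on UNIV f" "compact K" "{x. f x \<noteq> 0} \<subseteq> K"
  shows "f \<in> Cc"
proof -
  have "closure {x. f x \<noteq> 0} \<subseteq> K"
    using assms by (simp add: closure_minimal compact_imp_closed)
  then have "compact (K \<inter> closure {x. f x \<noteq> 0})" "K \<inter> closure {x. f x \<noteq> 0} = closure {x. f x \<noteq> 0}"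
    using compact_Int_closed[OF assms(2) closed_closure] by auto
  then show ?thesis
    using assms(1) by (simp add: Cc_def)
qed

lemma CcE:
  assumes "f \<in> Cc"
  obtains K where "continuous_on UNIV f" "compact K" "{x. f x \<noteq> 0} \<subseteq> K"
  using assms that[OF _ _ closure_subset] by (simp add: Cc_def)

lemma Cc_continuous: "f \<in> Cc \<Longrightarrow> continuous_on UNIV f"
  by (simp add: Cc_def)

lemma Cc_0 [simp]: "(\<lambda>_. 0) \<in> Cc"
  by (simp add: Cc_def)

lemma Cc_const: "compact (UNIV :: 'a::t2_space set) \<Longrightarrow> (\<lambda>_::'a. c) \<in> Cc"
  by (rule CcI) auto

text \<open>Since \<open>h 0 0 = 0\<close>, the composition vanishes wherever both functions do.
  Continuity is required of the composition itself; besides the lattice operations this covers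
  truncations such as \<open>max 0 (f x - e)\<close>.\<close>

lemma Cc_comp2:
  assumes f: "f \<in> Cc" and g: "g \<in> Cc"
    and h: "continuous_on UNIV (\<lambda>x. h (f x) (g x))" "h 0 0 = 0"
  shows "(\<lambda>x. h (f x) (g x)) \<in> Cc"
proof -
  obtain K where K: "compact K" "{x. f x \<noteq> 0} \<subseteq> K"
    using f by (rule CcE)
  obtain L where L: "compact L" "{x. g x \<noteq> 0} \<subseteq> L"
    using g by (rule CcE)
  show ?thesis
  proof (rule CcI[OF h(1) compact_Un[OF K(1) L(1)]])
    show "{x. h (f x) (g x) \<noteq> 0} \<subseteq> K \<union> L"
      using K(2) L(2) h(2) by force
  qed
qed

lemma Cc_add: "f \<in> Cc \<Longrightarrow> g \<in> Cc \<Longrightarrow> (\<lambda>x. f x + g x) \<in> Cc"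
  by (rule Cc_comp2[where h="(+)"]) (auto intro!: continuous_intros dest: Cc_continuous)

lemma Cc_diff: "f \<in> Cc \<Longrightarrow> g \<in> Cc \<Longrightarrow> (\<lambda>x. f x - g x) \<in> Cc"
  by (rule Cc_comp2[where h="(-)"]) (auto intro!: continuous_intros dest: Cc_continuous)

lemma Cc_max: "f \<in> Cc \<Longrightarrow> g \<in> Cc \<Longrightarrow> (\<lambda>x. max (f x) (g x)) \<in> Cc"
  by (rule Cc_comp2[where h="max"]) (auto intro!: continuous_intros dest: Cc_continuous)

lemma Cc_min: "f \<in> Cc \<Longrightarrow> g \<in> Cc \<Longrightarrow> (\<lambda>x. min (f x) (g x)) \<in> Cc"
  by (rule Cc_comp2[where h="min"]) (auto intro!: continuous_intros dest: Cc_continuous)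

lemma Cc_mult_left:
  assumes "continuous_on UNIV g" "f \<in> Cc"
  shows "(\<lambda>x. g x * f x) \<in> Cc"
  using assms(2)
proof (rule CcE)
  fix K assume "continuous_on UNIV f" "compact K" "{x. f x \<noteq> 0} \<subseteq> K"
  then show ?thesis
    using assms(1) by (intro CcI[of _ K]) (auto intro!: continuous_intros)
qed

lemma Cc_cmult: "f \<in> Cc \<Longrightarrow> (\<lambda>x. c * f x) \<in> Cc"
  by (rule Cc_mult_left) auto

lemma Cc_minus: "f \<in> Cc \<Longrightarrow> (\<lambda>x. - f x) \<in> Cc"
  using Cc_cmult[of f "-1"] by simp

lemma Cc_pos: "f \<in> Cc \<Longrightarrow> (\<lambda>x. max 0 (f x)) \<in> Cc"
  by (rule Cc_max) auto

lemma Cc_sum: "(\<And>i. i \<in> J \<Longrightarrow> f i \<in> Cc) \<Longrightarrow> (\<lambda>x. \<Sum>i\<in>J. f i x) \<in> Cc"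
  by (induction J rule: infinite_finite_induct) (auto intro: Cc_add)

lemma Cc_bounded:
  assumes "f \<in> Cc"
  obtains B where "0 \<le> B" "\<And>x. \<bar>f x\<bar> \<le> B"
  using assms
proof (rule CcE)
  fix K assume K: "continuous_on UNIV f" "compact K" "{x. f x \<noteq> 0} \<subseteq> K"
  have "bounded (f ` K)"
    using K by (intro compact_imp_bounded compact_continuous_image) (auto intro: continuous_on_subset)
  then obtain B where B: "0 < B" "\<And>x. x \<in> K \<Longrightarrow> \<bar>f x\<bar> \<le> B"
    unfolding bounded_pos by auto
  show thesis
    using B K(3) by (intro that[of B]) (force intro: order.strict_implies_order)+
qed

lemma Cc_le_SUP:
  assumes "f \<in> Cc"
  shows "\<bar>f x\<bar> \<le> (SUP x. \<bar>f x\<bar>)"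
proof -
  obtain B where "\<And>x. \<bar>f x\<bar> \<le> B"
    using Cc_bounded[OF assms] by blast
  then show ?thesis
    by (intro cSUP_upper bdd_aboveI2) auto
qed

text \<open>A locally compact Hausdorff space may fail to be normal, but it is completely regular,
  which suffices to separate a compact set from a closed one. The closed set is the complement of
  \<open>U \<inter> G\<close> with \<open>U\<close> inside a compact \<open>C\<close>: the factor
  \<open>U\<close> yields compact support, the factor \<open>G\<close> confines the nonzero set to
  \<open>G\<close>.\<close>

lemma Cc_Urysohn:
  fixes K G :: "'a::t2_space set"
  assumes lc: "locally_compact_space (euclidean :: 'a topology)"
    and K: "compact K" and G: "open G" "K \<subseteq> G"
  obtains f where "f \<in> Cc" "\<And>x. 0 \<le> f x" "\<And>x. f x \<le> 1" "\<And>x. x \<in> K \<Longrightarrow> f x = 1" "{x. f x \<noteq> 0} \<subseteq> G"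
proof -
  have haus: "Hausdorff_space (euclidean :: 'a topology)"
    by (metis Hausdorff_space_def disjnt_def hausdorff open_openin)
  have cr: "completely_regular_space (euclidean :: 'a topology)"
    using haus lc locally_compact_regular_imp_completely_regular_space by blast
  obtain U C where U: "open U" "compact C" "K \<subseteq> U" "U \<subseteq> C"
  proof -
    have "\<exists>U C. openin euclidean U \<and> compactin euclidean C \<and> K \<subseteq> U \<and> U \<subseteq> C"
      using K lc locally_compact_space_compact_closed_compact[of euclidean] haus by (metis compactin_euclidean_iff)
    then show thesis
      using that by (auto simp: compactin_euclidean_iff)
  qed
  have "compactin euclidean K" "closedin euclidean (- (U \<inter> G))" "disjnt K (- (U \<inter> G))"
    using K G U by (auto simp: disjnt_def)
  then obtain f where f: "continuous_map euclidean (subtopology euclidean {0..1}) f"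
      "f ` (- (U \<inter> G)) \<subseteq> {0::real}" "f ` K \<subseteq> {1}"
    using Urysohn_completely_regular_compact_closed[OF zero_le_one cr] by metis
  show thesis
  proof (rule that[of f])
    have c: "continuous_on UNIV f" "range f \<subseteq> {0..1}"
      using f(1) by (auto simp: continuous_map_in_subtopology)
    show "f \<in> Cc"
      using f(2) U by (intro CcI[OF c(1) U(2)]) force
    show "0 \<le> f x" "f x \<le> 1" for x
      using c(2) by (auto simp: image_subset_iff)
    show "f x = 1" if "x \<in> K" for x
      using f(3) that by auto
    show "{x. f x \<noteq> 0} \<subseteq> G"
      using f(2) by force
  qed
qed

lemma Cc_Urysohn_compact:
  fixes K :: "'a::t2_space set"
  assumes "locally_compact_space (euclidean :: 'a topology)" "compact K"
  obtains f where "f \<in> Cc" "\<And>x. 0 \<le> f x" "\<And>x. f x \<le> 1" "\<And>x. x \<in> K \<Longrightarrow> f x = 1"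
  using Cc_Urysohn[OF assms open_UNIV] by auto

section \<open>Radon measures\<close>

lemma radon_add: "\<nu> \<in> radon_measures \<Longrightarrow> f \<in> Cc \<Longrightarrow> g \<in> Cc \<Longrightarrow> \<nu> (\<lambda>x. f x + g x) = \<nu> f + \<nu> g"
  by (simp add: radon_measures_def)

lemma radon_cmult: "\<nu> \<in> radon_measures \<Longrightarrow> f \<in> Cc \<Longrightarrow> \<nu> (\<lambda>x. c * f x) = c * \<nu> f"
  by (simp add: radon_measures_def)

lemma radon_outside: "\<nu> \<in> radon_measures \<Longrightarrow> f \<notin> Cc \<Longrightarrow> \<nu> f = 0"
  by (simp add: radon_measures_def)

lemma radon_0 [simp]: "\<nu> \<in> radon_measures \<Longrightarrow> \<nu> (\<lambda>_. 0) = 0"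
  using radon_cmult[of \<nu> "\<lambda>_. 0" 0] by simp

lemma radon_minus: "\<nu> \<in> radon_measures \<Longrightarrow> f \<in> Cc \<Longrightarrow> \<nu> (\<lambda>x. - f x) = - \<nu> f"
  using radon_cmult[of \<nu> f "-1"] by simp

lemma radon_diff: "\<nu> \<in> radon_measures \<Longrightarrow> f \<in> Cc \<Longrightarrow> g \<in> Cc \<Longrightarrow> \<nu> (\<lambda>x. f x - g x) = \<nu> f - \<nu> g"
  using radon_add[of \<nu> f "\<lambda>x. - g x"] by (simp add: Cc_minus radon_minus)

lemma radon_sum:
  assumes "\<nu> \<in> radon_measures" "\<And>i. i \<in> J \<Longrightarrow> f i \<in> Cc"
  shows "\<nu> (\<lambda>x. \<Sum>i\<in>J. f i x) = (\<Sum>i\<in>J. \<nu> (f i))"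
  using assms(2)
proof (induction J rule: infinite_finite_induct)
  case (insert i J)
  then show ?case
    using radon_add[OF assms(1), of "f i" "\<lambda>x. \<Sum>i\<in>J. f i x"] by (simp add: Cc_sum)
qed (use assms(1) in auto)

text \<open>A nonnegative constant allows any uniform bound \<open>B\<close> in place of the
  supremum norm, so applications compute no supremum.\<close>

lemma radon_bound:
  assumes "\<nu> \<in> radon_measures" "compact K"
  obtains M where "0 \<le> M"
    "\<And>f B. f \<in> Cc \<Longrightarrow> {x. f x \<noteq> 0} \<subseteq> K \<Longrightarrow> (\<And>x. \<bar>f x\<bar> \<le> B) \<Longrightarrow> \<bar>\<nu> f\<bar> \<le> M * B"
proof -
  obtain M where M: "\<forall>f\<in>Cc. {x. f x \<noteq> 0} \<subseteq> K \<longrightarrow> \<bar>\<nu> f\<bar> \<le> M * (SUP x. \<bar>f x\<bar>)"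
    using assms by (auto simp: radon_measures_def)
  show thesis
  proof (rule that[of "\<bar>M\<bar>"])
    fix f :: "'a \<Rightarrow> real" and B
    assume f: "f \<in> Cc" "{x. f x \<noteq> 0} \<subseteq> K" "\<And>x. \<bar>f x\<bar> \<le> B"
    have "\<bar>\<nu> f\<bar> \<le> M * (SUP x. \<bar>f x\<bar>)"
      using bspec[OF M f(1)] f(2) by simp
    also have "\<dots> \<le> \<bar>M\<bar> * (SUP x. \<bar>f x\<bar>)"
      using order.trans[OF abs_ge_zero Cc_le_SUP[OF f(1)]] by (intro mult_right_mono) auto
    also have "\<dots> \<le> \<bar>M\<bar> * B"
      using f(3) by (intro mult_left_mono cSUP_least) auto
    finally show "\<bar>\<nu> f\<bar> \<le> \<bar>M\<bar> * B" .
  qed simp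
qed

lemma radon_measures_add:
  assumes "\<mu> \<in> radon_measures" "\<nu> \<in> radon_measures"
  shows "\<mu> + \<nu> \<in> radon_measures"
proof -
  have "\<exists>M. \<forall>f\<in>Cc. {x. f x \<noteq> 0} \<subseteq> K \<longrightarrow> \<bar>(\<mu> + \<nu>) f\<bar> \<le> M * (SUP x. \<bar>f x\<bar>)" if K: "compact K" for K
  proof -
    obtain M1 where M1: "\<And>f B. f \<in> Cc \<Longrightarrow> {x. f x \<noteq> 0} \<subseteq> K \<Longrightarrow> (\<And>x. \<bar>f x\<bar> \<le> B) \<Longrightarrow> \<bar>\<mu> f\<bar> \<le> M1 * B"
      using radon_bound[OF assms(1) K] by metis
    obtain M2 where M2: "\<And>f B. f \<in> Cc \<Longrightarrow> {x. f x \<noteq> 0} \<subseteq> K \<Longrightarrow> (\<And>x. \<bar>f x\<bar> \<le> B) \<Longrightarrow> \<bar>\<nu> f\<bar> \<le> M2 * B"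
      using radon_bound[OF assms(2) K] by metis
    have "\<bar>(\<mu> + \<nu>) f\<bar> \<le> (M1 + M2) * (SUP x. \<bar>f x\<bar>)" if "f \<in> Cc" "{x. f x \<noteq> 0} \<subseteq> K" for f
      using M1[OF that Cc_le_SUP[OF that(1)]] M2[OF that Cc_le_SUP[OF that(1)]]
      by (simp add: distrib_right)
    then show ?thesis
      by (intro exI ballI impI)
  qed
  then show ?thesis
    using assms by (auto simp: radon_measures_def algebra_simps)
qed

lemma radon_measures_cmult:
  assumes "\<nu> \<in> radon_measures"
  shows "(\<lambda>f. c * \<nu> f) \<in> radon_measures"
proof -
  have "\<exists>M. \<forall>f\<in>Cc. {x. f x \<noteq> 0} \<subseteq> K \<longrightarrow> \<bar>c * \<nu> f\<bar> \<le> M * (SUP x. \<bar>f x\<bar>)" if K: "compact K" for K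
  proof -
    obtain M where M: "\<And>f B. f \<in> Cc \<Longrightarrow> {x. f x \<noteq> 0} \<subseteq> K \<Longrightarrow> (\<And>x. \<bar>f x\<bar> \<le> B) \<Longrightarrow> \<bar>\<nu> f\<bar> \<le> M * B"
      using radon_bound[OF assms K] by metis
    have "\<bar>c * \<nu> f\<bar> \<le> (\<bar>c\<bar> * M) * (SUP x. \<bar>f x\<bar>)" if "f \<in> Cc" "{x. f x \<noteq> 0} \<subseteq> K" for f
      using mult_left_mono[OF M[OF that Cc_le_SUP[OF that(1)]], of "\<bar>c\<bar>"] by (simp add: abs_mult)
    then show ?thesis
      by (intro exI ballI impI)
  qed
  then show ?thesis
    using assms by (auto simp: radon_measures_def algebra_simps)
qed

lemma radon_measures_uminus: "\<nu> \<in> radon_measures \<Longrightarrow> - \<nu> \<in> radon_measures"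
  using radon_measures_cmult[of \<nu> "-1"] by (simp add: fun_Compl_def)

lemma radon_measures_diff: "\<mu> \<in> radon_measures \<Longrightarrow> \<nu> \<in> radon_measures \<Longrightarrow> \<mu> - \<nu> \<in> radon_measures"
  using radon_measures_add[OF _ radon_measures_uminus, of \<mu> \<nu>] by simp

lemma radon_measures_0: "(\<lambda>_. 0) \<in> radon_measures"
  by (auto simp: radon_measures_def intro!: exI[of _ 0])

lemma radon_eqI:
  assumes "\<mu> \<in> radon_measures" "\<nu> \<in> radon_measures"
    and "\<And>f. f \<in> Cc \<Longrightarrow> (\<And>x. 0 \<le> f x) \<Longrightarrow> \<mu> f = \<nu> f"
  shows "\<mu> = \<nu>"
proof
  fix f :: "'a \<Rightarrow> real"
  show "\<mu> f = \<nu> f"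
  proof (cases "f \<in> Cc")
    case True
    have "(\<lambda>x. max 0 (f x) - max 0 (- f x)) = f"
      by auto
    then have "\<rho> f = \<rho> (\<lambda>x. max 0 (f x)) - \<rho> (\<lambda>x. max 0 (- f x))" if "\<rho> \<in> radon_measures" for \<rho>
      using radon_diff[OF that Cc_pos[OF True] Cc_pos[OF Cc_minus[OF True]]] by simp
    moreover have "\<mu> (\<lambda>x. max 0 (f x)) = \<nu> (\<lambda>x. max 0 (f x))" "\<mu> (\<lambda>x. max 0 (- f x)) = \<nu> (\<lambda>x. max 0 (- f x))"
      using True by (auto intro!: assms(3) Cc_pos Cc_minus)
    ultimately show ?thesis
      using assms(1,2) by metis
  qed (simp add: assms radon_outside)
qed

text \<open>Positivity implies continuity: if \<open>h = 1\<close> on \<open>K\<close> and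
  \<open>f\<close> vanishes off \<open>K\<close>, then both \<open>f\<close> and \<open>- f\<close>
  lie below the supremum norm of \<open>f\<close> times \<open>h\<close>, so \<open>\<nu> h\<close>
  serves as the constant.\<close>

lemma pos_radonI:
  fixes \<nu> :: "('a::t2_space \<Rightarrow> real) \<Rightarrow> real"
  assumes lc: "locally_compact_space (euclidean :: 'a topology)"
    and add: "\<And>f g. f \<in> Cc \<Longrightarrow> g \<in> Cc \<Longrightarrow> \<nu> (\<lambda>x. f x + g x) = \<nu> f + \<nu> g"
    and cmult: "\<And>c f. f \<in> Cc \<Longrightarrow> \<nu> (\<lambda>x. c * f x) = c * \<nu> f"
    and nonneg: "\<And>f. f \<in> Cc \<Longrightarrow> (\<And>x. 0 \<le> f x) \<Longrightarrow> 0 \<le> \<nu> f"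
    and outside: "\<And>f. f \<notin> Cc \<Longrightarrow> \<nu> f = 0"
  shows "\<nu> \<in> pos_radon_measures"
proof -
  have "\<exists>M. \<forall>f\<in>Cc. {x. f x \<noteq> 0} \<subseteq> K \<longrightarrow> \<bar>\<nu> f\<bar> \<le> M * (SUP x. \<bar>f x\<bar>)" if K: "compact K" for K
  proof -
    obtain h where h: "h \<in> Cc" "\<And>x. 0 \<le> h x" "\<And>x. h x \<le> 1" "\<And>x. x \<in> K \<Longrightarrow> h x = 1"
      using Cc_Urysohn_compact[OF lc K] by blast
    have "\<bar>\<nu> f\<bar> \<le> \<nu> h * (SUP x. \<bar>f x\<bar>)" if f: "f \<in> Cc" "{x. f x \<noteq> 0} \<subseteq> K" for f
    proof -
      define S where "S = (SUP x. \<bar>f x\<bar>)"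
      have S: "\<bar>f x\<bar> \<le> S * h x" for x
      proof (cases "x \<in> K")
        case True
        then show ?thesis
          using Cc_le_SUP[OF f(1), of x] h(4) by (simp add: S_def)
      next
        case False
        then have "f x = 0"
          using f(2) by auto
        moreover have "0 \<le> S"
          using order.trans[OF abs_ge_zero Cc_le_SUP[OF f(1), of x]] by (simp add: S_def)
        ultimately show ?thesis
          using h(2) by simp
      qed
      have Sh: "(\<lambda>x. S * h x) \<in> Cc" "\<nu> (\<lambda>x. S * h x) = S * \<nu> h"
        using h cmult Cc_cmult by auto
      have "0 \<le> \<nu> (\<lambda>x. S * h x + f x)"
        using S by (intro nonneg Cc_add Sh f) (smt (verit))
      moreover have "0 \<le> \<nu> (\<lambda>x. S * h x + (-1) * f x)"
        using S by (intro nonneg Cc_add Sh f Cc_cmult) (smt (verit))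
      moreover have "\<nu> (\<lambda>x. S * h x + (-1) * f x) = S * \<nu> h + (- 1) * \<nu> f"
        using add[OF Sh(1) Cc_cmult[OF f(1), of "-1"]] cmult[OF f(1), of "-1"] Sh(2) by simp
      moreover have "\<nu> (\<lambda>x. S * h x + f x) = S * \<nu> h + \<nu> f"
        using add[OF Sh(1) f(1)] Sh(2) by simp
      ultimately show ?thesis
        by (auto simp: S_def mult.commute)
    qed
    then show ?thesis
      by (intro exI ballI impI)
  qed
  then show ?thesis
    using assms by (auto simp: pos_radon_measures_def radon_measures_def)
qed

lemma pos_radon_imp_radon: "\<nu> \<in> pos_radon_measures \<Longrightarrow> \<nu> \<in> radon_measures"
  by (simp add: pos_radon_measures_def)

lemma pos_radon_nonneg: "\<nu> \<in> pos_radon_measures \<Longrightarrow> (\<And>x. 0 \<le> f x) \<Longrightarrow> 0 \<le> \<nu> f"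
  by (cases "f \<in> Cc") (auto simp: pos_radon_measures_def radon_measures_def)

lemma pos_radon_mono:
  assumes "\<nu> \<in> pos_radon_measures" "f \<in> Cc" "g \<in> Cc" "\<And>x. f x \<le> g x"
  shows "\<nu> f \<le> \<nu> g"
  using pos_radon_nonneg[OF assms(1), of "\<lambda>x. g x - f x"] assms radon_diff[of \<nu> g f]
  by (simp add: pos_radon_imp_radon)

lemma pos_radon_add: "\<mu> \<in> pos_radon_measures \<Longrightarrow> \<nu> \<in> pos_radon_measures \<Longrightarrow> \<mu> + \<nu> \<in> pos_radon_measures"
  using radon_measures_add by (auto simp: pos_radon_measures_def)

lemma pos_radon_cmult: "\<nu> \<in> pos_radon_measures \<Longrightarrow> 0 \<le> c \<Longrightarrow> (\<lambda>f. c * \<nu> f) \<in> pos_radon_measures"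
  using radon_measures_cmult by (auto simp: pos_radon_measures_def)

lemma pos_radon_0: "(\<lambda>_. 0) \<in> pos_radon_measures"
  using radon_measures_0 by (auto simp: pos_radon_measures_def)

section \<open>The vector lattice order on Radon measures\<close>

definition radon_le :: "(('a::t2_space \<Rightarrow> real) \<Rightarrow> real) \<Rightarrow> (('a \<Rightarrow> real) \<Rightarrow> real) \<Rightarrow> bool" where
  "radon_le \<mu> \<nu> \<longleftrightarrow> (\<forall>f\<in>Cc. (\<forall>x. 0 \<le> f x) \<longrightarrow> \<mu> f \<le> \<nu> f)"

lemma radon_leD: "radon_le \<mu> \<nu> \<Longrightarrow> f \<in> Cc \<Longrightarrow> (\<And>x. 0 \<le> f x) \<Longrightarrow> \<mu> f \<le> \<nu> f"
  by (simp add: radon_le_def)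

lemma radon_le_refl [simp]: "radon_le \<mu> \<mu>"
  by (simp add: radon_le_def)

lemma radon_le_trans [trans]: "radon_le \<rho> \<mu> \<Longrightarrow> radon_le \<mu> \<nu> \<Longrightarrow> radon_le \<rho> \<nu>"
  unfolding radon_le_def using order.trans by blast

lemma radon_le_antisym:
  "\<mu> \<in> radon_measures \<Longrightarrow> \<nu> \<in> radon_measures \<Longrightarrow> radon_le \<mu> \<nu> \<Longrightarrow> radon_le \<nu> \<mu> \<Longrightarrow> \<mu> = \<nu>"
  by (rule radon_eqI) (auto simp: radon_le_def intro: order.antisym)

lemma pos_radon_diff:
  "\<mu> \<in> radon_measures \<Longrightarrow> \<nu> \<in> radon_measures \<Longrightarrow> radon_le \<nu> \<mu> \<Longrightarrow> \<mu> - \<nu> \<in> pos_radon_measures"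
  using radon_measures_diff by (auto simp: pos_radon_measures_def radon_le_def)

lemma radon_le_add: "\<nu> \<in> pos_radon_measures \<Longrightarrow> radon_le \<mu> (\<mu> + \<nu>)" "\<nu> \<in> pos_radon_measures \<Longrightarrow> radon_le \<mu> (\<nu> + \<mu>)"
  by (auto simp: radon_le_def pos_radon_nonneg)

section \<open>The Jordan decomposition\<close>

text \<open>The positive part on nonnegative functions, isolated because it is additive there. If
  \<open>h\<close> has a negative value, the supremum is taken over the empty set and means
  nothing.\<close>

definition radon_sup :: "(('a::t2_space \<Rightarrow> real) \<Rightarrow> real) \<Rightarrow> ('a \<Rightarrow> real) \<Rightarrow> real" where
  "radon_sup \<nu> h = (SUP g\<in>{g \<in> Cc. \<forall>x. 0 \<le> g x \<and> g x \<le> h x}. \<nu> g)"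

lemma radon_pos_part_alt:
  "radon_pos_part \<nu> f =
     (if f \<in> Cc then radon_sup \<nu> (\<lambda>x. max 0 (f x)) - radon_sup \<nu> (\<lambda>x. max 0 (- f x)) else 0)"
  by (simp add: radon_pos_part_def radon_sup_def Let_def)

lemma radon_sup_upper:
  assumes "\<nu> \<in> radon_measures" "h \<in> Cc" "g \<in> Cc" "\<And>x. 0 \<le> g x" "\<And>x. g x \<le> h x"
  shows "\<nu> g \<le> radon_sup \<nu> h"
proof -
  obtain K where K: "compact K" "{x. h x \<noteq> 0} \<subseteq> K"
    using assms(2) by (rule CcE)
  obtain B where B: "\<And>x. \<bar>h x\<bar> \<le> B"
    using Cc_bounded[OF assms(2)] by metis
  obtain M where M: "\<And>f B. f \<in> Cc \<Longrightarrow> {x. f x \<noteq> 0} \<subseteq> K \<Longrightarrow> (\<And>x. \<bar>f x\<bar> \<le> B) \<Longrightarrow> \<bar>\<nu> f\<bar> \<le> M * B"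
    using radon_bound[OF assms(1) K(1)] by metis
  have "\<nu> f \<le> M * B" if f: "f \<in> Cc" "\<forall>x. 0 \<le> f x \<and> f x \<le> h x" for f
  proof -
    have "f x = 0" if "h x = 0" for x
      using f(2)[rule_format, of x] that by simp
    then have "{x. f x \<noteq> 0} \<subseteq> {x. h x \<noteq> 0}"
      by auto
    moreover have "\<bar>f x\<bar> \<le> B" for x
      using f(2) B[of x] by (smt (verit))
    ultimately show ?thesis
      using M[OF f(1) order.trans[OF _ K(2)], of B] by auto
  qed
  then have "bdd_above (\<nu> ` {g \<in> Cc. \<forall>x. 0 \<le> g x \<and> g x \<le> h x})"
    by (intro bdd_aboveI2[of _ _ "M * B"]) auto
  then show ?thesis
    unfolding radon_sup_def using assms by (intro cSUP_upper) auto
qed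

lemma radon_sup_least:
  assumes "\<And>x. 0 \<le> h x" "\<And>g. g \<in> Cc \<Longrightarrow> (\<And>x. 0 \<le> g x) \<Longrightarrow> (\<And>x. g x \<le> h x) \<Longrightarrow> \<nu> g \<le> c"
  shows "radon_sup \<nu> h \<le> c"
  unfolding radon_sup_def
proof (rule cSUP_least)
  have "(\<lambda>_. 0) \<in> {g \<in> Cc. \<forall>x. 0 \<le> g x \<and> g x \<le> h x}"
    using assms(1) by simp
  then show "{g \<in> Cc. \<forall>x. 0 \<le> g x \<and> g x \<le> h x} \<noteq> {}"
    by (metis empty_iff)
qed (use assms(2) in auto)

lemma radon_sup_nonneg:
  "\<nu> \<in> radon_measures \<Longrightarrow> h \<in> Cc \<Longrightarrow> (\<And>x. 0 \<le> h x) \<Longrightarrow> 0 \<le> radon_sup \<nu> h"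
  using radon_sup_upper[of \<nu> h "\<lambda>_. 0"] by simp

lemma radon_sup_0: "\<nu> \<in> radon_measures \<Longrightarrow> radon_sup \<nu> (\<lambda>_. 0) = 0"
proof (rule order.antisym)
  assume \<nu>: "\<nu> \<in> radon_measures"
  show "radon_sup \<nu> (\<lambda>_. 0) \<le> 0"
  proof (rule radon_sup_least)
    fix g :: "'a \<Rightarrow> real" assume "\<And>x. 0 \<le> g x" "\<And>x. g x \<le> 0"
    then have "g = (\<lambda>_. 0)"
      by (auto intro: order.antisym)
    then show "\<nu> g \<le> 0"
      using \<nu> by simp
  qed simp
qed (simp add: radon_sup_nonneg)

text \<open>The splitting of \<open>g\<close> into \<open>min g f\<close> and the remainder is the
  Riesz decomposition for functions: the first lies below \<open>f\<close>, the second below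
  \<open>h\<close>. This gives one inequality; the other adds test functions.\<close>

lemma radon_sup_add:
  assumes \<nu>: "\<nu> \<in> radon_measures"
    and f: "f \<in> Cc" "\<And>x. 0 \<le> f x" and h: "h \<in> Cc" "\<And>x. 0 \<le> h x"
  shows "radon_sup \<nu> (\<lambda>x. f x + h x) = radon_sup \<nu> f + radon_sup \<nu> h"
proof (rule order.antisym)
  show "radon_sup \<nu> (\<lambda>x. f x + h x) \<le> radon_sup \<nu> f + radon_sup \<nu> h"
  proof (rule radon_sup_least)
    fix g :: "'a \<Rightarrow> real" assume g: "g \<in> Cc" "\<And>x. 0 \<le> g x" "\<And>x. g x \<le> f x + h x"
    let ?g1 = "\<lambda>x. min (g x) (f x)" and ?g2 = "\<lambda>x. g x - min (g x) (f x)"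
    have c: "?g1 \<in> Cc" "?g2 \<in> Cc"
      using g f by (auto intro!: Cc_min Cc_diff)
    have "\<nu> ?g1 \<le> radon_sup \<nu> f"
      using f g c by (intro radon_sup_upper \<nu>) auto
    moreover have "\<nu> ?g2 \<le> radon_sup \<nu> h"
      using f h g c by (intro radon_sup_upper \<nu>) (auto simp: min_def algebra_simps)
    moreover have "\<nu> g = \<nu> ?g1 + \<nu> ?g2"
      using radon_add[OF \<nu> c] by simp
    ultimately show "\<nu> g \<le> radon_sup \<nu> f + radon_sup \<nu> h"
      by simp
  qed (simp add: f h)
  have "radon_sup \<nu> f \<le> radon_sup \<nu> (\<lambda>x. f x + h x) - radon_sup \<nu> h"
  proof (rule radon_sup_least[OF f(2)])
    fix g1 :: "'a \<Rightarrow> real" assume g1: "g1 \<in> Cc" "\<And>x. 0 \<le> g1 x" "\<And>x. g1 x \<le> f x"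
    have "radon_sup \<nu> h \<le> radon_sup \<nu> (\<lambda>x. f x + h x) - \<nu> g1"
    proof (rule radon_sup_least[OF h(2)])
      fix g2 :: "'a \<Rightarrow> real" assume g2: "g2 \<in> Cc" "\<And>x. 0 \<le> g2 x" "\<And>x. g2 x \<le> h x"
      have "\<nu> (\<lambda>x. g1 x + g2 x) \<le> radon_sup \<nu> (\<lambda>x. f x + h x)"
        using f h g1 g2 by (intro radon_sup_upper \<nu> Cc_add) (auto intro: add_mono)
      then show "\<nu> g2 \<le> radon_sup \<nu> (\<lambda>x. f x + h x) - \<nu> g1"
        using radon_add[OF \<nu> g1(1) g2(1)] by simp
    qed
    then show "\<nu> g1 \<le> radon_sup \<nu> (\<lambda>x. f x + h x) - radon_sup \<nu> h"
      by simp
  qed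
  then show "radon_sup \<nu> f + radon_sup \<nu> h \<le> radon_sup \<nu> (\<lambda>x. f x + h x)"
    by simp
qed

lemma radon_sup_cmult:
  assumes \<nu>: "\<nu> \<in> radon_measures" and f: "f \<in> Cc" "\<And>x. 0 \<le> f x" and c: "0 \<le> c"
  shows "radon_sup \<nu> (\<lambda>x. c * f x) = c * radon_sup \<nu> f"
proof (cases "c = 0")
  case False
  have le: "radon_sup \<nu> (\<lambda>x. c * f x) \<le> c * radon_sup \<nu> f"
    if f: "f \<in> Cc" "\<And>x. 0 \<le> f x" and c: "0 < c" for c f
  proof (rule radon_sup_least)
    fix g :: "'a \<Rightarrow> real" assume g: "g \<in> Cc" "\<And>x. 0 \<le> g x" "\<And>x. g x \<le> c * f x"
    have "\<nu> (\<lambda>x. (1 / c) * g x) \<le> radon_sup \<nu> f"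
      using g f c by (intro radon_sup_upper \<nu> Cc_cmult) (auto simp: field_simps)
    then show "\<nu> g \<le> c * radon_sup \<nu> f"
      using radon_cmult[OF \<nu> g(1), of "1 / c"] c by (simp add: pos_divide_le_eq mult.commute)
  qed (use f c in auto)
  \<comment> \<open>The reverse inequality is the one just proved, with the factor
    \<open>1 / c\<close>.\<close>
  have "radon_sup \<nu> (\<lambda>x. (1 / c) * (c * f x)) \<le> (1 / c) * radon_sup \<nu> (\<lambda>x. c * f x)"
    using f c False by (intro le Cc_cmult) auto
  then have "c * radon_sup \<nu> f \<le> radon_sup \<nu> (\<lambda>x. c * f x)"
    using c False by (simp add: field_simps)
  then show ?thesis
    using le[OF f, of c] c False by auto
qed (simp add: radon_sup_0 \<nu>)

text \<open>The definition splits a function in one particular way. Any other splitting into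
  nonnegative functions differs from it by a common summand, which cancels by additivity on the
  cone; additivity of the positive part follows.\<close>

lemma radon_pos_part_diff:
  assumes \<nu>: "\<nu> \<in> radon_measures"
    and u: "u \<in> Cc" "\<And>x. 0 \<le> u x" and v: "v \<in> Cc" "\<And>x. 0 \<le> v x"
  shows "radon_pos_part \<nu> (\<lambda>x. u x - v x) = radon_sup \<nu> u - radon_sup \<nu> v"
proof -
  let ?p = "\<lambda>x. max 0 (u x - v x)" and ?n = "\<lambda>x. max 0 (- (u x - v x))"
  have c: "?p \<in> Cc" "?n \<in> Cc" "(\<lambda>x. u x - v x) \<in> Cc"
    using u v by (auto intro!: Cc_pos Cc_diff Cc_minus simp del: minus_diff_eq)
  have "(\<lambda>x. ?p x + v x) = (\<lambda>x. ?n x + u x)"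
    by auto
  moreover have "radon_sup \<nu> (\<lambda>x. ?p x + v x) = radon_sup \<nu> ?p + radon_sup \<nu> v"
    using c v by (intro radon_sup_add \<nu>) auto
  moreover have "radon_sup \<nu> (\<lambda>x. ?n x + u x) = radon_sup \<nu> ?n + radon_sup \<nu> u"
    using c u by (intro radon_sup_add \<nu>) auto
  ultimately have "radon_sup \<nu> ?p + radon_sup \<nu> v = radon_sup \<nu> ?n + radon_sup \<nu> u"
    by metis
  then show ?thesis
    using c(3) by (simp only: radon_pos_part_alt) simp
qed

lemma radon_pos_part_nonneg_arg:
  assumes "\<nu> \<in> radon_measures" "f \<in> Cc" "\<And>x. 0 \<le> f x"
  shows "radon_pos_part \<nu> f = radon_sup \<nu> f"
  using radon_pos_part_diff[OF assms, of "\<lambda>_. 0"] assms(1) by (simp add: radon_sup_0)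

lemma radon_pos_part_in_pos_radon:
  fixes \<nu> :: "('a::t2_space \<Rightarrow> real) \<Rightarrow> real"
  assumes lc: "locally_compact_space (euclidean :: 'a topology)" and \<nu>: "\<nu> \<in> radon_measures"
  shows "radon_pos_part \<nu> \<in> pos_radon_measures"
proof (rule pos_radonI[OF lc])
  fix f :: "'a \<Rightarrow> real" assume f: "f \<in> Cc"
  let ?p = "\<lambda>f x. max 0 (f x :: real)" and ?n = "\<lambda>f x. max 0 (- f x :: real)"
  have cp: "?p f \<in> Cc" "?n f \<in> Cc" if "f \<in> Cc" for f :: "'a \<Rightarrow> real"
    using that by (auto intro!: Cc_pos Cc_minus)
  have eq: "radon_pos_part \<nu> f = radon_sup \<nu> (?p f) - radon_sup \<nu> (?n f)" if "f \<in> Cc" for f :: "'a \<Rightarrow> real"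
    using that by (simp add: radon_pos_part_alt)
  {
    fix g :: "'a \<Rightarrow> real" assume g: "g \<in> Cc"
    have "radon_pos_part \<nu> (\<lambda>x. (?p f x + ?p g x) - (?n f x + ?n g x))
        = radon_sup \<nu> (\<lambda>x. ?p f x + ?p g x) - radon_sup \<nu> (\<lambda>x. ?n f x + ?n g x)"
      using cp f g by (intro radon_pos_part_diff \<nu> Cc_add) auto
    also have "\<dots> = (radon_sup \<nu> (?p f) + radon_sup \<nu> (?p g)) - (radon_sup \<nu> (?n f) + radon_sup \<nu> (?n g))"
      using cp f g by (subst (1 2) radon_sup_add[OF \<nu>]) auto
    also have "\<dots> = radon_pos_part \<nu> f + radon_pos_part \<nu> g"
      by (simp add: eq f g)
    also have "(\<lambda>x. (?p f x + ?p g x) - (?n f x + ?n g x)) = (\<lambda>x. f x + g x)"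
      by auto
    finally show "radon_pos_part \<nu> (\<lambda>x. f x + g x) = radon_pos_part \<nu> f + radon_pos_part \<nu> g" .
  }
  show "radon_pos_part \<nu> (\<lambda>x. c * f x) = c * radon_pos_part \<nu> f" for c
  proof (cases "0 \<le> c")
    case True
    have "radon_pos_part \<nu> (\<lambda>x. c * ?p f x - c * ?n f x) = c * radon_sup \<nu> (?p f) - c * radon_sup \<nu> (?n f)"
      using cp f True by (subst radon_pos_part_diff[OF \<nu>]) (auto intro!: Cc_cmult simp: radon_sup_cmult[OF \<nu>])
    also have "(\<lambda>x. c * ?p f x - c * ?n f x) = (\<lambda>x. c * f x)"
      by (auto simp: max_def)
    finally show ?thesis
      by (simp add: eq f algebra_simps)
  next
    case False
    \<comment> \<open>A negative factor exchanges the positive and negative parts of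
      \<open>f\<close>, after which scaling by the nonnegative \<open>d\<close> applies.\<close>
    define d where "d = - c"
    have d: "0 \<le> d" "c = - d"
      using False by (auto simp: d_def)
    have "radon_pos_part \<nu> (\<lambda>x. d * ?n f x - d * ?p f x) = d * radon_sup \<nu> (?n f) - d * radon_sup \<nu> (?p f)"
      using cp f d(1) by (subst radon_pos_part_diff[OF \<nu>]) (auto intro!: Cc_cmult simp: radon_sup_cmult[OF \<nu>])
    also have "(\<lambda>x. d * ?n f x - d * ?p f x) = (\<lambda>x. c * f x)"
      by (auto simp: max_def d(2))
    finally show ?thesis
      by (simp add: eq f d(2) algebra_simps)
  qed
  show "0 \<le> radon_pos_part \<nu> f" if "\<And>x. 0 \<le> f x"
    using radon_pos_part_nonneg_arg[OF \<nu> f that] radon_sup_nonneg[OF \<nu> f that] by simp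
qed (simp add: radon_pos_part_alt)

lemma radon_neg_part_in_pos_radon:
  fixes \<nu> :: "('a::t2_space \<Rightarrow> real) \<Rightarrow> real"
  assumes "locally_compact_space (euclidean :: 'a topology)" "\<nu> \<in> radon_measures"
  shows "radon_neg_part \<nu> \<in> pos_radon_measures"
  using assms by (simp add: radon_neg_part_def radon_pos_part_in_pos_radon radon_measures_uminus)

text \<open>The map \<open>g \<mapsto> f - g\<close> permutes the test functions between 0 and
  \<open>f\<close>, so the supremum of \<open>\<nu>\<close> over them is \<open>\<nu> f\<close> plus
  the supremum of \<open>- \<nu>\<close>.\<close>

lemma Jordan_decomposition:
  fixes \<nu> :: "('a::t2_space \<Rightarrow> real) \<Rightarrow> real"
  assumes lc: "locally_compact_space (euclidean :: 'a topology)" and \<nu>: "\<nu> \<in> radon_measures"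
  shows "radon_pos_part \<nu> - radon_neg_part \<nu> = \<nu>"
proof (rule radon_eqI)
  show "radon_pos_part \<nu> - radon_neg_part \<nu> \<in> radon_measures"
    using assms by (intro radon_measures_diff pos_radon_imp_radon[OF radon_pos_part_in_pos_radon]
        pos_radon_imp_radon[OF radon_neg_part_in_pos_radon])
  fix f :: "'a \<Rightarrow> real" assume f: "f \<in> Cc" "\<And>x. 0 \<le> f x"
  have \<nu>': "- \<nu> \<in> radon_measures"
    using \<nu> by (rule radon_measures_uminus)
  have fg: "(\<lambda>x. f x - g x) \<in> Cc" "\<nu> (\<lambda>x. f x - g x) = \<nu> f - \<nu> g" if "g \<in> Cc" for g :: "'a \<Rightarrow> real"
    using that f \<nu> by (auto intro: Cc_diff simp: radon_diff)
  have "radon_sup \<nu> f \<le> \<nu> f + radon_sup (- \<nu>) f"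
  proof (rule radon_sup_least[OF f(2)])
    fix g :: "'a \<Rightarrow> real" assume g: "g \<in> Cc" "\<And>x. 0 \<le> g x" "\<And>x. g x \<le> f x"
    have "(- \<nu>) (\<lambda>x. f x - g x) \<le> radon_sup (- \<nu>) f"
      using f g fg by (intro radon_sup_upper \<nu>') auto
    then show "\<nu> g \<le> \<nu> f + radon_sup (- \<nu>) f"
      using fg g by simp
  qed
  moreover have "radon_sup (- \<nu>) f \<le> radon_sup \<nu> f - \<nu> f"
  proof (rule radon_sup_least[OF f(2)])
    fix g :: "'a \<Rightarrow> real" assume g: "g \<in> Cc" "\<And>x. 0 \<le> g x" "\<And>x. g x \<le> f x"
    have "\<nu> (\<lambda>x. f x - g x) \<le> radon_sup \<nu> f"
      using f g fg by (intro radon_sup_upper \<nu>) auto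
    then show "(- \<nu>) g \<le> radon_sup \<nu> f - \<nu> f"
      using fg g by simp
  qed
  ultimately show "(radon_pos_part \<nu> - radon_neg_part \<nu>) f = \<nu> f"
    using f \<nu> \<nu>' by (simp add: radon_pos_part_nonneg_arg radon_neg_part_def)
qed fact

text \<open>Leastness, from \<open>\<nu> g \<le> \<pi> g \<le> \<pi> f\<close> for
  \<open>0 \<le> g \<le> f\<close>, is what yields the lattice infimum and the Riesz decomposition
  below.\<close>

lemma radon_pos_part_least:
  assumes "\<nu> \<in> radon_measures" "\<pi> \<in> pos_radon_measures" "radon_le \<nu> \<pi>"
  shows "radon_le (radon_pos_part \<nu>) \<pi>"
  unfolding radon_le_def
proof (intro ballI impI)
  fix f :: "'a \<Rightarrow> real" assume f: "f \<in> Cc" "\<forall>x. 0 \<le> f x"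
  have "radon_sup \<nu> f \<le> \<pi> f"
  proof (rule radon_sup_least)
    fix g :: "'a \<Rightarrow> real" assume g: "g \<in> Cc" "\<And>x. 0 \<le> g x" "\<And>x. g x \<le> f x"
    then show "\<nu> g \<le> \<pi> f"
      using radon_leD[OF assms(3), of g] pos_radon_mono[OF assms(2) g(1) f(1)] by force
  qed (use f in auto)
  then show "radon_pos_part \<nu> f \<le> \<pi> f"
    using f assms(1) by (simp add: radon_pos_part_nonneg_arg)
qed

lemma radon_le_pos_part: "\<nu> \<in> radon_measures \<Longrightarrow> radon_le \<nu> (radon_pos_part \<nu>)"
  by (auto simp: radon_le_def radon_pos_part_nonneg_arg intro: radon_sup_upper)

lemma radon_diff_le_self: "\<nu> \<in> pos_radon_measures \<Longrightarrow> radon_le (\<mu> - \<nu>) \<mu>"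
  by (auto simp: radon_le_def pos_radon_nonneg)

text \<open>The measure \<open>\<pi>\<close> below is the lattice infimum of \<open>\<mu>\<close> and \<open>\<nu>\<close>.\<close>

lemma Jordan_minimal:
  fixes \<mu> \<nu> :: "('a::t2_space \<Rightarrow> real) \<Rightarrow> real"
  assumes lc: "locally_compact_space (euclidean :: 'a topology)"
    and \<mu>: "\<mu> \<in> pos_radon_measures" and \<nu>: "\<nu> \<in> pos_radon_measures"
  obtains \<pi> where "\<pi> \<in> pos_radon_measures"
    "\<mu> = radon_pos_part (\<mu> - \<nu>) + \<pi>" "\<nu> = radon_neg_part (\<mu> - \<nu>) + \<pi>"
proof (rule that)
  let ?\<pi> = "\<mu> - radon_pos_part (\<mu> - \<nu>)"
  have d: "\<mu> - \<nu> \<in> radon_measures"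
    using \<mu> \<nu> by (intro radon_measures_diff pos_radon_imp_radon)
  have p: "radon_pos_part (\<mu> - \<nu>) \<in> pos_radon_measures"
    by (rule radon_pos_part_in_pos_radon[OF lc d])
  show "?\<pi> \<in> pos_radon_measures"
    by (rule pos_radon_diff[OF pos_radon_imp_radon[OF \<mu>] pos_radon_imp_radon[OF p]
          radon_pos_part_least[OF d \<mu> radon_diff_le_self[OF \<nu>]]])
  show "\<mu> = radon_pos_part (\<mu> - \<nu>) + ?\<pi>"
    by auto
  have "radon_pos_part (\<mu> - \<nu>) f - radon_neg_part (\<mu> - \<nu>) f = \<mu> f - \<nu> f" for f
    using fun_cong[OF Jordan_decomposition[OF lc d], of f] by simp
  then show "\<nu> = radon_neg_part (\<mu> - \<nu>) + ?\<pi>"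
    by (auto simp: fun_eq_iff algebra_simps)
qed

text \<open>Split off the infimum with \<open>\<nu>\<close>. What is left is
  \<open>radon_pos_part (\<mu> - \<nu>)\<close>, which lies below \<open>\<rho>\<close> because
  \<open>\<rho>\<close> is a positive measure above \<open>\<mu> - \<nu>\<close>.\<close>

lemma radon_Riesz_decomposition:
  fixes \<mu> \<nu> \<rho> :: "('a::t2_space \<Rightarrow> real) \<Rightarrow> real"
  assumes lc: "locally_compact_space (euclidean :: 'a topology)"
    and \<mu>: "\<mu> \<in> pos_radon_measures" and \<nu>: "\<nu> \<in> pos_radon_measures" and \<rho>: "\<rho> \<in> pos_radon_measures"
    and le: "radon_le \<mu> (\<nu> + \<rho>)"
  obtains \<mu>1 \<mu>2 where "\<mu>1 \<in> pos_radon_measures" "\<mu>2 \<in> pos_radon_measures" "\<mu> = \<mu>1 + \<mu>2"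
    "radon_le \<mu>1 \<nu>" "radon_le \<mu>2 \<rho>"
proof -
  obtain \<pi> where \<pi>: "\<pi> \<in> pos_radon_measures"
    "\<mu> = radon_pos_part (\<mu> - \<nu>) + \<pi>" "\<nu> = radon_neg_part (\<mu> - \<nu>) + \<pi>"
    using Jordan_minimal[OF lc \<mu> \<nu>] .
  have d: "\<mu> - \<nu> \<in> radon_measures"
    using \<mu> \<nu> by (intro radon_measures_diff pos_radon_imp_radon)
  show thesis
  proof (rule that)
    show "\<mu> = \<pi> + radon_pos_part (\<mu> - \<nu>)"
      using \<pi>(2) by (metis add.commute)
    show "radon_le \<pi> \<nu>"
      by (metis \<pi>(3) lc d radon_le_add(2) radon_neg_part_in_pos_radon)
    show "radon_le (radon_pos_part (\<mu> - \<nu>)) \<rho>"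
      using le by (intro radon_pos_part_least d \<rho>) (auto simp: radon_le_def)
  qed (auto intro: \<pi> radon_pos_part_in_pos_radon lc d)
qed

lemma radon_pos_part_pos:
  fixes \<mu> :: "('a::t2_space \<Rightarrow> real) \<Rightarrow> real"
  assumes lc: "locally_compact_space (euclidean :: 'a topology)" and \<mu>: "\<mu> \<in> pos_radon_measures"
  shows "radon_pos_part \<mu> = \<mu>"
  using assms by (intro radon_le_antisym radon_pos_part_least radon_le_pos_part pos_radon_imp_radon
      radon_pos_part_in_pos_radon) auto

lemma radon_neg_part_pos:
  fixes \<mu> :: "('a::t2_space \<Rightarrow> real) \<Rightarrow> real"
  assumes lc: "locally_compact_space (euclidean :: 'a topology)" and \<mu>: "\<mu> \<in> pos_radon_measures"
  shows "radon_neg_part \<mu> = (\<lambda>_. 0)"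
proof -
  have "radon_pos_part \<mu> f - radon_neg_part \<mu> f = \<mu> f" for f
    using fun_cong[OF Jordan_decomposition[OF lc pos_radon_imp_radon[OF \<mu>]], of f] by simp
  then show ?thesis
    using radon_pos_part_pos[OF assms] by auto
qed

section \<open>Products of Radon measures\<close>

lemma Cc_slice:
  fixes F :: "'a::t2_space \<times> 'b::t2_space \<Rightarrow> real"
  assumes "F \<in> Cc"
  shows "(\<lambda>y. F (x, y)) \<in> Cc"
  using assms
proof (rule CcE)
  fix K assume K: "continuous_on UNIV F" "compact K" "{z. F z \<noteq> 0} \<subseteq> K"
  show ?thesis
  proof (rule CcI)
    show "continuous_on UNIV (\<lambda>y. F (x, y))"
      by (intro continuous_on_compose2[OF K(1)] continuous_intros) auto
    show "compact (snd ` K)"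
      using K(2) by (intro compact_continuous_image continuous_intros)
    show "{y. F (x, y) \<noteq> 0} \<subseteq> snd ` K"
      using K(3) by force
  qed
qed

text \<open>This ensures that the outer functional in \<open>radon_tensor\<close> is not evaluated
  at a function outside \<open>Cc\<close>. All slices vanish off the second projection of
  \<open>K\<close>, so one bound \<open>M\<close> serves them all; compactness makes nearby slices
  uniformly close without any metric on the spaces.\<close>

lemma Cc_radon_slice:
  fixes F :: "'a::t2_space \<times> 'b::t2_space \<Rightarrow> real"
  assumes F: "F \<in> Cc" and \<nu>: "\<nu> \<in> radon_measures"
  shows "(\<lambda>x. \<nu> (\<lambda>y. F (x, y))) \<in> Cc"
  using F
proof (rule CcE)
  fix K assume K: "continuous_on UNIV F" "compact K" "{z. F z \<noteq> 0} \<subseteq> K"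
  have K1: "compact (fst ` K)" and K2: "compact (snd ` K)"
    using K(2) by (auto intro!: compact_continuous_image continuous_intros)
  have off: "F (x, y) = 0" if "y \<notin> snd ` K" for x y
    using K(3) that by force
  obtain M where M: "0 \<le> M"
    "\<And>f B. f \<in> Cc \<Longrightarrow> {y. f y \<noteq> 0} \<subseteq> snd ` K \<Longrightarrow> (\<And>y. \<bar>f y\<bar> \<le> B) \<Longrightarrow> \<bar>\<nu> f\<bar> \<le> M * B"
    using radon_bound[OF \<nu> K2] by metis
  show ?thesis
  proof (rule CcI[OF _ K1])
    show "{x. \<nu> (\<lambda>y. F (x, y)) \<noteq> 0} \<subseteq> fst ` K"
    proof
      fix x assume x: "x \<in> {x. \<nu> (\<lambda>y. F (x, y)) \<noteq> 0}"
      have "\<exists>y. F (x, y) \<noteq> 0"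
      proof (rule ccontr)
        assume "\<not> ?thesis"
        then have "(\<lambda>y. F (x, y)) = (\<lambda>_. 0)"
          by auto
        then show False
          using x \<nu> by simp
      qed
      then show "x \<in> fst ` K"
        using K(3) by force
    qed
    show "continuous_on UNIV (\<lambda>x. \<nu> (\<lambda>y. F (x, y)))"
      unfolding continuous_on_topological
    proof (intro ballI allI impI)
      fix x0 B assume B: "open B" "\<nu> (\<lambda>y. F (x0, y)) \<in> B"
      obtain e where e: "0 < e" "ball (\<nu> (\<lambda>y. F (x0, y))) e \<subseteq> B"
        using B openE by blast
      \<comment> \<open>The bound \<open>M\<close> may be 0 and cannot itself be the
        divisor.\<close>
      define d where "d = e / (M + 1)"
      have d: "0 < d" "M * d < e"
        using e M(1) by (auto simp: d_def field_simps)
      have "continuous_on (UNIV \<times> snd ` K) F"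
        using K(1) continuous_on_subset by blast
      then obtain X where X: "x0 \<in> X" "open X" "\<forall>x\<in>X \<inter> UNIV. \<forall>t\<in>snd ` K. dist (F (x, t)) (F (x0, t)) \<le> d"
        using continuous_on_prod_compactE[OF _ K2 UNIV_I d(1)] by metis
      have "\<nu> (\<lambda>y. F (x, y)) \<in> B" if "x \<in> X" for x
      proof -
        let ?D = "\<lambda>y. F (x, y) - F (x0, y)"
        have "\<bar>\<nu> ?D\<bar> \<le> M * d"
        proof (rule M(2))
          show "?D \<in> Cc"
            using F by (intro Cc_diff Cc_slice)
          show "{y. ?D y \<noteq> 0} \<subseteq> snd ` K"
          proof
            fix y assume "y \<in> {y. ?D y \<noteq> 0}"
            then show "y \<in> snd ` K"
              using off[of y x] off[of y x0] by (cases "y \<in> snd ` K") auto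
          qed
          show "\<bar>?D y\<bar> \<le> d" for y
            using X(3) that off[of y] d(1) by (cases "y \<in> snd ` K") (auto simp: dist_real_def)
        qed
        then show ?thesis
          using e(2) d(2) radon_diff[OF \<nu> Cc_slice[OF F] Cc_slice[OF F], of x x0]
          by (auto simp: subset_iff dist_real_def abs_minus_commute)
      qed
      then show "\<exists>A. open A \<and> x0 \<in> A \<and> (\<forall>y\<in>UNIV. y \<in> A \<longrightarrow> \<nu> (\<lambda>ya. F (y, ya)) \<in> B)"
        using X(1,2) by blast
    qed
  qed
qed

lemma radon_tensor_mono:
  assumes \<mu>: "\<mu> \<in> pos_radon_measures" and \<nu>: "\<nu> \<in> pos_radon_measures"
    and F: "F \<in> Cc" "G \<in> Cc" "\<And>z. F z \<le> G z"
  shows "radon_tensor \<mu> \<nu> F \<le> radon_tensor \<mu> \<nu> G"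
  using assms by (auto simp: radon_tensor_def
      intro!: pos_radon_mono[OF \<mu>] pos_radon_mono[OF \<nu>] Cc_radon_slice Cc_slice pos_radon_imp_radon)

lemma radon_tensor_0_left [simp]: "radon_tensor (\<lambda>_. 0) \<nu> = (\<lambda>_. 0)"
  by (auto simp: radon_tensor_def)

lemma radon_tensor_0_right [simp]: "\<mu> \<in> radon_measures \<Longrightarrow> radon_tensor \<mu> (\<lambda>_. 0) = (\<lambda>_. 0)"
  by (auto simp: radon_tensor_def)

lemma radon_tensor_add_left: "radon_tensor (\<mu>1 + \<mu>2) \<nu> F = radon_tensor \<mu>1 \<nu> F + radon_tensor \<mu>2 \<nu> F"
  by (simp add: radon_tensor_def)

lemma radon_tensor_add_right:
  assumes "\<mu> \<in> radon_measures" "\<nu>1 \<in> radon_measures" "\<nu>2 \<in> radon_measures"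
  shows "radon_tensor \<mu> (\<nu>1 + \<nu>2) F = radon_tensor \<mu> \<nu>1 F + radon_tensor \<mu> \<nu>2 F"
proof (cases "F \<in> Cc")
  case True
  show ?thesis
    using radon_add[OF assms(1) Cc_radon_slice[OF True assms(2)] Cc_radon_slice[OF True assms(3)]]
    by (simp add: radon_tensor_def)
qed (simp add: radon_tensor_def)

lemma radon_tensor_cmult_left: "radon_tensor (\<lambda>f. c * \<mu> f) \<nu> F = c * radon_tensor \<mu> \<nu> F"
  by (simp add: radon_tensor_def)

lemma radon_tensor_cmult_right:
  assumes "\<mu> \<in> radon_measures" "\<nu> \<in> radon_measures"
  shows "radon_tensor \<mu> (\<lambda>f. c * \<nu> f) F = c * radon_tensor \<mu> \<nu> F"
proof (cases "F \<in> Cc")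
  case True
  show ?thesis
    using radon_cmult[OF assms(1) Cc_radon_slice[OF True assms(2)]] by (simp add: radon_tensor_def)
qed (simp add: radon_tensor_def)

section \<open>Locally finite sums of Radon measures\<close>

text \<open>Tested on functions vanishing off \<open>K\<close> rather than on supports of measures:
  this form follows directly from the local finiteness of the plates and is the one needed to
  evaluate a sum.\<close>

definition locally_finite_family ::
    "'i set \<Rightarrow> ('i \<Rightarrow> ('a::t2_space \<Rightarrow> real) \<Rightarrow> real) \<Rightarrow> bool" where
  "locally_finite_family I \<mu> \<longleftrightarrow>
     (\<forall>K. compact K \<longrightarrow> finite {i \<in> I. \<exists>f\<in>Cc. {x. f x \<noteq> 0} \<subseteq> K \<and> \<mu> i f \<noteq> 0})"

definition radon_sum ::
    "'i set \<Rightarrow> ('i \<Rightarrow> ('a::t2_space \<Rightarrow> real) \<Rightarrow> real) \<Rightarrow> ('a \<Rightarrow> real) \<Rightarrow> real" where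
  "radon_sum I \<mu> f = (\<Sum>\<^sub>\<infinity>i\<in>I. \<mu> i f)"

lemma infsum_finite_support:
  fixes f :: "'i \<Rightarrow> real"
  assumes "finite J" "J \<subseteq> I" "\<And>i. i \<in> I - J \<Longrightarrow> f i = 0"
  shows "infsum f I = sum f J"
  using assms by (metis (no_types, lifting) Diff_eq_empty_iff empty_iff infsum_cong_neutral infsum_finite)

lemma infsum_diff_real:
  fixes f g :: "'i \<Rightarrow> real"
  assumes "f summable_on I" "g summable_on I"
  shows "(\<Sum>\<^sub>\<infinity>i\<in>I. f i - g i) = infsum f I - infsum g I"
  using has_sum_add[OF has_sum_infsum[OF assms(1)] has_sum_cmult_right[OF has_sum_infsum[OF assms(2)], of "-1"]]
  by (intro infsumI) simp

lemma locally_finite_familyE: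
  assumes "locally_finite_family I \<mu>" "compact K"
  obtains J where "finite J" "J \<subseteq> I"
    "\<And>i f. i \<in> I - J \<Longrightarrow> f \<in> Cc \<Longrightarrow> {x. f x \<noteq> 0} \<subseteq> K \<Longrightarrow> \<mu> i f = 0"
    "\<And>f. f \<in> Cc \<Longrightarrow> {x. f x \<noteq> 0} \<subseteq> K \<Longrightarrow> radon_sum I \<mu> f = (\<Sum>i\<in>J. \<mu> i f)"
proof -
  let ?J = "{i \<in> I. \<exists>f\<in>Cc. {x. f x \<noteq> 0} \<subseteq> K \<and> \<mu> i f \<noteq> 0}"
  have J: "finite ?J"
    using assms by (simp add: locally_finite_family_def)
  show thesis
  proof (rule that[OF J])
    show *: "\<mu> i f = 0" if "i \<in> I - ?J" "f \<in> Cc" "{x. f x \<noteq> 0} \<subseteq> K" for i f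
      using that by simp
    show "radon_sum I \<mu> f = (\<Sum>i\<in>?J. \<mu> i f)" if "f \<in> Cc" "{x. f x \<noteq> 0} \<subseteq> K" for f
      unfolding radon_sum_def using * that by (intro infsum_finite_support J) auto
  qed auto
qed

lemma radon_sum_in_pos_radon:
  fixes \<mu> :: "'i \<Rightarrow> ('a::t2_space \<Rightarrow> real) \<Rightarrow> real"
  assumes lc: "locally_compact_space (euclidean :: 'a topology)"
    and fin: "locally_finite_family I \<mu>" and \<mu>: "\<And>i. i \<in> I \<Longrightarrow> \<mu> i \<in> pos_radon_measures"
  shows "radon_sum I \<mu> \<in> pos_radon_measures"
proof (rule pos_radonI[OF lc])
  fix f :: "'a \<Rightarrow> real" assume f: "f \<in> Cc"
  obtain K where K: "compact K" "{x. f x \<noteq> 0} \<subseteq> K"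
    using f by (rule CcE)
  {
    fix g :: "'a \<Rightarrow> real" assume g: "g \<in> Cc"
    obtain L where L: "compact L" "{x. g x \<noteq> 0} \<subseteq> L"
      using g by (rule CcE)
    obtain J where J: "finite J" "J \<subseteq> I"
      "\<And>f. f \<in> Cc \<Longrightarrow> {x. f x \<noteq> 0} \<subseteq> K \<union> L \<Longrightarrow> radon_sum I \<mu> f = (\<Sum>i\<in>J. \<mu> i f)"
      using locally_finite_familyE[OF fin compact_Un[OF K(1) L(1)]] by metis
    have "{x. f x + g x \<noteq> 0} \<subseteq> K \<union> L"
      using K(2) L(2) by force
    then have "radon_sum I \<mu> (\<lambda>x. f x + g x) = (\<Sum>i\<in>J. \<mu> i (\<lambda>x. f x + g x))"
      using f g by (intro J Cc_add)
    also have "\<dots> = (\<Sum>i\<in>J. \<mu> i f + \<mu> i g)"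
      using J(2) f g \<mu> by (intro sum.cong refl radon_add pos_radon_imp_radon) auto
    also have "\<dots> = radon_sum I \<mu> f + radon_sum I \<mu> g"
      using f g K(2) L(2) by (subst (1 2) J(3)) (auto simp: sum.distrib)
    finally show "radon_sum I \<mu> (\<lambda>x. f x + g x) = radon_sum I \<mu> f + radon_sum I \<mu> g" .
  }
  show "radon_sum I \<mu> (\<lambda>x. c * f x) = c * radon_sum I \<mu> f" for c
  proof -
    have "radon_sum I \<mu> (\<lambda>x. c * f x) = (\<Sum>\<^sub>\<infinity>i\<in>I. c * \<mu> i f)"
      unfolding radon_sum_def using f \<mu> by (intro infsum_cong radon_cmult pos_radon_imp_radon)
    then show ?thesis
      by (simp add: radon_sum_def infsum_cmult_right')
  qed
  show "0 \<le> radon_sum I \<mu> f" if "\<And>x. 0 \<le> f x"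
    unfolding radon_sum_def by (intro infsum_nonneg pos_radon_nonneg[OF \<mu>] that)
next
  fix f :: "'a \<Rightarrow> real" assume f: "f \<notin> Cc"
  have "radon_sum I \<mu> f = (\<Sum>\<^sub>\<infinity>i\<in>I. 0)"
    unfolding radon_sum_def using f \<mu> by (intro infsum_cong radon_outside pos_radon_imp_radon)
  then show "radon_sum I \<mu> f = 0"
    by simp
qed

text \<open>Both projections of the support of \<open>F\<close> are compact, so only finitely many
  indices matter on each side and \<open>T\<close> is a finite rectangle. Finiteness for each single
  \<open>F\<close> is what lets the integral of the kernel commute with the sum.\<close>

lemma radon_tensor_sum:
  fixes \<mu> :: "'i \<Rightarrow> ('a::t2_space \<Rightarrow> real) \<Rightarrow> real" and \<nu> :: "'j \<Rightarrow> ('b::t2_space \<Rightarrow> real) \<Rightarrow> real"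
  assumes fin: "locally_finite_family I \<mu>" "locally_finite_family J \<nu>"
    and \<mu>: "\<And>i. i \<in> I \<Longrightarrow> \<mu> i \<in> radon_measures" and \<nu>: "\<And>j. j \<in> J \<Longrightarrow> \<nu> j \<in> radon_measures"
    and F: "F \<in> Cc"
  obtains T where "finite T" "T \<subseteq> I \<times> J"
    "\<And>i j. (i, j) \<in> I \<times> J - T \<Longrightarrow> radon_tensor (\<mu> i) (\<nu> j) F = 0"
    "radon_tensor (radon_sum I \<mu>) (radon_sum J \<nu>) F = (\<Sum>(i, j)\<in>T. radon_tensor (\<mu> i) (\<nu> j) F)"
  using F
proof (rule CcE)
  fix K assume K: "continuous_on UNIV F" "compact K" "{z. F z \<noteq> 0} \<subseteq> K"
  have K1: "compact (fst ` K)" and K2: "compact (snd ` K)"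
    using K(2) by (auto intro!: compact_continuous_image continuous_intros)
  obtain I0 where I0: "finite I0" "I0 \<subseteq> I"
    "\<And>i f. i \<in> I - I0 \<Longrightarrow> f \<in> Cc \<Longrightarrow> {x. f x \<noteq> 0} \<subseteq> fst ` K \<Longrightarrow> \<mu> i f = 0"
    "\<And>f. f \<in> Cc \<Longrightarrow> {x. f x \<noteq> 0} \<subseteq> fst ` K \<Longrightarrow> radon_sum I \<mu> f = (\<Sum>i\<in>I0. \<mu> i f)"
    using locally_finite_familyE[OF fin(1) K1] by metis
  obtain J0 where J0: "finite J0" "J0 \<subseteq> J"
    "\<And>j f. j \<in> J - J0 \<Longrightarrow> f \<in> Cc \<Longrightarrow> {x. f x \<noteq> 0} \<subseteq> snd ` K \<Longrightarrow> \<nu> j f = 0"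
    "\<And>f. f \<in> Cc \<Longrightarrow> {x. f x \<noteq> 0} \<subseteq> snd ` K \<Longrightarrow> radon_sum J \<nu> f = (\<Sum>j\<in>J0. \<nu> j f)"
    using locally_finite_familyE[OF fin(2) K2] by metis
  have slice: "{y. F (x, y) \<noteq> 0} \<subseteq> snd ` K" for x
    using K(3) by force
  have zero: "(\<lambda>y. F (x, y)) = (\<lambda>_. 0)" if "x \<notin> fst ` K" for x
    using K(3) that by force
  have inner: "{x. \<nu> j (\<lambda>y. F (x, y)) \<noteq> 0} \<subseteq> fst ` K" if "j \<in> J" for j
  proof
    fix x assume "x \<in> {x. \<nu> j (\<lambda>y. F (x, y)) \<noteq> 0}"
    then show "x \<in> fst ` K"
      using zero[of x] \<nu>[OF that] by (cases "x \<in> fst ` K") auto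
  qed
  have Cc_in: "(\<lambda>x. \<nu> j (\<lambda>y. F (x, y))) \<in> Cc" if "j \<in> J" for j
    using Cc_radon_slice[OF F \<nu>[OF that]] .
  have J0J: "j \<in> J" if "j \<in> J0" for j
    using that J0(2) by auto
  show thesis
  proof (rule that[of "I0 \<times> J0"])
    show "radon_tensor (\<mu> i) (\<nu> j) F = 0" if ij: "(i, j) \<in> I \<times> J - I0 \<times> J0" for i j
    proof (cases "i \<in> I0")
      case True
      then have "j \<in> J - J0"
        using ij by auto
      then have "(\<lambda>x. \<nu> j (\<lambda>y. F (x, y))) = (\<lambda>_. 0)"
        using J0(3)[OF _ Cc_slice[OF F] slice] by simp
      then show ?thesis
        using \<mu> ij by (simp add: radon_tensor_def)
    next
      case False
      then show ?thesis
        using ij I0(3)[OF _ Cc_in inner] by (auto simp: radon_tensor_def)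
    qed
    have "radon_tensor (radon_sum I \<mu>) (radon_sum J \<nu>) F = radon_sum I \<mu> (\<lambda>x. \<Sum>j\<in>J0. \<nu> j (\<lambda>y. F (x, y)))"
      using F slice by (simp add: radon_tensor_def J0(4) Cc_slice)
    also have "\<dots> = (\<Sum>i\<in>I0. \<mu> i (\<lambda>x. \<Sum>j\<in>J0. \<nu> j (\<lambda>y. F (x, y))))"
    proof (rule I0(4))
      show "{x. (\<Sum>j\<in>J0. \<nu> j (\<lambda>y. F (x, y))) \<noteq> 0} \<subseteq> fst ` K"
      proof
        fix x assume "x \<in> {x. (\<Sum>j\<in>J0. \<nu> j (\<lambda>y. F (x, y))) \<noteq> 0}"
        then obtain j where "j \<in> J0" "\<nu> j (\<lambda>y. F (x, y)) \<noteq> 0"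
          by (auto elim: sum.not_neutral_contains_not_neutral)
        then show "x \<in> fst ` K"
          using inner[of j] J0J by auto
      qed
    qed (use Cc_sum[OF Cc_in[OF J0J], of J0] in simp)
    also have "\<dots> = (\<Sum>i\<in>I0. \<Sum>j\<in>J0. \<mu> i (\<lambda>x. \<nu> j (\<lambda>y. F (x, y))))"
      using I0(2) by (intro sum.cong refl radon_sum \<mu> Cc_in J0J) auto
    also have "\<dots> = (\<Sum>(i, j)\<in>I0 \<times> J0. radon_tensor (\<mu> i) (\<nu> j) F)"
      using F by (simp add: sum.cartesian_product radon_tensor_def)
    finally show "radon_tensor (radon_sum I \<mu>) (radon_sum J \<nu>) F = (\<Sum>(i, j)\<in>I0 \<times> J0. radon_tensor (\<mu> i) (\<nu> j) F)" .
  qed (use I0(1,2) J0(1,2) in auto)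
qed

section \<open>Integrals of lower semicontinuous functions\<close>

text \<open>The lemmas on integrals of nonnegative functions rest on monotonicity and the value at 0
  alone. In this generality they apply to \<open>radon_tensor\<close> and to finite sums of products
  without any continuity argument on the product space.\<close>

definition Cc_mono :: "(('a::t2_space \<Rightarrow> real) \<Rightarrow> real) \<Rightarrow> bool" where
  "Cc_mono \<nu> \<longleftrightarrow> \<nu> (\<lambda>_. 0) = 0 \<and> (\<forall>f\<in>Cc. \<forall>g\<in>Cc. (\<forall>x. f x \<le> g x) \<longrightarrow> \<nu> f \<le> \<nu> g)"

lemma Cc_monoD: "Cc_mono \<nu> \<Longrightarrow> f \<in> Cc \<Longrightarrow> g \<in> Cc \<Longrightarrow> (\<And>x. f x \<le> g x) \<Longrightarrow> \<nu> f \<le> \<nu> g"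
  by (simp add: Cc_mono_def)

lemma Cc_mono_0: "Cc_mono \<nu> \<Longrightarrow> \<nu> (\<lambda>_. 0) = 0"
  by (simp add: Cc_mono_def)

lemma Cc_mono_pos_radon: "\<nu> \<in> pos_radon_measures \<Longrightarrow> Cc_mono \<nu>"
  by (simp add: Cc_mono_def pos_radon_mono pos_radon_imp_radon)

lemma Cc_mono_radon_tensor: "\<mu> \<in> pos_radon_measures \<Longrightarrow> \<nu> \<in> pos_radon_measures \<Longrightarrow> Cc_mono (radon_tensor \<mu> \<nu>)"
  unfolding Cc_mono_def using radon_tensor_mono[of \<mu> \<nu>]
  by (auto simp: pos_radon_imp_radon) (simp add: radon_tensor_def pos_radon_imp_radon)

lemma Cc_mono_sum: "(\<And>k. k \<in> J \<Longrightarrow> Cc_mono (\<nu> k)) \<Longrightarrow> Cc_mono (\<lambda>f. \<Sum>k\<in>J. \<nu> k f)"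
  by (simp add: Cc_mono_def sum_mono)

lemma lsc_integral_upper: "f \<in> Cc \<Longrightarrow> (\<And>x. ereal (f x) \<le> g x) \<Longrightarrow> ereal (\<nu> f) \<le> lsc_integral g \<nu>"
  unfolding lsc_integral_def by (rule SUP_upper) simp

lemma lsc_integral_least:
  "(\<And>f. f \<in> Cc \<Longrightarrow> (\<And>x. ereal (f x) \<le> g x) \<Longrightarrow> ereal (\<nu> f) \<le> c) \<Longrightarrow> lsc_integral g \<nu> \<le> c"
  unfolding lsc_integral_def by (rule SUP_least) simp

text \<open>Passing from \<open>f\<close> to \<open>max 0 f\<close> keeps the function below
  \<open>g\<close> and does not lower the functional. The reduction is needed because measures are
  compared on nonnegative functions only.\<close>

lemma lsc_integral_least_nonneg:
  assumes g: "\<And>x. 0 \<le> g x" and \<nu>: "Cc_mono \<nu>"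
    and le: "\<And>f. f \<in> Cc \<Longrightarrow> (\<And>x. 0 \<le> f x) \<Longrightarrow> (\<And>x. ereal (f x) \<le> g x) \<Longrightarrow> ereal (\<nu> f) \<le> c"
  shows "lsc_integral g \<nu> \<le> c"
proof (rule lsc_integral_least)
  fix f :: "'a \<Rightarrow> real" assume f: "f \<in> Cc" "\<And>x. ereal (f x) \<le> g x"
  have "ereal (\<nu> f) \<le> ereal (\<nu> (\<lambda>x. max 0 (f x)))"
    using f by (simp add: Cc_monoD[OF \<nu>] Cc_pos)
  also have "\<dots> \<le> c"
    using f g by (intro le Cc_pos) (auto simp: max_def zero_ereal_def)
  finally show "ereal (\<nu> f) \<le> c" .
qed

lemma lsc_integral_nonneg: "(\<And>x. 0 \<le> g x) \<Longrightarrow> Cc_mono \<nu> \<Longrightarrow> 0 \<le> lsc_integral g \<nu>"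
  using lsc_integral_upper[of "\<lambda>_. 0" g \<nu>] by (simp add: Cc_mono_0 flip: zero_ereal_def)

lemma lsc_integral_mono:
  assumes g: "\<And>x. 0 \<le> g x" and \<mu>: "Cc_mono \<mu>"
    and le: "\<And>f. f \<in> Cc \<Longrightarrow> (\<And>x. 0 \<le> f x) \<Longrightarrow> \<mu> f \<le> \<nu> f"
  shows "lsc_integral g \<mu> \<le> lsc_integral g \<nu>"
proof (rule lsc_integral_least_nonneg[OF g \<mu>])
  fix f :: "'a \<Rightarrow> real" assume f: "f \<in> Cc" "\<And>x. 0 \<le> f x" "\<And>x. ereal (f x) \<le> g x"
  have "ereal (\<mu> f) \<le> ereal (\<nu> f)"
    using le f by simp
  also have "\<dots> \<le> lsc_integral g \<nu>"
    using f by (intro lsc_integral_upper)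
  finally show "ereal (\<mu> f) \<le> lsc_integral g \<nu>" .
qed

lemma lsc_integral_0: "(\<And>x. 0 \<le> g x) \<Longrightarrow> lsc_integral g (\<lambda>_. 0) = 0"
  by (rule order.antisym) (auto intro!: lsc_integral_least lsc_integral_nonneg simp: Cc_mono_def)

text \<open>The functions in \<open>Cc\<close> below \<open>g\<close> are directed upwards by \<open>max\<close>.\<close>

lemma lsc_integral_add:
  assumes g: "\<And>x. 0 \<le> g x" and \<mu>: "Cc_mono \<mu>" and \<nu>: "Cc_mono \<nu>"
  shows "lsc_integral g (\<lambda>f. \<mu> f + \<nu> f) = lsc_integral g \<mu> + lsc_integral g \<nu>"
proof (rule order.antisym)
  show "lsc_integral g (\<lambda>f. \<mu> f + \<nu> f) \<le> lsc_integral g \<mu> + lsc_integral g \<nu>"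
  proof (rule lsc_integral_least)
    fix f :: "'a \<Rightarrow> real" assume "f \<in> Cc" "\<And>x. ereal (f x) \<le> g x"
    then show "ereal (\<mu> f + \<nu> f) \<le> lsc_integral g \<mu> + lsc_integral g \<nu>"
      using add_mono[OF lsc_integral_upper[of f g \<mu>] lsc_integral_upper[of f g \<nu>]] by simp
  qed
  let ?C = "{f \<in> Cc. \<forall>x. ereal (f x) \<le> g x}"
  have ne: "?C \<noteq> {}"
    using g by (auto intro!: exI[of _ "\<lambda>_. 0"] simp flip: zero_ereal_def)
  have \<nu>0: "lsc_integral g \<nu> \<noteq> - \<infinity>"
    using lsc_integral_nonneg[OF g \<nu>] by auto
  have "ereal (\<mu> f) + lsc_integral g \<nu> \<le> lsc_integral g (\<lambda>f. \<mu> f + \<nu> f)" if f: "f \<in> ?C" for f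
  proof -
    have "ereal (\<mu> f) + ereal (\<nu> h) \<le> lsc_integral g (\<lambda>f. \<mu> f + \<nu> f)" if h: "h \<in> ?C" for h
    proof -
      let ?m = "\<lambda>x. max (f x) (h x)"
      have "?m \<in> Cc"
        using f h by (auto intro: Cc_max)
      moreover from this have "ereal (\<mu> f) + ereal (\<nu> h) \<le> ereal (\<mu> ?m + \<nu> ?m)"
        using f h by (auto intro!: add_mono Cc_monoD[OF \<mu>] Cc_monoD[OF \<nu>])
      moreover have "ereal (?m x) \<le> g x" for x
        using f h by (auto simp: max_def)
      ultimately show ?thesis
        using lsc_integral_upper[of ?m g "\<lambda>f. \<mu> f + \<nu> f"] by (meson order.trans)
    qed
    then have "(SUP h\<in>?C. ereal (\<mu> f) + ereal (\<nu> h)) \<le> lsc_integral g (\<lambda>f. \<mu> f + \<nu> f)"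
      by (intro SUP_least)
    then show ?thesis
      using SUP_ereal_add_right[OF ne, of "ereal (\<mu> f)" "\<lambda>h. ereal (\<nu> h)"] by (simp add: lsc_integral_def)
  qed
  then have "(SUP f\<in>?C. ereal (\<mu> f) + lsc_integral g \<nu>) \<le> lsc_integral g (\<lambda>f. \<mu> f + \<nu> f)"
    by (intro SUP_least)
  then show "lsc_integral g \<mu> + lsc_integral g \<nu> \<le> lsc_integral g (\<lambda>f. \<mu> f + \<nu> f)"
    using SUP_ereal_add_left[OF ne \<nu>0, of "\<lambda>f. ereal (\<mu> f)"] by (simp add: lsc_integral_def)
qed

lemma lsc_integral_sum:
  assumes g: "\<And>x. 0 \<le> g x" and "finite J" "\<And>k. k \<in> J \<Longrightarrow> Cc_mono (\<nu> k)"
  shows "lsc_integral g (\<lambda>f. \<Sum>k\<in>J. \<nu> k f) = (\<Sum>k\<in>J. lsc_integral g (\<nu> k))"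
  using assms(2,3)
proof (induction J)
  case (insert k J)
  then show ?case
    using lsc_integral_add[OF g, of "\<nu> k" "\<lambda>f. \<Sum>k\<in>J. \<nu> k f"] Cc_mono_sum[of J \<nu>] by simp
qed (simp add: lsc_integral_0 g)

lemma lsc_integral_cmult:
  assumes g: "\<And>x. 0 \<le> g x" and c: "0 \<le> c"
  shows "lsc_integral g (\<lambda>f. c * \<nu> f) = ereal c * lsc_integral g \<nu>"
proof (cases "c = 0")
  case False
  have le: "lsc_integral g (\<lambda>f. c * \<nu> f) \<le> ereal c * lsc_integral g \<nu>" if c: "0 < c" for c \<nu>
  proof (rule lsc_integral_least)
    fix f :: "'a \<Rightarrow> real" assume f: "f \<in> Cc" "\<And>x. ereal (f x) \<le> g x"
    show "ereal (c * \<nu> f) \<le> ereal c * lsc_integral g \<nu>"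
      using ereal_mult_left_mono[OF lsc_integral_upper[OF f], of "ereal c" \<nu>] c by simp
  qed
  have "lsc_integral g \<nu> = lsc_integral g (\<lambda>f. (1 / c) * (c * \<nu> f))"
    using False by simp
  also have "\<dots> \<le> ereal (1 / c) * lsc_integral g (\<lambda>f. c * \<nu> f)"
    using c False by (intro le) auto
  finally have "ereal c * lsc_integral g \<nu> \<le> ereal c * (ereal (1 / c) * lsc_integral g (\<lambda>f. c * \<nu> f))"
    using c by (intro ereal_mult_left_mono) auto
  also have "\<dots> = lsc_integral g (\<lambda>f. c * \<nu> f)"
    using False by (simp flip: mult.assoc)
  finally show ?thesis
    using le[of c \<nu>] c False by (intro order.antisym) auto
qed (simp add: lsc_integral_0 g)

text \<open>Each test function sees a finite subsum, which gives one inequality; conversely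
  \<open>\<mu>\<close> dominates every finite subsum on nonnegative functions. As the finite set
  varies with \<open>f\<close>, the right-hand side is a supremum over all of them.\<close>

lemma lsc_integral_locally_finite_sum:
  assumes g: "\<And>x. 0 \<le> g x" and \<nu>: "\<And>k. k \<in> T \<Longrightarrow> Cc_mono (\<nu> k)"
    and lf: "\<And>f. f \<in> Cc \<Longrightarrow> \<exists>J. finite J \<and> J \<subseteq> T \<and> (\<forall>k\<in>T - J. \<nu> k f = 0) \<and> \<mu> f = (\<Sum>k\<in>J. \<nu> k f)"
  shows "lsc_integral g \<mu> = (SUP J\<in>{J. finite J \<and> J \<subseteq> T}. \<Sum>k\<in>J. lsc_integral g (\<nu> k))"
proof (rule order.antisym)
  have mono_J: "Cc_mono (\<lambda>f. \<Sum>k\<in>J. \<nu> k f)" if "J \<subseteq> T" for J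
    using that \<nu> by (intro Cc_mono_sum) auto
  have sum_J: "(\<Sum>k\<in>J. lsc_integral g (\<nu> k)) = lsc_integral g (\<lambda>f. \<Sum>k\<in>J. \<nu> k f)" if "finite J" "J \<subseteq> T" for J
    using that \<nu> by (intro lsc_integral_sum[OF g, symmetric]) auto
  show "lsc_integral g \<mu> \<le> (SUP J\<in>{J. finite J \<and> J \<subseteq> T}. \<Sum>k\<in>J. lsc_integral g (\<nu> k))"
  proof (rule lsc_integral_least)
    fix f :: "'a \<Rightarrow> real" assume f: "f \<in> Cc" "\<And>x. ereal (f x) \<le> g x"
    obtain J where J: "finite J" "J \<subseteq> T" "\<mu> f = (\<Sum>k\<in>J. \<nu> k f)"
      using lf[OF f(1)] by blast
    have "ereal (\<mu> f) \<le> (\<Sum>k\<in>J. lsc_integral g (\<nu> k))"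
      using lsc_integral_upper[OF f, of "\<lambda>f. \<Sum>k\<in>J. \<nu> k f"] J sum_J by simp
    also have "\<dots> \<le> (SUP J\<in>{J. finite J \<and> J \<subseteq> T}. \<Sum>k\<in>J. lsc_integral g (\<nu> k))"
      using J by (intro SUP_upper) auto
    finally show "ereal (\<mu> f) \<le> (SUP J\<in>{J. finite J \<and> J \<subseteq> T}. \<Sum>k\<in>J. lsc_integral g (\<nu> k))" .
  qed
  show "(SUP J\<in>{J. finite J \<and> J \<subseteq> T}. \<Sum>k\<in>J. lsc_integral g (\<nu> k)) \<le> lsc_integral g \<mu>"
  proof (rule SUP_least)
    fix J assume J: "J \<in> {J. finite J \<and> J \<subseteq> T}"
    have "lsc_integral g (\<lambda>f. \<Sum>k\<in>J. \<nu> k f) \<le> lsc_integral g \<mu>"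
    proof (rule lsc_integral_mono[OF g])
      show "Cc_mono (\<lambda>f. \<Sum>k\<in>J. \<nu> k f)"
        using J mono_J by simp
      fix f :: "'a \<Rightarrow> real" assume f: "f \<in> Cc" "\<And>x. 0 \<le> f x"
      obtain L where L: "finite L" "L \<subseteq> T" "\<forall>k\<in>T - L. \<nu> k f = 0" "\<mu> f = (\<Sum>k\<in>L. \<nu> k f)"
        using lf[OF f(1)] by blast
      have "0 \<le> \<nu> k f" if "k \<in> T" for k
        using Cc_monoD[OF \<nu>[OF that] Cc_0 f(1)] f(2) Cc_mono_0[OF \<nu>[OF that]] by simp
      \<comment> \<open>\<open>J\<close> and \<open>L\<close> are unrelated: passing to the union
        adds nonnegative terms, and the terms outside \<open>L\<close> vanish.\<close>
      then have "(\<Sum>k\<in>J. \<nu> k f) \<le> (\<Sum>k\<in>J \<union> L. \<nu> k f)"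
        using J L by (intro sum_mono2) auto
      also have "\<dots> = \<mu> f"
        unfolding L(4) using J L(1-3) by (intro sum.mono_neutral_right) auto
      finally show "(\<Sum>k\<in>J. \<nu> k f) \<le> \<mu> f" .
    qed
    then show "(\<Sum>k\<in>J. lsc_integral g (\<nu> k)) \<le> lsc_integral g \<mu>"
      using J sum_J by simp
  qed
qed

text \<open>Adding \<open>M\<close> is a bijection between the test functions below the two
  integrands, and the number \<open>m\<close> stands for the integral of the constant
  \<open>M\<close>.\<close>

lemma lsc_integral_shift:
  fixes g :: "'a::t2_space \<Rightarrow> ereal"
  assumes M: "(\<lambda>_::'a. M) \<in> Cc" and \<nu>: "\<And>f. f \<in> Cc \<Longrightarrow> \<nu> (\<lambda>x. f x + M) = \<nu> f + m"
  shows "lsc_integral (\<lambda>x. g x + ereal M) \<nu> = lsc_integral g \<nu> + ereal m"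
proof (rule order.antisym)
  show "lsc_integral (\<lambda>x. g x + ereal M) \<nu> \<le> lsc_integral g \<nu> + ereal m"
  proof (rule lsc_integral_least)
    fix f :: "'a \<Rightarrow> real" assume f: "f \<in> Cc" "\<And>x. ereal (f x) \<le> g x + ereal M"
    let ?h = "\<lambda>x. f x - M"
    have "?h \<in> Cc"
      using f(1) M by (rule Cc_diff)
    moreover have "ereal (?h x) \<le> g x" for x
      using f(2)[of x] by (cases "g x") auto
    ultimately have "ereal (\<nu> ?h) \<le> lsc_integral g \<nu>" "\<nu> f = \<nu> ?h + m"
      using \<nu>[of ?h] by (auto intro: lsc_integral_upper)
    then show "ereal (\<nu> f) \<le> lsc_integral g \<nu> + ereal m"
      by (metis add_right_mono plus_ereal.simps(1))
  qed
  have "lsc_integral g \<nu> \<le> lsc_integral (\<lambda>x. g x + ereal M) \<nu> - ereal m"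
  proof (rule lsc_integral_least)
    fix f :: "'a \<Rightarrow> real" assume f: "f \<in> Cc" "\<And>x. ereal (f x) \<le> g x"
    let ?h = "\<lambda>x. f x + M"
    have "?h \<in> Cc"
      using f(1) M by (rule Cc_add)
    moreover have "ereal (?h x) \<le> g x + ereal M" for x
      using add_right_mono[OF f(2)[of x], of "ereal M"] by simp
    ultimately have "ereal (\<nu> ?h) \<le> lsc_integral (\<lambda>x. g x + ereal M) \<nu>"
      by (intro lsc_integral_upper)
    then show "ereal (\<nu> f) \<le> lsc_integral (\<lambda>x. g x + ereal M) \<nu> - ereal m"
      using \<nu>[OF f(1)] by (simp add: ereal_le_minus)
  qed
  then show "lsc_integral g \<nu> + ereal m \<le> lsc_integral (\<lambda>x. g x + ereal M) \<nu>"
    by (simp add: ereal_le_minus)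
qed

section \<open>The energy form\<close>

text \<open>On a compact space the open sets where the kernel exceeds \<open>- real n\<close> cover
  the product, because the value \<open>- \<infinity>\<close> is excluded; a finite subcover
  provides the bound.\<close>

lemma energy_kernel_lower_bound:
  fixes \<kappa> :: "'a::t2_space \<times> 'a \<Rightarrow> ereal"
  assumes \<kappa>: "energy_kernel \<kappa>"
  obtains M where "\<And>z. 0 \<le> \<kappa> z + ereal M" "M = 0 \<or> compact (UNIV :: 'a set)"
proof (cases "compact (UNIV :: 'a set)")
  case True
  have "compact (UNIV :: ('a \<times> 'a) set)"
    using compact_Times[OF True True] by simp
  moreover have "open {z. ereal (- real n) < \<kappa> z}" for n
    using \<kappa> by (simp add: energy_kernel_def)
  moreover have "UNIV \<subseteq> (\<Union>n. {z. ereal (- real n) < \<kappa> z})"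
  proof
    fix z
    have "\<kappa> z \<noteq> - \<infinity>"
      using \<kappa> unfolding energy_kernel_def by blast
    then show "z \<in> (\<Union>n. {z. ereal (- real n) < \<kappa> z})"
    proof (cases "\<kappa> z")
      case (real r)
      obtain n where "- r < real n"
        using reals_Archimedean2 by blast
      then show ?thesis
        using real by (auto intro!: exI[of _ n])
    qed auto
  qed
  ultimately obtain D where D: "finite D" "UNIV \<subseteq> (\<Union>n\<in>D. {z. ereal (- real n) < \<kappa> z})"
    by (metis (no_types, lifting) compactE_image UNIV_I)
  show thesis
  proof (rule that)
    fix z
    obtain n where n: "n \<in> D" "ereal (- real n) < \<kappa> z"
      using D(2) by blast
    have "n \<le> Max D"
      using n(1) D(1) by simp
    then show "0 \<le> \<kappa> z + ereal (real (Max D))"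
      using n(2) by (cases "\<kappa> z") auto
  qed (use True in simp)
next
  case False
  then show thesis
    using \<kappa> by (intro that[of 0]) (auto simp: energy_kernel_def zero_ereal_def[symmetric])
qed

text \<open>
  The shift by \<open>M\<close> makes the kernel nonnegative.  On a compact space it alters energies by the
  finite bilinear form \<open>M \<mu>(1) \<nu>(1)\<close>; on a noncompact space \<open>M = 0\<close>, and moreover \<open>\<mu>(1)\<close> is the
  junk value 0.
\<close>

locale shifted_kernel =
  fixes \<kappa> :: "'a::t2_space \<times> 'a \<Rightarrow> ereal" and M :: real
  assumes lc: "locally_compact_space (euclidean :: 'a topology)"
    and pd: "positive_definite \<kappa>"
    and M_nonneg: "\<And>z. 0 \<le> \<kappa> z + ereal M"
    and M_compact: "M = 0 \<or> compact (UNIV :: 'a set)"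
begin

definition N :: "(('a \<Rightarrow> real) \<Rightarrow> real) \<Rightarrow> (('a \<Rightarrow> real) \<Rightarrow> real) \<Rightarrow> ereal" where
  "N \<mu> \<nu> = lsc_integral (\<lambda>z. \<kappa> z + ereal M) (radon_tensor \<mu> \<nu>)"

abbreviation n :: "(('a \<Rightarrow> real) \<Rightarrow> real) \<Rightarrow> (('a \<Rightarrow> real) \<Rightarrow> real) \<Rightarrow> real" where
  "n \<mu> \<nu> \<equiv> real_of_ereal (N \<mu> \<nu>)"

abbreviation mass :: "(('a \<Rightarrow> real) \<Rightarrow> real) \<Rightarrow> real" where
  "mass \<mu> \<equiv> \<mu> (\<lambda>_. 1)"

section \<open>Biadditivity and monotonicity of the shifted energy\<close>

lemma N_nonneg: "\<mu> \<in> pos_radon_measures \<Longrightarrow> \<nu> \<in> pos_radon_measures \<Longrightarrow> 0 \<le> N \<mu> \<nu>"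
  by (simp add: N_def lsc_integral_nonneg M_nonneg Cc_mono_radon_tensor)

lemma N_eq_n:
  assumes "\<mu> \<in> pos_radon_measures" "\<nu> \<in> pos_radon_measures" "N \<mu> \<nu> \<noteq> \<infinity>"
  shows "N \<mu> \<nu> = ereal (n \<mu> \<nu>)"
  using N_nonneg[OF assms(1,2)] assms(3) by (cases "N \<mu> \<nu>") auto

lemma N_add_left:
  assumes "\<mu>1 \<in> pos_radon_measures" "\<mu>2 \<in> pos_radon_measures" "\<nu> \<in> pos_radon_measures"
  shows "N (\<mu>1 + \<mu>2) \<nu> = N \<mu>1 \<nu> + N \<mu>2 \<nu>"
proof -
  have "radon_tensor (\<mu>1 + \<mu>2) \<nu> = (\<lambda>F. radon_tensor \<mu>1 \<nu> F + radon_tensor \<mu>2 \<nu> F)"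
    by (rule ext) (rule radon_tensor_add_left)
  then show ?thesis
    using assms by (simp add: N_def lsc_integral_add M_nonneg Cc_mono_radon_tensor)
qed

lemma N_add_right:
  assumes "\<mu> \<in> pos_radon_measures" "\<nu>1 \<in> pos_radon_measures" "\<nu>2 \<in> pos_radon_measures"
  shows "N \<mu> (\<nu>1 + \<nu>2) = N \<mu> \<nu>1 + N \<mu> \<nu>2"
proof -
  have "radon_tensor \<mu> (\<nu>1 + \<nu>2) = (\<lambda>F. radon_tensor \<mu> \<nu>1 F + radon_tensor \<mu> \<nu>2 F)"
    using assms by (intro ext radon_tensor_add_right pos_radon_imp_radon)
  then show ?thesis
    using assms by (simp add: N_def lsc_integral_add M_nonneg Cc_mono_radon_tensor)
qed

lemma N_cmult_left: "0 \<le> c \<Longrightarrow> N (\<lambda>f. c * \<mu> f) \<nu> = ereal c * N \<mu> \<nu>"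
  using lsc_integral_cmult[OF M_nonneg, where c = c and \<nu> = "radon_tensor \<mu> \<nu>"]
  by (simp add: N_def radon_tensor_cmult_left[abs_def])

lemma N_cmult_right:
  assumes "0 \<le> c" "\<mu> \<in> pos_radon_measures" "\<nu> \<in> pos_radon_measures"
  shows "N \<mu> (\<lambda>f. c * \<nu> f) = ereal c * N \<mu> \<nu>"
proof -
  have "radon_tensor \<mu> (\<lambda>f. c * \<nu> f) = (\<lambda>F. c * radon_tensor \<mu> \<nu> F)"
    using assms by (intro ext radon_tensor_cmult_right pos_radon_imp_radon)
  then show ?thesis
    using assms(1) by (simp add: N_def lsc_integral_cmult M_nonneg)
qed

lemma N_mono:
  assumes P: "\<mu> \<in> pos_radon_measures" "\<mu>' \<in> pos_radon_measures" "\<nu> \<in> pos_radon_measures" "\<nu>' \<in> pos_radon_measures"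
    and le: "radon_le \<mu> \<mu>'" "radon_le \<nu> \<nu>'"
  shows "N \<mu> \<nu> \<le> N \<mu>' \<nu>'"
proof -
  have d: "\<mu>' - \<mu> \<in> pos_radon_measures" "\<nu>' - \<nu> \<in> pos_radon_measures"
    using P le by (auto intro: pos_radon_diff pos_radon_imp_radon)
  have "N \<mu> \<nu> \<le> N \<mu> \<nu> + N (\<mu>' - \<mu>) \<nu>"
    using N_nonneg[OF d(1) P(3)] by (simp add: add_increasing2)
  also have "\<dots> = N (\<mu> + (\<mu>' - \<mu>)) \<nu>"
    using P d by (intro N_add_left[symmetric])
  also have "\<dots> = N \<mu>' \<nu>"
    by simp
  also have "\<dots> \<le> N \<mu>' \<nu> + N \<mu>' (\<nu>' - \<nu>)"
    using N_nonneg[OF P(2) d(2)] by (simp add: add_increasing2)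
  also have "\<dots> = N \<mu>' (\<nu> + (\<nu>' - \<nu>))"
    using P d by (intro N_add_right[symmetric])
  also have "\<dots> = N \<mu>' \<nu>'"
    by simp
  finally show ?thesis .
qed

lemma N_sum:
  assumes fin: "locally_finite_family I \<mu>" "locally_finite_family J \<nu>"
    and \<mu>: "\<And>i. i \<in> I \<Longrightarrow> \<mu> i \<in> pos_radon_measures" and \<nu>: "\<And>j. j \<in> J \<Longrightarrow> \<nu> j \<in> pos_radon_measures"
  shows "N (radon_sum I \<mu>) (radon_sum J \<nu>) = (SUP T\<in>{T. finite T \<and> T \<subseteq> I \<times> J}. \<Sum>(i, j)\<in>T. N (\<mu> i) (\<nu> j))"
proof -
  have eq: "(\<lambda>(i, j). lsc_integral (\<lambda>z. \<kappa> z + ereal M) (radon_tensor (\<mu> i) (\<nu> j)))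
      = (\<lambda>k. lsc_integral (\<lambda>z. \<kappa> z + ereal M) (case k of (i, j) \<Rightarrow> radon_tensor (\<mu> i) (\<nu> j)))"
    by auto
  show ?thesis
    unfolding N_def eq
  proof (rule lsc_integral_locally_finite_sum[OF M_nonneg])
    show "Cc_mono (case k of (i, j) \<Rightarrow> radon_tensor (\<mu> i) (\<nu> j))" if "k \<in> I \<times> J" for k
      using that \<mu> \<nu> by (auto intro: Cc_mono_radon_tensor)
    fix F :: "'a \<times> 'a \<Rightarrow> real" assume F: "F \<in> Cc"
    obtain T where T: "finite T" "T \<subseteq> I \<times> J"
      "\<And>i j. (i, j) \<in> I \<times> J - T \<Longrightarrow> radon_tensor (\<mu> i) (\<nu> j) F = 0"
      "radon_tensor (radon_sum I \<mu>) (radon_sum J \<nu>) F = (\<Sum>(i, j)\<in>T. radon_tensor (\<mu> i) (\<nu> j) F)"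
      using radon_tensor_sum[OF fin pos_radon_imp_radon[OF \<mu>] pos_radon_imp_radon[OF \<nu>] F] by metis
    then show "\<exists>T. finite T \<and> T \<subseteq> I \<times> J \<and> (\<forall>k\<in>I \<times> J - T. (case k of (i, j) \<Rightarrow> radon_tensor (\<mu> i) (\<nu> j)) F = 0) \<and>
        radon_tensor (radon_sum I \<mu>) (radon_sum J \<nu>) F
          = (\<Sum>k\<in>T. (case k of (i, j) \<Rightarrow> radon_tensor (\<mu> i) (\<nu> j)) F)"
      using T by (intro exI[of _ T]) (auto simp: case_prod_beta)
  qed
qed

text \<open>The correction is a finite number, so the identity remains meaningful when the energy is
  infinite.\<close>

lemma lsc_integral_kernel:
  assumes \<mu>: "\<mu> \<in> pos_radon_measures" and \<nu>: "\<nu> \<in> pos_radon_measures"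
  shows "lsc_integral \<kappa> (radon_tensor \<mu> \<nu>) = N \<mu> \<nu> - ereal (M * mass \<mu> * mass \<nu>)"
proof -
  have M2: "(\<lambda>_::'a \<times> 'a. M) \<in> Cc"
    using M_compact Cc_const[where 'a="'a \<times> 'a"] compact_Times[of "UNIV :: 'a set" "UNIV :: 'a set"] by auto
  have "radon_tensor \<mu> \<nu> (\<lambda>z. F z + M) = radon_tensor \<mu> \<nu> F + M * mass \<mu> * mass \<nu>" if F: "F \<in> Cc" for F
  proof (cases "M = 0")
    \<comment> \<open>For \<open>M \<noteq> 0\<close> the space is compact, constants belong to
      \<open>Cc\<close>, and \<open>mass\<close> is the true total mass.\<close>
    case False
    then have c: "(\<lambda>_::'a. c) \<in> Cc" for c
      using M_compact Cc_const[where 'a='a] by auto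
    have \<nu>M: "\<nu> (\<lambda>y. F (x, y) + M) = \<nu> (\<lambda>y. F (x, y)) + M * mass \<nu>" for x
      using radon_add[OF pos_radon_imp_radon[OF \<nu>] Cc_slice[OF F] c]
        radon_cmult[OF pos_radon_imp_radon[OF \<nu>] c, of M 1] by simp
    have "\<mu> (\<lambda>x. M * mass \<nu>) = M * mass \<nu> * mass \<mu>"
      using radon_cmult[OF pos_radon_imp_radon[OF \<mu>] c, of "M * mass \<nu>" 1] by simp
    then show ?thesis
      using F Cc_add[OF F M2] radon_add[OF pos_radon_imp_radon[OF \<mu>] Cc_radon_slice[OF F pos_radon_imp_radon[OF \<nu>]] c]
      by (simp add: radon_tensor_def \<nu>M)
  qed simp
  then have "N \<mu> \<nu> = lsc_integral \<kappa> (radon_tensor \<mu> \<nu>) + ereal (M * mass \<mu> * mass \<nu>)"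
    unfolding N_def by (rule lsc_integral_shift[OF M2])
  then show ?thesis
    by (cases "lsc_integral \<kappa> (radon_tensor \<mu> \<nu>)") auto
qed

lemma energy_parts:
  assumes "\<mu> \<in> radon_measures" "\<nu> \<in> radon_measures"
  shows "energy_pos_part \<kappa> \<mu> \<nu> =
      (N (radon_pos_part \<mu>) (radon_pos_part \<nu>) + N (radon_neg_part \<mu>) (radon_neg_part \<nu>))
      - ereal (M * mass (radon_pos_part \<mu>) * mass (radon_pos_part \<nu>) + M * mass (radon_neg_part \<mu>) * mass (radon_neg_part \<nu>))"
    and "energy_neg_part \<kappa> \<mu> \<nu> =
      (N (radon_pos_part \<mu>) (radon_neg_part \<nu>) + N (radon_neg_part \<mu>) (radon_pos_part \<nu>))
      - ereal (M * mass (radon_pos_part \<mu>) * mass (radon_neg_part \<nu>) + M * mass (radon_neg_part \<mu>) * mass (radon_pos_part \<nu>))"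
proof -
  have P: "radon_pos_part \<mu> \<in> pos_radon_measures" "radon_neg_part \<mu> \<in> pos_radon_measures"
    "radon_pos_part \<nu> \<in> pos_radon_measures" "radon_neg_part \<nu> \<in> pos_radon_measures"
    using assms lc by (auto intro: radon_pos_part_in_pos_radon radon_neg_part_in_pos_radon)
  have sub: "(a - ereal r) + (b - ereal s) = (a + b) - ereal (r + s)" for a b r s
    by (cases a; cases b) auto
  show "energy_pos_part \<kappa> \<mu> \<nu> =
      (N (radon_pos_part \<mu>) (radon_pos_part \<nu>) + N (radon_neg_part \<mu>) (radon_neg_part \<nu>))
      - ereal (M * mass (radon_pos_part \<mu>) * mass (radon_pos_part \<nu>) + M * mass (radon_neg_part \<mu>) * mass (radon_neg_part \<nu>))"
    "energy_neg_part \<kappa> \<mu> \<nu> =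
      (N (radon_pos_part \<mu>) (radon_neg_part \<nu>) + N (radon_neg_part \<mu>) (radon_pos_part \<nu>))
      - ereal (M * mass (radon_pos_part \<mu>) * mass (radon_neg_part \<nu>) + M * mass (radon_neg_part \<mu>) * mass (radon_pos_part \<nu>))"
    by (simp_all add: energy_pos_part_def energy_neg_part_def lsc_integral_kernel P sub)
qed

lemma N_0 [simp]: "N (\<lambda>_. 0) \<nu> = 0" "\<mu> \<in> radon_measures \<Longrightarrow> N \<mu> (\<lambda>_. 0) = 0"
  by (simp_all add: N_def lsc_integral_0 M_nonneg)

text \<open>Finiteness is imposed on \<open>N\<close> instead of the energy because \<open>N\<close>
  comes from a nonnegative kernel and is monotone, so the property passes to smaller
  measures.\<close>

definition finite_pos :: "(('a \<Rightarrow> real) \<Rightarrow> real) set" where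
  "finite_pos = {\<mu> \<in> pos_radon_measures. N \<mu> \<mu> \<noteq> \<infinity>}"

lemma finite_pos_pos: "\<mu> \<in> finite_pos \<Longrightarrow> \<mu> \<in> pos_radon_measures"
  by (simp add: finite_pos_def)

lemma finite_pos_radon: "\<mu> \<in> finite_pos \<Longrightarrow> \<mu> \<in> radon_measures"
  by (simp add: finite_pos_def pos_radon_imp_radon)

lemma finite_pos_dominated:
  assumes "\<mu> \<in> pos_radon_measures" "\<nu> \<in> finite_pos" "radon_le \<mu> \<nu>"
  shows "\<mu> \<in> finite_pos"
  using N_mono[of \<mu> \<nu> \<mu> \<nu>] assms by (auto simp: finite_pos_def)

lemma finite_pos_cmult:
  assumes "\<mu> \<in> finite_pos" "0 \<le> c"
  shows "(\<lambda>f. c * \<mu> f) \<in> finite_pos"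
  using assms by (auto simp: finite_pos_def pos_radon_cmult N_cmult_left N_cmult_right ereal_times(1))

lemma n_add_left:
  assumes "\<mu>1 \<in> pos_radon_measures" "\<mu>2 \<in> pos_radon_measures" "\<nu> \<in> pos_radon_measures"
    and "N \<mu>1 \<nu> \<noteq> \<infinity>" "N \<mu>2 \<nu> \<noteq> \<infinity>"
  shows "n (\<mu>1 + \<mu>2) \<nu> = n \<mu>1 \<nu> + n \<mu>2 \<nu>"
  using N_eq_n[of \<mu>1 \<nu>] N_eq_n[of \<mu>2 \<nu>] assms N_add_left[of \<mu>1 \<mu>2 \<nu>] by (metis real_of_ereal.simps(1) plus_ereal.simps(1))

lemma n_add_right:
  assumes "\<mu> \<in> pos_radon_measures" "\<nu>1 \<in> pos_radon_measures" "\<nu>2 \<in> pos_radon_measures"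
    and "N \<mu> \<nu>1 \<noteq> \<infinity>" "N \<mu> \<nu>2 \<noteq> \<infinity>"
  shows "n \<mu> (\<nu>1 + \<nu>2) = n \<mu> \<nu>1 + n \<mu> \<nu>2"
  using N_eq_n[of \<mu> \<nu>1] N_eq_n[of \<mu> \<nu>2] assms N_add_right[of \<mu> \<nu>1 \<nu>2] by (metis real_of_ereal.simps(1) plus_ereal.simps(1))

text \<open>The positive energy part of \<open>\<mu> - \<nu>\<close> is finite, so positive definiteness forces the negative
  one, and with it \<open>N \<mu> \<nu>\<close>, to be finite.\<close>

lemma finite_pos_cross:
  assumes \<mu>: "\<mu> \<in> finite_pos" and \<nu>: "\<nu> \<in> finite_pos"
  shows "N \<mu> \<nu> \<noteq> \<infinity>"
proof -
  define \<sigma> where "\<sigma> = \<mu> - \<nu>"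
  define p q where "p = radon_pos_part \<sigma>" and "q = radon_neg_part \<sigma>"
  note P = \<mu>[THEN finite_pos_pos] \<nu>[THEN finite_pos_pos]
  have \<sigma>: "\<sigma> \<in> radon_measures"
    unfolding \<sigma>_def using P by (intro radon_measures_diff pos_radon_imp_radon)
  have pq: "p \<in> pos_radon_measures" "q \<in> pos_radon_measures"
    using \<sigma> lc by (auto simp: p_def q_def intro: radon_pos_part_in_pos_radon radon_neg_part_in_pos_radon)
  \<comment> \<open>The parts of the energy of \<open>\<sigma>\<close> involve \<open>p\<close> and
    \<open>q\<close>, not \<open>\<mu>\<close> and \<open>\<nu>\<close>; the common summand
    \<open>\<pi>\<close> links the two pairs.\<close>
  obtain \<pi> where \<pi>: "\<pi> \<in> pos_radon_measures" "\<mu> = p + \<pi>" "\<nu> = q + \<pi>"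
    using Jordan_minimal[OF lc P] unfolding p_def q_def \<sigma>_def by metis
  have le: "radon_le p \<mu>" "radon_le \<pi> \<mu>" "radon_le q \<nu>" "radon_le \<pi> \<nu>"
    using \<pi> pq by (auto intro: radon_le_add)
  have fin: "p \<in> finite_pos" "q \<in> finite_pos" "\<pi> \<in> finite_pos"
    using le pq \<pi>(1) \<mu> \<nu> by (auto intro: finite_pos_dominated)
  obtain r1 r2 where r: "N p p = ereal r1" "N q q = ereal r2"
    using fin N_eq_n[of p p] N_eq_n[of q q] by (auto simp: finite_pos_def)
  have pos: "energy_pos_part \<kappa> \<sigma> \<sigma> = ereal (r1 + r2 - (M * mass p * mass p + M * mass q * mass q))"
    using energy_parts(1)[OF \<sigma> \<sigma>] by (simp add: r flip: p_def q_def)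
  then have "0 \<le> mutual_energy \<kappa> \<sigma> \<sigma>"
    using pd \<sigma> by (simp add: positive_definite_def energy_defined_def)
  then have "energy_neg_part \<kappa> \<sigma> \<sigma> \<noteq> \<infinity>"
    by (auto simp: mutual_energy_def pos)
  then have neg: "N p q \<noteq> \<infinity>"
    unfolding energy_parts(2)[OF \<sigma> \<sigma>] p_def[symmetric] q_def[symmetric] by auto
  \<comment> \<open>The terms containing \<open>\<pi>\<close> are bounded by diagonal energies, as
    \<open>p\<close> and \<open>\<pi>\<close> lie below \<open>\<mu>\<close>, and \<open>q\<close>
    and \<open>\<pi>\<close> below \<open>\<nu>\<close>. Only \<open>N p q\<close> required positive
    definiteness.\<close>
  have "N p \<pi> \<le> N \<mu> \<mu>" "N \<pi> q \<le> N \<nu> \<nu>"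
    using P pq \<pi>(1) le by (auto intro: N_mono)
  then have "N p \<pi> \<noteq> \<infinity>" "N \<pi> q \<noteq> \<infinity>" "N \<pi> \<pi> \<noteq> \<infinity>"
    using \<mu> \<nu> fin by (auto simp: finite_pos_def)
  then show ?thesis
    using neg \<pi> pq by (simp add: N_add_left N_add_right pos_radon_add)
qed

lemma finite_pos_add:
  assumes "\<mu> \<in> finite_pos" "\<nu> \<in> finite_pos"
  shows "\<mu> + \<nu> \<in> finite_pos"
proof -
  note P = assms[THEN finite_pos_pos]
  have "N (\<mu> + \<nu>) (\<mu> + \<nu>) \<noteq> \<infinity>"
    using finite_pos_cross[OF assms(1,1)] finite_pos_cross[OF assms(1,2)]
      finite_pos_cross[OF assms(2,1)] finite_pos_cross[OF assms(2,2)] P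
    by (simp add: N_add_left N_add_right pos_radon_add)
  then show ?thesis
    using P by (simp add: finite_pos_def pos_radon_add)
qed

text \<open>Any representation a - b arises from the Jordan one by adding the same positive measure
  to both parts. In the bilinear expansion these common summands cancel, so the energy can be
  computed without knowing the Jordan parts.\<close>

lemma mutual_energy_diff:
  assumes P: "a \<in> pos_radon_measures" "b \<in> pos_radon_measures" "c \<in> pos_radon_measures" "d \<in> pos_radon_measures"
    and fin: "N a c \<noteq> \<infinity>" "N a d \<noteq> \<infinity>" "N b c \<noteq> \<infinity>" "N b d \<noteq> \<infinity>"
  shows "energy_defined \<kappa> (a - b) (c - d)"
    and "mutual_energy \<kappa> (a - b) (c - d)
      = ereal (n a c + n b d - n a d - n b c - M * (mass a - mass b) * (mass c - mass d))"
proof -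
  define p q where "p = radon_pos_part (a - b)" and "q = radon_neg_part (a - b)"
  define u v where "u = radon_pos_part (c - d)" and "v = radon_neg_part (c - d)"
  have \<sigma>: "a - b \<in> radon_measures" "c - d \<in> radon_measures"
    using P by (auto intro: radon_measures_diff pos_radon_imp_radon)
  have Q: "p \<in> pos_radon_measures" "q \<in> pos_radon_measures" "u \<in> pos_radon_measures" "v \<in> pos_radon_measures"
    using \<sigma> lc by (auto simp: p_def q_def u_def v_def intro: radon_pos_part_in_pos_radon radon_neg_part_in_pos_radon)
  obtain \<pi> where \<pi>: "\<pi> \<in> pos_radon_measures" "a = p + \<pi>" "b = q + \<pi>"
    using Jordan_minimal[OF lc P(1,2)] unfolding p_def q_def by metis
  obtain \<rho> where \<rho>: "\<rho> \<in> pos_radon_measures" "c = u + \<rho>" "d = v + \<rho>"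
    using Jordan_minimal[OF lc P(3,4)] unfolding u_def v_def by metis
  note R = Q \<pi>(1) \<rho>(1)
  have NN: "N p u \<noteq> \<infinity>" "N p \<rho> \<noteq> \<infinity>" "N \<pi> u \<noteq> \<infinity>" "N \<pi> \<rho> \<noteq> \<infinity>"
    "N p v \<noteq> \<infinity>" "N \<pi> v \<noteq> \<infinity>" "N q u \<noteq> \<infinity>" "N q \<rho> \<noteq> \<infinity>" "N q v \<noteq> \<infinity>"
    using fin R unfolding \<pi>(2,3) \<rho>(2,3) by (simp_all add: N_add_left N_add_right pos_radon_add)
  have NN': "N p (u + \<rho>) \<noteq> \<infinity>" "N p (v + \<rho>) \<noteq> \<infinity>" "N q (u + \<rho>) \<noteq> \<infinity>" "N q (v + \<rho>) \<noteq> \<infinity>"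
    "N \<pi> (u + \<rho>) \<noteq> \<infinity>" "N \<pi> (v + \<rho>) \<noteq> \<infinity>"
    using R NN by (simp_all add: N_add_right)
  have exp: "n a c = n p u + n p \<rho> + (n \<pi> u + n \<pi> \<rho>)" "n a d = n p v + n p \<rho> + (n \<pi> v + n \<pi> \<rho>)"
    "n b c = n q u + n q \<rho> + (n \<pi> u + n \<pi> \<rho>)" "n b d = n q v + n q \<rho> + (n \<pi> v + n \<pi> \<rho>)"
    using n_add_left[of p \<pi> c] n_add_left[of p \<pi> d] n_add_left[of q \<pi> c] n_add_left[of q \<pi> d]
      n_add_right[of p u \<rho>] n_add_right[of p v \<rho>] n_add_right[of q u \<rho>] n_add_right[of q v \<rho>]
      n_add_right[of \<pi> u \<rho>] n_add_right[of \<pi> v \<rho>]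
    unfolding \<pi>(2,3) \<rho>(2,3) using R NN NN' by (simp_all add: pos_radon_add)
  obtain r1 r2 r3 r4 where r: "N p u = ereal r1" "N q v = ereal r2" "N p v = ereal r3" "N q u = ereal r4"
    using NN Q N_eq_n[of p u] N_eq_n[of q v] N_eq_n[of p v] N_eq_n[of q u] by blast
  have pos: "energy_pos_part \<kappa> (a - b) (c - d) = ereal (r1 + r2 - (M * mass p * mass u + M * mass q * mass v))"
    using energy_parts(1)[OF \<sigma>] by (simp add: r flip: p_def q_def u_def v_def)
  have neg: "energy_neg_part \<kappa> (a - b) (c - d) = ereal (r3 + r4 - (M * mass p * mass v + M * mass q * mass u))"
    using energy_parts(2)[OF \<sigma>] by (simp add: r flip: p_def q_def u_def v_def)
  show "energy_defined \<kappa> (a - b) (c - d)"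
    by (simp add: energy_defined_def pos)
  have m: "mass a - mass b = mass p - mass q" "mass c - mass d = mass u - mass v"
    by (simp_all add: \<pi>(2,3) \<rho>(2,3))
  show "mutual_energy \<kappa> (a - b) (c - d)
      = ereal (n a c + n b d - n a d - n b c - M * (mass a - mass b) * (mass c - mass d))"
    unfolding mutual_energy_def pos neg exp m r by (simp add: algebra_simps)
qed

section \<open>The bilinear form on measures of finite energy\<close>

abbreviation E :: "(('a \<Rightarrow> real) \<Rightarrow> real) \<Rightarrow> (('a \<Rightarrow> real) \<Rightarrow> real) \<Rightarrow> real" where
  "E \<mu> \<nu> \<equiv> real_of_ereal (mutual_energy \<kappa> \<mu> \<nu>)"

lemma E_diff:
  assumes "a \<in> finite_pos" "b \<in> finite_pos" "c \<in> finite_pos" "d \<in> finite_pos"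
  shows "energy_defined \<kappa> (a - b) (c - d)" "\<bar>mutual_energy \<kappa> (a - b) (c - d)\<bar> \<noteq> \<infinity>"
    "E (a - b) (c - d) = n a c + n b d - n a d - n b c - M * (mass a - mass b) * (mass c - mass d)"
  using mutual_energy_diff[of a b c d] assms by (auto simp: finite_pos_pos finite_pos_cross)

text \<open>Describing the measures of finite energy as differences of elements of a convex cone
  makes their linear structure evident; with the Jordan definition, closure under addition is
  not.\<close>

lemma finite_energy_measures_eq: "finite_energy_measures \<kappa> = {a - b | a b. a \<in> finite_pos \<and> b \<in> finite_pos}"
proof (intro equalityI subsetI)
  fix \<sigma> assume "\<sigma> \<in> finite_energy_measures \<kappa>"
  then have \<sigma>: "\<sigma> \<in> radon_measures" and e: "energy_defined \<kappa> \<sigma> \<sigma>" "\<bar>mutual_energy \<kappa> \<sigma> \<sigma>\<bar> \<noteq> \<infinity>"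
    by (auto simp: finite_energy_measures_def)
  define p q where "p = radon_pos_part \<sigma>" and "q = radon_neg_part \<sigma>"
  have pq: "p \<in> pos_radon_measures" "q \<in> pos_radon_measures"
    using \<sigma> lc by (auto simp: p_def q_def intro: radon_pos_part_in_pos_radon radon_neg_part_in_pos_radon)
  \<comment> \<open>One of the two parts is finite by definedness, and an infinite other part would
    make the difference infinite.\<close>
  have "\<bar>energy_pos_part \<kappa> \<sigma> \<sigma>\<bar> \<noteq> \<infinity>"
    using e by (cases "energy_pos_part \<kappa> \<sigma> \<sigma>"; cases "energy_neg_part \<kappa> \<sigma> \<sigma>")
      (auto simp: energy_defined_def mutual_energy_def)
  then have "N p p \<noteq> \<infinity>" "N q q \<noteq> \<infinity>"
    unfolding energy_parts(1)[OF \<sigma> \<sigma>] p_def[symmetric] q_def[symmetric]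
    using N_nonneg[OF pq(1,1)] N_nonneg[OF pq(2,2)] by auto
  moreover have "\<sigma> = p - q"
    using Jordan_decomposition[OF lc \<sigma>] by (simp add: p_def q_def)
  ultimately show "\<sigma> \<in> {a - b | a b. a \<in> finite_pos \<and> b \<in> finite_pos}"
    using pq by (auto simp: finite_pos_def)
next
  fix \<sigma> assume "\<sigma> \<in> {a - b | a b. a \<in> finite_pos \<and> b \<in> finite_pos}"
  then obtain a b where ab: "a \<in> finite_pos" "b \<in> finite_pos" "\<sigma> = a - b"
    by blast
  then show "\<sigma> \<in> finite_energy_measures \<kappa>"
    using E_diff(1,2)[of a b a b] by (simp add: finite_energy_measures_def radon_measures_diff finite_pos_radon)
qed

lemma finite_energyE:
  assumes "\<sigma> \<in> finite_energy_measures \<kappa>"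
  obtains a b where "a \<in> finite_pos" "b \<in> finite_pos" "\<sigma> = a - b"
  using assms by (auto simp: finite_energy_measures_eq)

lemma finite_energyI: "a \<in> finite_pos \<Longrightarrow> b \<in> finite_pos \<Longrightarrow> a - b \<in> finite_energy_measures \<kappa>"
  by (auto simp: finite_energy_measures_eq)

lemma finite_pos_0: "(\<lambda>_. 0) \<in> finite_pos"
  by (simp add: finite_pos_def pos_radon_0)

lemma finite_pos_finite_energy: "a \<in> finite_pos \<Longrightarrow> a \<in> finite_energy_measures \<kappa>"
  using finite_energyI[OF _ finite_pos_0, of a] by (simp add: fun_diff_def)

lemma mutual_energy_pos:
  assumes "a \<in> pos_radon_measures" "b \<in> pos_radon_measures"
  shows "mutual_energy \<kappa> a b = N a b - ereal (M * mass a * mass b)"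
  using energy_parts[of a b] assms lc
  by (simp add: mutual_energy_def radon_pos_part_pos radon_neg_part_pos pos_radon_imp_radon flip: zero_ereal_def)

lemma E_add_left:
  assumes "\<sigma> \<in> finite_energy_measures \<kappa>" "\<sigma>' \<in> finite_energy_measures \<kappa>" "\<tau> \<in> finite_energy_measures \<kappa>"
  shows "E (\<sigma> + \<sigma>') \<tau> = E \<sigma> \<tau> + E \<sigma>' \<tau>"
proof -
  obtain a b where ab: "a \<in> finite_pos" "b \<in> finite_pos" "\<sigma> = a - b"
    using assms(1) by (rule finite_energyE)
  obtain a' b' where ab': "a' \<in> finite_pos" "b' \<in> finite_pos" "\<sigma>' = a' - b'"
    using assms(2) by (rule finite_energyE)
  obtain c d where cd: "c \<in> finite_pos" "d \<in> finite_pos" "\<tau> = c - d"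
    using assms(3) by (rule finite_energyE)
  have eq: "\<sigma> + \<sigma>' = (a + a') - (b + b')"
    by (auto simp: ab ab')
  note fin = ab(1,2) ab'(1,2) cd(1,2)
  show ?thesis
    unfolding eq unfolding ab(3) ab'(3) cd(3)
    using fin by (simp add: E_diff finite_pos_add n_add_left finite_pos_cross finite_pos_pos algebra_simps)
qed

lemma E_add_right:
  assumes "\<sigma> \<in> finite_energy_measures \<kappa>" "\<sigma>' \<in> finite_energy_measures \<kappa>" "\<tau> \<in> finite_energy_measures \<kappa>"
  shows "E \<tau> (\<sigma> + \<sigma>') = E \<tau> \<sigma> + E \<tau> \<sigma>'"
proof -
  obtain a b where ab: "a \<in> finite_pos" "b \<in> finite_pos" "\<sigma> = a - b"
    using assms(1) by (rule finite_energyE)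
  obtain a' b' where ab': "a' \<in> finite_pos" "b' \<in> finite_pos" "\<sigma>' = a' - b'"
    using assms(2) by (rule finite_energyE)
  obtain c d where cd: "c \<in> finite_pos" "d \<in> finite_pos" "\<tau> = c - d"
    using assms(3) by (rule finite_energyE)
  have eq: "\<sigma> + \<sigma>' = (a + a') - (b + b')"
    by (auto simp: ab ab')
  note fin = ab(1,2) ab'(1,2) cd(1,2)
  show ?thesis
    unfolding eq unfolding ab(3) ab'(3) cd(3)
    using fin by (simp add: E_diff finite_pos_add n_add_right finite_pos_cross finite_pos_pos algebra_simps)
qed

lemma finite_energy_add:
  assumes "\<sigma> \<in> finite_energy_measures \<kappa>" "\<tau> \<in> finite_energy_measures \<kappa>"
  shows "\<sigma> + \<tau> \<in> finite_energy_measures \<kappa>"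
proof -
  obtain a b where ab: "a \<in> finite_pos" "b \<in> finite_pos" "\<sigma> = a - b"
    using assms(1) by (rule finite_energyE)
  obtain c d where cd: "c \<in> finite_pos" "d \<in> finite_pos" "\<tau> = c - d"
    using assms(2) by (rule finite_energyE)
  have "(a + c) - (b + d) \<in> finite_energy_measures \<kappa>"
    using ab cd by (intro finite_energyI finite_pos_add)
  also have "(a + c) - (b + d) = \<sigma> + \<tau>"
    by (auto simp: ab cd)
  finally show ?thesis .
qed

lemma finite_energy_uminus:
  assumes "\<sigma> \<in> finite_energy_measures \<kappa>"
  shows "- \<sigma> \<in> finite_energy_measures \<kappa>"
proof -
  obtain a b where ab: "a \<in> finite_pos" "b \<in> finite_pos" "\<sigma> = a - b"
    using assms by (rule finite_energyE)
  then have "- \<sigma> = b - a"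
    by (simp add: fun_eq_iff)
  then show ?thesis
    using ab by (simp add: finite_energyI)
qed

lemma E_uminus:
  assumes "\<sigma> \<in> finite_energy_measures \<kappa>" "\<tau> \<in> finite_energy_measures \<kappa>"
  shows "E (- \<sigma>) \<tau> = - E \<sigma> \<tau>" "E \<sigma> (- \<tau>) = - E \<sigma> \<tau>"
proof -
  obtain a b where ab: "a \<in> finite_pos" "b \<in> finite_pos" "\<sigma> = a - b"
    using assms(1) by (rule finite_energyE)
  obtain c d where cd: "c \<in> finite_pos" "d \<in> finite_pos" "\<tau> = c - d"
    using assms(2) by (rule finite_energyE)
  have eq: "- \<sigma> = b - a" "- \<tau> = d - c"
    by (simp_all add: ab cd fun_eq_iff)
  show "E (- \<sigma>) \<tau> = - E \<sigma> \<tau>"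
    unfolding eq unfolding ab(3) cd(3) using ab(1,2) cd(1,2) by (simp add: E_diff algebra_simps)
  show "E \<sigma> (- \<tau>) = - E \<sigma> \<tau>"
    unfolding eq unfolding ab(3) cd(3) using ab(1,2) cd(1,2) by (simp add: E_diff algebra_simps)
qed

lemma n_cmult:
  assumes "0 \<le> c" "\<mu> \<in> pos_radon_measures" "\<nu> \<in> pos_radon_measures"
  shows "n (\<lambda>f. c * \<mu> f) \<nu> = c * n \<mu> \<nu>" "n \<mu> (\<lambda>f. c * \<nu> f) = c * n \<mu> \<nu>"
  using assms by (simp_all add: N_cmult_left N_cmult_right)

lemma E_cmult_pos:
  assumes "\<sigma> \<in> finite_energy_measures \<kappa>" "\<tau> \<in> finite_energy_measures \<kappa>" "0 \<le> t"
  shows "(\<lambda>f. t * \<sigma> f) \<in> finite_energy_measures \<kappa>"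
    "E (\<lambda>f. t * \<sigma> f) \<tau> = t * E \<sigma> \<tau>" "E \<tau> (\<lambda>f. t * \<sigma> f) = t * E \<tau> \<sigma>"
proof -
  obtain a b where ab: "a \<in> finite_pos" "b \<in> finite_pos" "\<sigma> = a - b"
    using assms(1) by (rule finite_energyE)
  obtain c d where cd: "c \<in> finite_pos" "d \<in> finite_pos" "\<tau> = c - d"
    using assms(2) by (rule finite_energyE)
  have eq: "(\<lambda>f. t * \<sigma> f) = (\<lambda>f. t * a f) - (\<lambda>f. t * b f)"
    by (auto simp: ab algebra_simps)
  show "(\<lambda>f. t * \<sigma> f) \<in> finite_energy_measures \<kappa>"
    unfolding eq using ab assms(3) by (intro finite_energyI finite_pos_cmult)
  show "E (\<lambda>f. t * \<sigma> f) \<tau> = t * E \<sigma> \<tau>"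
    unfolding eq unfolding ab(3) cd(3)
    using ab(1,2) cd(1,2) assms(3) by (simp add: E_diff finite_pos_cmult n_cmult finite_pos_pos algebra_simps)
  show "E \<tau> (\<lambda>f. t * \<sigma> f) = t * E \<tau> \<sigma>"
    unfolding eq unfolding ab(3) cd(3)
    using ab(1,2) cd(1,2) assms(3) by (simp add: E_diff finite_pos_cmult n_cmult finite_pos_pos algebra_simps)
qed

section \<open>Cauchy-Schwarz and the energy seminorm\<close>

lemma E_self_nonneg: "\<sigma> \<in> finite_energy_measures \<kappa> \<Longrightarrow> 0 \<le> E \<sigma> \<sigma>"
  using pd by (auto simp: finite_energy_measures_def positive_definite_def intro!: real_of_ereal_pos)

text \<open>Nonnegative coefficients are enough, since the opposite sign is obtained by replacing
  \<open>\<tau>\<close> with \<open>- \<tau>\<close>.\<close>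

lemma E_quadratic:
  assumes "\<sigma> \<in> finite_energy_measures \<kappa>" "\<tau> \<in> finite_energy_measures \<kappa>" "0 \<le> s" "0 \<le> t"
  shows "0 \<le> s\<^sup>2 * E \<sigma> \<sigma> + s * t * (E \<sigma> \<tau> + E \<tau> \<sigma>) + t\<^sup>2 * E \<tau> \<tau>"
proof -
  let ?s = "\<lambda>f. s * \<sigma> f" and ?t = "\<lambda>f. t * \<tau> f"
  have fin: "?s \<in> finite_energy_measures \<kappa>" "?t \<in> finite_energy_measures \<kappa>"
    using assms by (auto intro: E_cmult_pos)
  have "0 \<le> E (?s + ?t) (?s + ?t)"
    using fin by (intro E_self_nonneg finite_energy_add)
  also have "\<dots> = s\<^sup>2 * E \<sigma> \<sigma> + s * t * (E \<sigma> \<tau> + E \<tau> \<sigma>) + t\<^sup>2 * E \<tau> \<tau>"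
    using assms fin finite_energy_add[OF fin]
    by (simp add: E_add_left E_add_right E_cmult_pos algebra_simps power2_eq_square)
  finally show ?thesis .
qed

text \<open>The form \<open>E\<close> is not shown to be symmetric: its symmetrisation suffices for the triangle
  inequality.\<close>

lemma E_Cauchy_Schwarz:
  assumes \<sigma>: "\<sigma> \<in> finite_energy_measures \<kappa>" and \<tau>: "\<tau> \<in> finite_energy_measures \<kappa>"
  shows "E \<sigma> \<tau> + E \<tau> \<sigma> \<le> 2 * sqrt (E \<sigma> \<sigma>) * sqrt (E \<tau> \<tau>)"
proof -
  define p q r where "p = sqrt (E \<sigma> \<sigma>)" and "q = sqrt (E \<tau> \<tau>)" and "r = E \<sigma> \<tau> + E \<tau> \<sigma>"
  have pq: "0 \<le> p" "0 \<le> q" "E \<sigma> \<sigma> = p\<^sup>2" "E \<tau> \<tau> = q\<^sup>2"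
    using E_self_nonneg assms by (auto simp: p_def q_def)
  have \<tau>': "- \<tau> \<in> finite_energy_measures \<kappa>"
    using \<tau> by (rule finite_energy_uminus)
  have quad: "s * t * r \<le> s\<^sup>2 * p\<^sup>2 + t\<^sup>2 * q\<^sup>2" if "0 \<le> s" "0 \<le> t" for s t
    using E_quadratic[OF \<sigma> \<tau>' that] pq(3,4) \<sigma> \<tau> \<tau>'
    by (simp add: E_uminus r_def algebra_simps)
  have "r \<le> 2 * p * q"
  proof (cases "p = 0 \<or> q = 0")
    case True
    have "r \<le> 0"
    proof (rule ccontr)
      assume "\<not> r \<le> 0"
      then have r: "0 < r"
        by simp
      \<comment> \<open>The factor is chosen to make the left side \<open>q\<^sup>2 + 1\<close>,
        which contradicts the right side \<open>q\<^sup>2\<close> if \<open>p = 0\<close>. The next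
        inequality does the same for \<open>q = 0\<close>.\<close>
      have "(q\<^sup>2 + 1) / r * 1 * r \<le> ((q\<^sup>2 + 1) / r)\<^sup>2 * p\<^sup>2 + 1\<^sup>2 * q\<^sup>2"
        using r by (intro quad) auto
      moreover have "1 * ((p\<^sup>2 + 1) / r) * r \<le> 1\<^sup>2 * p\<^sup>2 + ((p\<^sup>2 + 1) / r)\<^sup>2 * q\<^sup>2"
        using r by (intro quad) auto
      ultimately show False
        using True r by auto
    qed
    then show ?thesis
      using True by auto
  next
    case False
    \<comment> \<open>The coefficients \<open>q\<close> and \<open>p\<close> make both squares on
      the right equal, the case of equality in the arithmetic-geometric mean inequality.\<close>
    have "(q * p) * r \<le> (q * p) * (2 * p * q)"
      using quad[of q p] pq by (simp add: power2_eq_square algebra_simps)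
    moreover have "0 < q * p"
      using False pq by simp
    ultimately show ?thesis
      by (simp add: mult_le_cancel_left_pos)
  qed
  then show ?thesis
    by (simp add: p_def q_def r_def)
qed

lemma energy_norm_eq: "energy_norm \<kappa> \<sigma> = sqrt (E \<sigma> \<sigma>)"
  by (simp add: energy_norm_def)

lemma energy_norm_triangle:
  assumes "\<sigma> \<in> finite_energy_measures \<kappa>" "\<tau> \<in> finite_energy_measures \<kappa>"
  shows "energy_norm \<kappa> (\<sigma> + \<tau>) \<le> energy_norm \<kappa> \<sigma> + energy_norm \<kappa> \<tau>"
proof -
  have "E (\<sigma> + \<tau>) (\<sigma> + \<tau>) = E \<sigma> \<sigma> + (E \<sigma> \<tau> + E \<tau> \<sigma>) + E \<tau> \<tau>"
    using assms finite_energy_add[OF assms] by (simp add: E_add_left E_add_right)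
  also have "\<dots> \<le> (sqrt (E \<sigma> \<sigma>) + sqrt (E \<tau> \<tau>))\<^sup>2"
    using E_Cauchy_Schwarz[OF assms] E_self_nonneg[OF assms(1)] E_self_nonneg[OF assms(2)]
    by (simp add: power2_sum)
  finally show ?thesis
    unfolding energy_norm_eq using E_self_nonneg[OF assms(1)] E_self_nonneg[OF assms(2)]
    by (intro real_le_lsqrt add_nonneg_nonneg) auto
qed

lemma energy_norm_uminus: "\<sigma> \<in> finite_energy_measures \<kappa> \<Longrightarrow> energy_norm \<kappa> (- \<sigma>) = energy_norm \<kappa> \<sigma>"
  by (simp add: energy_norm_eq E_uminus finite_energy_uminus)

end

section \<open>Measures carried by a set\<close>

lemma radon_outer_nonneg:
  assumes "\<nu> \<in> pos_radon_measures"
  shows "0 \<le> radon_outer \<nu> Q"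
  unfolding radon_outer_def
  by (intro INF_greatest lsc_integral_nonneg Cc_mono_pos_radon assms) (simp add: indicator_def)

lemma radon_outer_lessE:
  assumes "radon_outer \<nu> Q < c"
  obtains G where "open G" "Q \<subseteq> G" "lsc_integral (indicator G) \<nu> < c"
  using assms by (auto simp: radon_outer_def INF_less_iff)

lemma radon_outer_open:
  assumes "\<nu> \<in> pos_radon_measures" "open G"
  shows "radon_outer \<nu> G = lsc_integral (indicator G) \<nu>"
proof (rule order.antisym)
  show "radon_outer \<nu> G \<le> lsc_integral (indicator G) \<nu>"
    unfolding radon_outer_def using assms by (intro INF_lower) auto
  show "lsc_integral (indicator G) \<nu> \<le> radon_outer \<nu> G"
    unfolding radon_outer_def
  proof (rule INF_greatest, rule lsc_integral_least)
    fix H f assume H: "H \<in> {H. open H \<and> G \<subseteq> H}" and f: "f \<in> Cc" "\<And>x. ereal (f x) \<le> indicator G x"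
    have "(indicator G x :: ereal) \<le> indicator H x" for x
      using H by (auto simp: indicator_def)
    then have "ereal (f x) \<le> indicator H x" for x
      using f(2) order.trans by blast
    then show "ereal (\<nu> f) \<le> lsc_integral (indicator H) \<nu>"
      using f(1) by (intro lsc_integral_upper)
  qed
qed

lemma radon_outer_mono:
  assumes "\<mu> \<in> pos_radon_measures" "radon_le \<mu> \<nu>" "Q \<subseteq> R"
  shows "radon_outer \<mu> Q \<le> radon_outer \<nu> R"
  unfolding radon_outer_def
proof (rule INF_greatest)
  fix G assume G: "G \<in> {G. open G \<and> R \<subseteq> G}"
  have "(INF G\<in>{G. open G \<and> Q \<subseteq> G}. lsc_integral (indicator G) \<mu>) \<le> lsc_integral (indicator G) \<mu>"
    using G assms(3) by (intro INF_lower) auto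
  also have "\<dots> \<le> lsc_integral (indicator G) \<nu>"
    by (rule lsc_integral_mono[OF _ Cc_mono_pos_radon[OF assms(1)] radon_leD[OF assms(2)]]) (auto simp: indicator_def)
  finally show "(INF G\<in>{G. open G \<and> Q \<subseteq> G}. lsc_integral (indicator G) \<mu>) \<le> lsc_integral (indicator G) \<nu>" .
qed

lemma radon_outer_0: "radon_outer (\<lambda>_. 0) Q = 0"
proof -
  have "lsc_integral (indicator G) (\<lambda>_. 0) = 0" for G :: "'a set"
    by (rule lsc_integral_0) (simp add: indicator_def)
  then show ?thesis
    by (auto simp: radon_outer_def INF_constant)
qed

lemma measures_carried_by_0: "(\<lambda>_. 0) \<in> measures_carried_by Q"
  by (simp add: measures_carried_by_def locally_negligible_def pos_radon_0 radon_outer_0)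

lemma measures_carried_by_pos: "\<nu> \<in> measures_carried_by Q \<Longrightarrow> \<nu> \<in> pos_radon_measures"
  by (simp add: measures_carried_by_def)

lemma measures_carried_by_dominated:
  assumes "\<nu> \<in> measures_carried_by Q" "\<mu> \<in> pos_radon_measures" "radon_le \<mu> \<nu>"
  shows "\<mu> \<in> measures_carried_by Q"
proof -
  have "radon_outer \<mu> (- Q \<inter> K) = 0" if "compact K" for K
    using radon_outer_mono[OF assms(2,3) order.refl, of "- Q \<inter> K"] radon_outer_nonneg[OF assms(2), of "- Q \<inter> K"] assms(1) that
    by (auto simp: measures_carried_by_def locally_negligible_def)
  then show ?thesis
    using assms(2) by (simp add: measures_carried_by_def locally_negligible_def)
qed

lemma measures_carried_by_mono:
  assumes "\<nu> \<in> measures_carried_by Q" "Q \<subseteq> R"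
  shows "\<nu> \<in> measures_carried_by R"
proof -
  have \<nu>: "\<nu> \<in> pos_radon_measures"
    using assms(1) by (rule measures_carried_by_pos)
  have "radon_outer \<nu> (- R \<inter> K) = 0" if "compact K" for K
    using radon_outer_mono[OF \<nu> radon_le_refl, of "- R \<inter> K" "- Q \<inter> K"] radon_outer_nonneg[OF \<nu>, of "- R \<inter> K"] assms that
    by (auto simp: measures_carried_by_def locally_negligible_def)
  then show ?thesis
    using \<nu> by (simp add: measures_carried_by_def locally_negligible_def)
qed

text \<open>A test function scaled below 1 lies under the indicator of every open superset of
  \<open>K\<close>, and such supersets have arbitrarily small measure.\<close>

lemma negligible_compact_integral_0:
  assumes \<nu>: "\<nu> \<in> pos_radon_measures" and K: "radon_outer \<nu> K = 0"
    and f: "f \<in> Cc" "{x. f x \<noteq> 0} \<subseteq> K"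
  shows "\<nu> f = 0"
proof -
  have nonneg: "\<nu> h = 0" if h: "h \<in> Cc" "\<And>x. 0 \<le> h x" "{x. h x \<noteq> 0} \<subseteq> K" for h
  proof -
    obtain B where B: "0 \<le> B" "\<And>x. \<bar>h x\<bar> \<le> B"
      using Cc_bounded[OF h(1)] by metis
    \<comment> \<open>Dividing by \<open>B + 1\<close> brings the function below 1 and is legitimate
      even for \<open>B = 0\<close>.\<close>
    let ?g = "\<lambda>x. 1 / (B + 1) * h x"
    have g: "?g \<in> Cc"
      using h(1) by (rule Cc_cmult)
    have "\<nu> ?g \<le> e" if e: "0 < e" for e
    proof -
      have "radon_outer \<nu> K < ereal e"
        using K e by simp
      then obtain G where G: "open G" "K \<subseteq> G" "lsc_integral (indicator G) \<nu> < ereal e"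
        by (rule radon_outer_lessE)
      have "ereal (?g x) \<le> indicator G x" for x
      proof (cases "x \<in> G")
        case True
        then show ?thesis
          using B(1) B(2)[of x] h(2)[of x] by (simp add: field_simps)
      next
        case False
        then have "h x = 0"
          using h(3) G(2) by auto
        then show ?thesis
          by (simp add: zero_ereal_def[symmetric])
      qed
      then have "ereal (\<nu> ?g) \<le> lsc_integral (indicator G) \<nu>"
        by (rule lsc_integral_upper[OF g])
      also have "\<dots> < ereal e"
        by (rule G(3))
      finally show ?thesis
        by simp
    qed
    then have "\<nu> ?g \<le> 0"
      using field_le_epsilon[of "\<nu> ?g" 0] by simp
    moreover have "\<nu> ?g = 1 / (B + 1) * \<nu> h"
      using \<nu> h(1) by (intro radon_cmult pos_radon_imp_radon)
    moreover have "0 \<le> \<nu> h"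
      using \<nu> h(2) by (intro pos_radon_nonneg[OF \<nu>])
    moreover have "0 < 1 / (B + 1)"
      using B(1) by simp
    ultimately show ?thesis
      by (metis mult_pos_pos not_less order_le_less)
  qed
  have "(\<lambda>x. max 0 (f x)) \<in> Cc" "(\<lambda>x. max 0 (- f x)) \<in> Cc"
    using f(1) by (auto intro!: Cc_pos Cc_minus)
  moreover from this have "\<nu> (\<lambda>x. max 0 (f x)) = 0" "\<nu> (\<lambda>x. max 0 (- f x)) = 0"
    using f(2) by (auto intro!: nonneg)
  moreover have "(\<lambda>x. max 0 (f x) - max 0 (- f x)) = f"
    by auto
  ultimately show ?thesis
    using radon_diff[OF pos_radon_imp_radon[OF \<nu>]] by (metis diff_0_right)
qed

text \<open>This transfers the local finiteness of the plates to the functionals: a plate missing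
  \<open>K\<close> contributes nothing to functions vanishing off \<open>K\<close>.\<close>

lemma carried_by_disjoint_0:
  assumes "\<nu> \<in> measures_carried_by Q" "compact K" "Q \<inter> K = {}" "f \<in> Cc" "{x. f x \<noteq> 0} \<subseteq> K"
  shows "\<nu> f = 0"
proof -
  have "- Q \<inter> K = K"
    using assms(3) by auto
  then have "radon_outer \<nu> K = 0"
    using assms(1,2) by (metis (mono_tags, lifting) measures_carried_by_def locally_negligible_def mem_Collect_eq)
  then show ?thesis
    using negligible_compact_integral_0[OF measures_carried_by_pos[OF assms(1)] _ assms(4,5)] by simp
qed

lemma locally_finite_family_finite:
  assumes "locally_finite_family I \<mu>" "\<And>i. i \<in> I \<Longrightarrow> \<mu> i \<in> radon_measures"
  shows "finite {i \<in> I. \<mu> i f \<noteq> 0}"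
proof (cases "f \<in> Cc")
  case True
  then obtain K where K: "compact K" "{x. f x \<noteq> 0} \<subseteq> K"
    by (rule CcE)
  show ?thesis
    by (rule finite_subset[of _ "{i \<in> I. \<exists>f\<in>Cc. {x. f x \<noteq> 0} \<subseteq> K \<and> \<mu> i f \<noteq> 0}"])
      (use assms(1) K True in \<open>auto simp: locally_finite_family_def\<close>)
next
  case False
  then have "{i \<in> I. \<mu> i f \<noteq> 0} = {}"
    using assms(2) radon_outside by auto
  then show ?thesis
    by (simp only: finite.emptyI)
qed

text \<open>Sums the correction terms of the kernel shift, with \<open>w\<close> built from the
  masses: the masses of a locally finite family are values at one fixed function, so almost all of
  them vanish.\<close>

lemma has_sum_outer_product:
  fixes w :: "'i \<Rightarrow> real"
  assumes "finite {i \<in> I. w i \<noteq> 0}"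
  shows "((\<lambda>(i, j). w i * w j) has_sum (infsum w I * infsum w I)) (I \<times> I)"
proof -
  let ?J = "{i \<in> I. w i \<noteq> 0}"
  have "infsum w I = sum w ?J"
    using assms by (intro infsum_finite_support) auto
  then have "infsum w I * infsum w I = (\<Sum>(i, j)\<in>?J \<times> ?J. w i * w j)"
    by (simp add: sum_product sum.cartesian_product)
  then show ?thesis
    using assms by (intro has_sum_finite_neutralI[of "?J \<times> ?J"]) auto
qed

section \<open>Energies of locally finite sums as unconditional series\<close>

context shifted_kernel
begin

text \<open>Since the terms are nonnegative, the supremum of finite sums in \<open>N_sum\<close> is
  an unconditional sum. This is the source of absolute convergence.\<close>

lemma n_has_sum:
  assumes fin: "locally_finite_family I \<mu>" "locally_finite_family J \<nu>"
    and \<mu>: "\<And>i. i \<in> I \<Longrightarrow> \<mu> i \<in> pos_radon_measures" and \<nu>: "\<And>j. j \<in> J \<Longrightarrow> \<nu> j \<in> pos_radon_measures"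
    and N: "N (radon_sum I \<mu>) (radon_sum J \<nu>) \<noteq> \<infinity>"
  shows "((\<lambda>(i, j). n (\<mu> i) (\<nu> j)) has_sum n (radon_sum I \<mu>) (radon_sum J \<nu>)) (I \<times> J)"
proof -
  let ?c = "n (radon_sum I \<mu>) (radon_sum J \<nu>)" and ?f = "\<lambda>(i, j). n (\<mu> i) (\<nu> j)"
  have NS: "N (radon_sum I \<mu>) (radon_sum J \<nu>) = ereal ?c"
    using radon_sum_in_pos_radon[OF lc fin(1) \<mu>] radon_sum_in_pos_radon[OF lc fin(2) \<nu>] N by (intro N_eq_n)
  have SUP: "ereal ?c = (SUP T\<in>{T. finite T \<and> T \<subseteq> I \<times> J}. \<Sum>(i, j)\<in>T. N (\<mu> i) (\<nu> j))"
    unfolding NS[symmetric] using \<mu> \<nu> by (rule N_sum[OF fin])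
  have le: "(\<Sum>(i, j)\<in>T. N (\<mu> i) (\<nu> j)) \<le> ereal ?c" if "finite T" "T \<subseteq> I \<times> J" for T
    unfolding SUP using that by (intro SUP_upper) auto
  have "N (\<mu> i) (\<nu> j) \<noteq> \<infinity>" if "i \<in> I" "j \<in> J" for i j
    using le[of "{(i, j)}"] that by auto
  then have eq: "N (\<mu> i) (\<nu> j) = ereal (n (\<mu> i) (\<nu> j))" if "i \<in> I" "j \<in> J" for i j
    using that \<mu> \<nu> by (intro N_eq_n) auto
  have sum_eq: "(\<Sum>(i, j)\<in>T. N (\<mu> i) (\<nu> j)) = ereal (sum ?f T)" if "T \<subseteq> I \<times> J" for T
  proof -
    have "(\<Sum>(i, j)\<in>T. N (\<mu> i) (\<nu> j)) = (\<Sum>k\<in>T. ereal (?f k))"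
      using that eq by (intro sum.cong) auto
    then show ?thesis
      by simp
  qed
  have pos: "0 \<le> ?f k" if "k \<in> I \<times> J" for k
    using that \<mu> \<nu> by (auto intro!: real_of_ereal_pos N_nonneg)
  have summable: "?f summable_on I \<times> J"
  proof (rule nonneg_bdd_above_summable_on[OF pos])
    have "sum ?f T \<le> ?c" if "finite T" "T \<subseteq> I \<times> J" for T
      using le[OF that] sum_eq[OF that(2)] by simp
    then show "bdd_above (sum ?f ` {T. T \<subseteq> I \<times> J \<and> finite T})"
      by (intro bdd_aboveI2[of _ _ ?c]) auto
  qed
  have "ereal (infsum ?f (I \<times> J)) = (SUP T\<in>{T. finite T \<and> T \<subseteq> I \<times> J}. ereal (sum ?f T))"
    by (rule infsum_nonneg_is_SUPREMUM_ereal[OF summable pos])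
  also have "\<dots> = ereal ?c"
    unfolding SUP using sum_eq by (intro SUP_cong) auto
  finally show ?thesis
    using has_sum_infsum[OF summable] by simp
qed

text \<open>The converse direction: summability bounds all finite subsums and hence their
  supremum.\<close>

lemma N_sum_finite:
  assumes fin: "locally_finite_family I \<mu>" "locally_finite_family J \<nu>"
    and \<mu>: "\<And>i. i \<in> I \<Longrightarrow> \<mu> i \<in> pos_radon_measures" and \<nu>: "\<And>j. j \<in> J \<Longrightarrow> \<nu> j \<in> pos_radon_measures"
    and N: "\<And>i j. i \<in> I \<Longrightarrow> j \<in> J \<Longrightarrow> N (\<mu> i) (\<nu> j) \<noteq> \<infinity>"
    and summable: "(\<lambda>(i, j). n (\<mu> i) (\<nu> j)) summable_on I \<times> J"
  shows "N (radon_sum I \<mu>) (radon_sum J \<nu>) \<noteq> \<infinity>"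
proof -
  let ?f = "\<lambda>(i, j). n (\<mu> i) (\<nu> j)"
  have pos: "0 \<le> ?f k" if "k \<in> I \<times> J" for k
    using that \<mu> \<nu> by (auto intro!: real_of_ereal_pos N_nonneg)
  have "(\<Sum>(i, j)\<in>T. N (\<mu> i) (\<nu> j)) \<le> ereal (infsum ?f (I \<times> J))" if T: "finite T" "T \<subseteq> I \<times> J" for T
  proof -
    have "(\<Sum>(i, j)\<in>T. N (\<mu> i) (\<nu> j)) = (\<Sum>k\<in>T. ereal (?f k))"
    proof (rule sum.cong[OF refl])
      fix k assume "k \<in> T"
      then obtain i j where "k = (i, j)" "i \<in> I" "j \<in> J"
        using T(2) by blast
      then show "(case k of (i, j) \<Rightarrow> N (\<mu> i) (\<nu> j)) = ereal (?f k)"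
        using N_eq_n[OF \<mu> \<nu> N] by simp
    qed
    also have "\<dots> \<le> ereal (infsum ?f (I \<times> J))"
      using finite_sum_le_infsum[OF summable T] pos by simp
    finally show ?thesis .
  qed
  then have "(SUP T\<in>{T. finite T \<and> T \<subseteq> I \<times> J}. \<Sum>(i, j)\<in>T. N (\<mu> i) (\<nu> j)) \<le> ereal (infsum ?f (I \<times> J))"
    by (intro SUP_least) auto
  moreover have "N (radon_sum I \<mu>) (radon_sum J \<nu>) = (SUP T\<in>{T. finite T \<and> T \<subseteq> I \<times> J}. \<Sum>(i, j)\<in>T. N (\<mu> i) (\<nu> j))"
    using \<mu> \<nu> by (rule N_sum[OF fin])
  ultimately have "N (radon_sum I \<mu>) (radon_sum J \<nu>) \<le> ereal (infsum ?f (I \<times> J))"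
    by simp
  then show ?thesis
    by auto
qed

end

section \<open>Vector measures on a generalized condenser\<close>

locale condenser = shifted_kernel \<kappa> M
  for \<kappa> :: "'a::t2_space \<times> 'a \<Rightarrow> ereal" and M :: real +
  fixes Ipos Ineg :: "'i set" and A :: "'i \<Rightarrow> 'a set"
  assumes condenser: "generalized_condenser Ipos Ineg A"
begin

abbreviation I :: "'i set" where
  "I \<equiv> Ipos \<union> Ineg"

abbreviation s :: "'i \<Rightarrow> real" where
  "s \<equiv> plate_sign Ineg"

abbreviation \<E> :: "('i \<Rightarrow> ('a \<Rightarrow> real) \<Rightarrow> real) set" where
  "\<E> \<equiv> finite_energy_vectors \<kappa> Ipos Ineg A"

abbreviation R :: "('i \<Rightarrow> ('a \<Rightarrow> real) \<Rightarrow> real) \<Rightarrow> ('a \<Rightarrow> real) \<Rightarrow> real" where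
  "R \<equiv> condenser_R Ipos Ineg"

lemma carried_locally_finite:
  assumes "\<And>i. i \<in> I \<Longrightarrow> \<mu> i \<in> measures_carried_by (A i)"
  shows "locally_finite_family I \<mu>"
  unfolding locally_finite_family_def
proof (intro allI impI)
  fix K :: "'a set" assume K: "compact K"
  have "{i \<in> I. \<exists>f\<in>Cc. {x. f x \<noteq> 0} \<subseteq> K \<and> \<mu> i f \<noteq> 0} \<subseteq> {i \<in> I. A i \<inter> K \<noteq> {}}"
    using carried_by_disjoint_0[OF assms K] by (auto simp del: Un_iff)
  moreover have "finite {i \<in> I. A i \<inter> K \<noteq> {}}"
    using condenser K by (simp add: generalized_condenser_def)
  ultimately show "finite {i \<in> I. \<exists>f\<in>Cc. {x. f x \<noteq> 0} \<subseteq> K \<and> \<mu> i f \<noteq> 0}"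
    by (rule finite_subset)
qed

lemma finite_energy_vectors_carried: "\<mu> \<in> \<E> \<Longrightarrow> i \<in> I \<Longrightarrow> \<mu> i \<in> measures_carried_by (A i)"
  by (simp add: finite_energy_vectors_def vector_measures_def PiE_def Pi_def del: Un_iff)

lemma finite_energy_vectors_locally_finite: "\<mu> \<in> \<E> \<Longrightarrow> locally_finite_family I \<mu>"
  by (intro carried_locally_finite finite_energy_vectors_carried)

lemma finite_energy_vectors_finite_pos:
  assumes "\<mu> \<in> \<E>" "i \<in> I"
  shows "\<mu> i \<in> finite_pos"
proof -
  have P: "\<mu> i \<in> pos_radon_measures"
    using assms finite_energy_vectors_carried measures_carried_by_pos by blast
  have "\<bar>mutual_energy \<kappa> (\<mu> i) (\<mu> i)\<bar> \<noteq> \<infinity>"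
    using assms by (simp add: finite_energy_vectors_def vector_energy_finite_def)
  then show ?thesis
    using P by (auto simp: finite_pos_def mutual_energy_pos)
qed

text \<open>Absolute convergence discards the signs, as \<open>s i * s j\<close> has modulus 1.
  Adding back the mass terms turns the energies into values of \<open>N\<close>, so the unsigned sum
  has finite energy.\<close>

lemma radon_sum_finite_pos:
  assumes \<mu>: "\<mu> \<in> \<E>"
  shows "radon_sum I \<mu> \<in> finite_pos"
proof -
  note lf = finite_energy_vectors_locally_finite[OF \<mu>]
  have P: "\<mu> i \<in> finite_pos" "\<mu> i \<in> pos_radon_measures" if "i \<in> I" for i
    using \<mu> that by (auto intro: finite_energy_vectors_finite_pos finite_pos_pos)
  let ?e = "\<lambda>(i, j). E (\<mu> i) (\<mu> j)" and ?m = "\<lambda>(i, j). mass (\<mu> i) * mass (\<mu> j)"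
  have "(\<lambda>(i, j). \<bar>s i * s j * E (\<mu> i) (\<mu> j)\<bar>) summable_on I \<times> I"
    using \<mu> by (simp add: finite_energy_vectors_def vector_energy_finite_def)
  moreover have "(\<lambda>(i, j). \<bar>s i * s j * E (\<mu> i) (\<mu> j)\<bar>) = (\<lambda>k. norm (?e k))"
    by (auto simp: plate_sign_def)
  ultimately have "(\<lambda>k. norm (?e k)) summable_on I \<times> I"
    by simp
  then have e: "?e summable_on I \<times> I"
    by (rule summable_on_iff_abs_summable_on_real[THEN iffD2])
  have "?m summable_on I \<times> I"
    using has_sum_outer_product[OF locally_finite_family_finite[OF lf pos_radon_imp_radon[OF P(2)]], of "\<lambda>_. 1"]
    by (auto simp: summable_on_def)
  then have "(\<lambda>k. ?e k + M * ?m k) summable_on I \<times> I"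
    using e by (intro summable_on_add summable_on_cmult_right)
  also have "?this \<longleftrightarrow> (\<lambda>(i, j). n (\<mu> i) (\<mu> j)) summable_on I \<times> I"
  proof (rule summable_on_cong)
    fix k assume k: "k \<in> I \<times> I"
    obtain i j where ij: "k = (i, j)" "i \<in> I" "j \<in> I"
      using k by blast
    obtain r where "N (\<mu> i) (\<mu> j) = ereal r"
      using N_eq_n[OF P(2) P(2) finite_pos_cross[OF P(1) P(1)]] ij by blast
    then show "?e k + M * ?m k = (\<lambda>(i, j). n (\<mu> i) (\<mu> j)) k"
      using ij P by (simp add: mutual_energy_pos)
  qed
  finally have "N (radon_sum I \<mu>) (radon_sum I \<mu>) \<noteq> \<infinity>"
    using P by (intro N_sum_finite lf finite_pos_cross)
  then show ?thesis
    using radon_sum_in_pos_radon[OF lc lf P(2)] by (simp add: finite_pos_def)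
qed

text \<open>The zero vector lets results on differences specialise to a single vector, with
  \<open>R \<mu>\<close> read as \<open>R \<mu> - R 0\<close>.\<close>

lemma finite_energy_vectors_0: "(\<lambda>i\<in>I. \<lambda>_. 0) \<in> \<E>"
proof -
  have "mutual_energy \<kappa> (\<lambda>_. 0) (\<lambda>_. 0) = 0" "energy_defined \<kappa> (\<lambda>_. 0) (\<lambda>_. 0)"
    using finite_pos_finite_energy[OF finite_pos_0]
    by (simp_all add: mutual_energy_pos pos_radon_0 finite_energy_measures_def flip: zero_ereal_def)
  then have "vector_energy_finite \<kappa> Ipos Ineg (\<lambda>i\<in>I. \<lambda>_. 0)"
    unfolding vector_energy_finite_def
    by (auto intro!: summable_on_0)
  then show ?thesis
    by (auto simp: finite_energy_vectors_def vector_measures_def measures_carried_by_0)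
qed

text \<open>Exchanging the components on the negative plates absorbs the signs:
  \<open>s\<^sub>i (\<mu>\<^sup>i - \<nu>\<^sup>i) = (join \<mu> \<nu>)\<^sup>i - (join \<nu> \<mu>)\<^sup>i\<close>.\<close>

definition join ::
    "('i \<Rightarrow> ('a \<Rightarrow> real) \<Rightarrow> real) \<Rightarrow> ('i \<Rightarrow> ('a \<Rightarrow> real) \<Rightarrow> real) \<Rightarrow> 'i \<Rightarrow> ('a \<Rightarrow> real) \<Rightarrow> real" where
  "join \<mu> \<nu> i = (if i \<in> Ineg then \<nu> i else \<mu> i)"

context
  fixes \<mu> \<nu>
  assumes \<mu>: "\<mu> \<in> \<E>" and \<nu>: "\<nu> \<in> \<E>"
begin

lemma join_finite_pos: "i \<in> I \<Longrightarrow> join \<mu> \<nu> i \<in> finite_pos"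
  using \<mu> \<nu> by (auto simp: join_def intro: finite_energy_vectors_finite_pos)

lemma join_carried: "i \<in> I \<Longrightarrow> join \<mu> \<nu> i \<in> measures_carried_by (A i)"
  using \<mu> \<nu> by (auto simp: join_def intro: finite_energy_vectors_carried)

lemma join_locally_finite: "locally_finite_family I (join \<mu> \<nu>)"
  by (intro carried_locally_finite join_carried)

text \<open>Each component of the join is one of two components, hence at most their sum; domination
  by the two unsigned sums then gives finite energy.\<close>

lemma join_sum_finite_pos: "radon_sum I (join \<mu> \<nu>) \<in> finite_pos"
proof (rule finite_pos_dominated)
  show "radon_sum I (join \<mu> \<nu>) \<in> pos_radon_measures"
    by (intro radon_sum_in_pos_radon lc join_locally_finite finite_pos_pos join_finite_pos)
  show "radon_sum I \<mu> + radon_sum I \<nu> \<in> finite_pos"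
    using \<mu> \<nu> by (intro finite_pos_add radon_sum_finite_pos)
  have summable: "(\<lambda>i. \<rho> i f) summable_on I" if "locally_finite_family I \<rho>" "\<And>i. i \<in> I \<Longrightarrow> \<rho> i \<in> finite_pos" for \<rho> f
    using that by (intro finite_nonzero_values_imp_summable_on locally_finite_family_finite finite_pos_radon)
  show "radon_le (radon_sum I (join \<mu> \<nu>)) (radon_sum I \<mu> + radon_sum I \<nu>)"
    unfolding radon_le_def
  proof (intro ballI impI)
    fix f :: "'a \<Rightarrow> real" assume f: "f \<in> Cc" "\<forall>x. 0 \<le> f x"
    have sm: "(\<lambda>i. join \<mu> \<nu> i f) summable_on I" "(\<lambda>i. \<mu> i f) summable_on I" "(\<lambda>i. \<nu> i f) summable_on I"
      using \<mu> \<nu> by (auto intro!: summable join_locally_finite join_finite_pos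
          finite_energy_vectors_locally_finite intro: finite_energy_vectors_finite_pos)
    have "radon_sum I (join \<mu> \<nu>) f \<le> (\<Sum>\<^sub>\<infinity>i\<in>I. \<mu> i f + \<nu> i f)"
      unfolding radon_sum_def
    proof (rule infsum_mono)
      fix i assume i: "i \<in> I"
      have "0 \<le> \<mu> i f" "0 \<le> \<nu> i f"
        using finite_pos_pos[OF finite_energy_vectors_finite_pos[OF \<mu> i]]
          finite_pos_pos[OF finite_energy_vectors_finite_pos[OF \<nu> i]] f(2) by (auto intro: pos_radon_nonneg)
      then show "join \<mu> \<nu> i f \<le> \<mu> i f + \<nu> i f"
        by (simp add: join_def)
    qed (use sm in \<open>auto intro: summable_on_add\<close>)
    then show "radon_sum I (join \<mu> \<nu>) f \<le> (radon_sum I \<mu> + radon_sum I \<nu>) f"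
      using sm by (simp add: radon_sum_def infsum_add)
  qed
qed

end

section \<open>The distance as the energy norm of the difference of images\<close>

context
  fixes \<mu> \<nu>
  assumes \<mu>: "\<mu> \<in> \<E>" and \<nu>: "\<nu> \<in> \<E>"
begin

lemma R_diff: "R \<mu> - R \<nu> = radon_sum I (join \<mu> \<nu>) - radon_sum I (join \<nu> \<mu>)"
proof
  fix f :: "'a \<Rightarrow> real"
  have fin: "finite {i \<in> I. \<rho> i f \<noteq> 0}" if "\<rho> \<in> \<E>" for \<rho>
    by (rule locally_finite_family_finite[OF finite_energy_vectors_locally_finite[OF that]
          finite_pos_radon[OF finite_energy_vectors_finite_pos[OF that]]])
  have fin_s: "finite {i \<in> I. s i * \<rho> i f \<noteq> 0}" if "\<rho> \<in> \<E>" for \<rho>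
    by (rule finite_subset[OF _ fin[OF that]]) auto
  have fin_j: "finite {i \<in> I. join \<rho> \<rho>' i f \<noteq> 0}" if "\<rho> \<in> \<E>" "\<rho>' \<in> \<E>" for \<rho> \<rho>'
    by (rule locally_finite_family_finite[OF join_locally_finite[OF that] finite_pos_radon[OF join_finite_pos[OF that]]])
  have "R \<mu> f - R \<nu> f = (\<Sum>\<^sub>\<infinity>i\<in>I. s i * \<mu> i f - s i * \<nu> i f)"
    unfolding condenser_R_def using fin_s \<mu> \<nu>
    by (intro infsum_diff_real[symmetric] finite_nonzero_values_imp_summable_on)
  also have "\<dots> = (\<Sum>\<^sub>\<infinity>i\<in>I. join \<mu> \<nu> i f - join \<nu> \<mu> i f)"
    by (intro infsum_cong) (simp add: join_def plate_sign_def)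
  also have "\<dots> = radon_sum I (join \<mu> \<nu>) f - radon_sum I (join \<nu> \<mu>) f"
    unfolding radon_sum_def using fin_j \<mu> \<nu>
    by (intro infsum_diff_real finite_nonzero_values_imp_summable_on)
  finally show "(R \<mu> - R \<nu>) f = (radon_sum I (join \<mu> \<nu>) - radon_sum I (join \<nu> \<mu>)) f"
    by simp
qed

lemma R_diff_finite_energy: "R \<mu> - R \<nu> \<in> finite_energy_measures \<kappa>"
  unfolding R_diff using \<mu> \<nu> by (intro finite_energyI join_sum_finite_pos)

text \<open>With the signs absorbed into the joins, each term is the energy of
  \<open>?u i - ?v i\<close> against \<open>?u j - ?v j\<close>. It splits into four families of
  values of \<open>n\<close> and a mass term, each summable on its own, and the four sums reassemble
  to the energy of the difference of the two total measures.\<close>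

lemma vector_energy_has_sum:
  "((\<lambda>(i, j). s i * s j * E (\<mu> i - \<nu> i) (\<mu> j - \<nu> j)) has_sum E (R \<mu> - R \<nu>) (R \<mu> - R \<nu>)) (I \<times> I)"
proof -
  let ?u = "join \<mu> \<nu>" and ?v = "join \<nu> \<mu>"
  let ?U = "radon_sum I ?u" and ?V = "radon_sum I ?v"
  note fp = join_finite_pos[OF \<mu> \<nu>] join_finite_pos[OF \<nu> \<mu>]
  note pos = finite_pos_pos[OF fp(1)] finite_pos_pos[OF fp(2)]
  note lf = join_locally_finite[OF \<mu> \<nu>] join_locally_finite[OF \<nu> \<mu>]
  note UV = join_sum_finite_pos[OF \<mu> \<nu>] join_sum_finite_pos[OF \<nu> \<mu>]
  let ?w = "\<lambda>i. mass (?u i) - mass (?v i)"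
  have fin: "finite {i \<in> I. mass (?u i) \<noteq> 0}" "finite {i \<in> I. mass (?v i) \<noteq> 0}"
    by (rule locally_finite_family_finite[OF lf(1) pos_radon_imp_radon[OF pos(1)]]
        locally_finite_family_finite[OF lf(2) pos_radon_imp_radon[OF pos(2)]]; assumption)+
  have "finite {i \<in> I. ?w i \<noteq> 0}"
    by (rule finite_subset[OF _ finite_UnI[OF fin]]) auto
  moreover have "infsum ?w I = mass ?U - mass ?V"
    unfolding radon_sum_def using fin by (intro infsum_diff_real finite_nonzero_values_imp_summable_on)
  ultimately have w: "((\<lambda>(i, j). ?w i * ?w j) has_sum ((mass ?U - mass ?V) * (mass ?U - mass ?V))) (I \<times> I)"
    using has_sum_outer_product[of I ?w] by simp
  have uu: "((\<lambda>(i, j). n (?u i) (?u j)) has_sum n ?U ?U) (I \<times> I)"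
    and vv: "((\<lambda>(i, j). n (?v i) (?v j)) has_sum n ?V ?V) (I \<times> I)"
    and uv: "((\<lambda>(i, j). n (?u i) (?v j)) has_sum n ?U ?V) (I \<times> I)"
    and vu: "((\<lambda>(i, j). n (?v i) (?u j)) has_sum n ?V ?U) (I \<times> I)"
    by (intro n_has_sum lf pos finite_pos_cross UV; assumption)+
  have "((\<lambda>k. (\<lambda>(i, j). n (?u i) (?u j)) k + (\<lambda>(i, j). n (?v i) (?v j)) k
        + (-1) * (\<lambda>(i, j). n (?u i) (?v j)) k + (-1) * (\<lambda>(i, j). n (?v i) (?u j)) k
        + (-M) * (\<lambda>(i, j). ?w i * ?w j) k) has_sum
      (n ?U ?U + n ?V ?V + (-1) * n ?U ?V + (-1) * n ?V ?U
        + (-M) * ((mass ?U - mass ?V) * (mass ?U - mass ?V)))) (I \<times> I)"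
    by (intro has_sum_add has_sum_cmult_right uu vv uv vu w)
  also have "n ?U ?U + n ?V ?V + (-1) * n ?U ?V + (-1) * n ?V ?U + (-M) * ((mass ?U - mass ?V) * (mass ?U - mass ?V))
      = E (R \<mu> - R \<nu>) (R \<mu> - R \<nu>)"
    unfolding R_diff using UV by (simp add: E_diff algebra_simps)
  finally show ?thesis
  proof (rule has_sum_cong[THEN iffD1, rotated])
    fix k assume k: "k \<in> I \<times> I"
    obtain i j where ij: "k = (i, j)" "i \<in> I" "j \<in> I"
      using k by blast
    note P = finite_energy_vectors_finite_pos[OF \<mu> ij(2)] finite_energy_vectors_finite_pos[OF \<nu> ij(2)]
      finite_energy_vectors_finite_pos[OF \<mu> ij(3)] finite_energy_vectors_finite_pos[OF \<nu> ij(3)]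
    show "(\<lambda>(i, j). n (?u i) (?u j)) k + (\<lambda>(i, j). n (?v i) (?v j)) k
        + (-1) * (\<lambda>(i, j). n (?u i) (?v j)) k + (-1) * (\<lambda>(i, j). n (?v i) (?u j)) k
        + (-M) * (\<lambda>(i, j). ?w i * ?w j) k = (\<lambda>(i, j). s i * s j * E (\<mu> i - \<nu> i) (\<mu> j - \<nu> j)) k"
      unfolding ij(1) using P by (simp add: E_diff join_def plate_sign_def algebra_simps)
  qed
qed

lemma vector_energy_finite_diff: "vector_energy_finite \<kappa> Ipos Ineg (\<lambda>i. \<mu> i - \<nu> i)"
proof -
  have "(\<lambda>(i, j). s i * s j * E (\<mu> i - \<nu> i) (\<mu> j - \<nu> j)) summable_on I \<times> I"
    using vector_energy_has_sum by (auto simp: summable_on_def)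
  \<comment> \<open>For real families, unordered summability is already absolute.\<close>
  then have "(\<lambda>k. norm ((\<lambda>(i, j). s i * s j * E (\<mu> i - \<nu> i) (\<mu> j - \<nu> j)) k)) summable_on I \<times> I"
    by (rule summable_on_iff_abs_summable_on_real[THEN iffD1])
  also have "(\<lambda>k. norm ((\<lambda>(i, j). s i * s j * E (\<mu> i - \<nu> i) (\<mu> j - \<nu> j)) k))
      = (\<lambda>(i, j). \<bar>s i * s j * E (\<mu> i - \<nu> i) (\<mu> j - \<nu> j)\<bar>)"
    by auto
  finally show ?thesis
    unfolding vector_energy_finite_def
    by (intro conjI ballI E_diff finite_energy_vectors_finite_pos[OF \<mu>] finite_energy_vectors_finite_pos[OF \<nu>])
qed

lemma vector_dist_eq: "vector_dist \<kappa> Ipos Ineg A \<mu> \<nu> = energy_norm \<kappa> (R \<mu> - R \<nu>)"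
  using \<mu> \<nu> infsumI[OF vector_energy_has_sum]
  by (simp add: vector_dist_def vector_energy_def energy_norm_eq)

end

lemma R_finite_energy:
  assumes \<mu>: "\<mu> \<in> \<E>"
  shows "R \<mu> \<in> finite_energy_measures \<kappa>"
proof -
  have "R (\<lambda>i\<in>I. \<lambda>_. 0) = (\<lambda>_. 0)"
    unfolding condenser_R_def by (intro ext infsum_0) auto
  then show ?thesis
    using R_diff_finite_energy[OF \<mu> finite_energy_vectors_0] by (simp add: fun_diff_def)
qed

lemma energy_norm_zero: "energy_norm \<kappa> (\<lambda>_. 0) = 0"
  by (simp add: energy_norm_eq mutual_energy_pos pos_radon_0 flip: zero_ereal_def)

lemma semimetric_space_vector_dist: "semimetric_space \<E> (vector_dist \<kappa> Ipos Ineg A)"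
  unfolding semimetric_space_def
proof (intro conjI allI ballI)
  let ?d = "vector_dist \<kappa> Ipos Ineg A"
  show "0 \<le> ?d x y" for x y
  proof (cases "x \<in> \<E> \<and> y \<in> \<E>")
    case True
    then show ?thesis
      using E_self_nonneg[OF R_diff_finite_energy] by (simp add: vector_dist_eq energy_norm_eq)
  qed (auto simp: vector_dist_def)
  show "?d x y = ?d y x" for x y
  proof (cases "x \<in> \<E> \<and> y \<in> \<E>")
    case True
    have "- (R x - R y) = R y - R x"
      by (simp add: fun_eq_iff)
    then show ?thesis
      using True energy_norm_uminus[OF R_diff_finite_energy, of x y] by (simp add: vector_dist_eq)
  qed (auto simp: vector_dist_def)
  show "?d x x = 0" if "x \<in> \<E>" for x
    using that energy_norm_zero by (simp add: vector_dist_eq zero_fun_def)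
  show "?d x z \<le> ?d x y + ?d y z" if "x \<in> \<E>" "y \<in> \<E>" "z \<in> \<E>" for x y z
  proof -
    have "(R x - R y) + (R y - R z) = R x - R z"
      by (simp add: fun_eq_iff)
    then show ?thesis
      using that energy_norm_triangle[OF R_diff_finite_energy R_diff_finite_energy, of x y y z]
      by (simp add: vector_dist_eq)
  qed
qed

end

section \<open>Subadditivity of the outer measure\<close>

text \<open>The support of \<open>f \<le> 1\<close> on \<open>G \<union> H\<close> need not be contained in \<open>G \<union> H\<close>; the level sets \<open>{f \<ge> e}\<close>
  are, so \<open>(f - e)\<^sup>+\<close> can be split between \<open>G\<close> and \<open>H\<close> by an Urysohn function.\<close>

lemma lsc_integral_indicator_Un:
  fixes \<mu> :: "('a::t2_space \<Rightarrow> real) \<Rightarrow> real"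
  assumes lc: "locally_compact_space (euclidean :: 'a topology)"
    and \<mu>: "\<mu> \<in> pos_radon_measures" and G: "open G" and H: "open H"
  shows "lsc_integral (indicator (G \<union> H)) \<mu> \<le> lsc_integral (indicator G) \<mu> + lsc_integral (indicator H) \<mu>"
proof (rule lsc_integral_least_nonneg[OF _ Cc_mono_pos_radon[OF \<mu>]])
  let ?X = "lsc_integral (indicator G) \<mu> + lsc_integral (indicator H) \<mu>"
  fix f :: "'a \<Rightarrow> real"
  assume f: "f \<in> Cc" "\<And>x. 0 \<le> f x" "\<And>x. ereal (f x) \<le> indicator (G \<union> H) x"
  have f1: "f x \<le> 1" "x \<notin> G \<union> H \<Longrightarrow> f x = 0" for x
    using f(2)[of x] f(3)[of x] by (cases "x \<in> G \<union> H"; simp)+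
  obtain K where K: "continuous_on UNIV f" "compact K" "{x. f x \<noteq> 0} \<subseteq> K"
    using f(1) by (rule CcE)
  obtain h where h: "h \<in> Cc" "\<And>x. 0 \<le> h x" "\<And>x. h x \<le> 1" "\<And>x. x \<in> K \<Longrightarrow> h x = 1"
    using Cc_Urysohn_compact[OF lc K(2)] by blast
  have h_nonneg: "0 \<le> \<mu> h"
    by (rule pos_radon_nonneg[OF \<mu> h(2)])
  have approx: "ereal (\<mu> f) \<le> ?X + ereal (e * \<mu> h)" if e: "0 < e" for e
  proof -
    let ?g = "\<lambda>x. max 0 (f x - e)"
    have g: "?g \<in> Cc"
      using e f(1) by (intro Cc_comp2[where f = f and g = f and h = "\<lambda>u v. max 0 (u - e)"])
        (auto intro!: continuous_intros K(1))
    \<comment> \<open>\<open>L\<close> is the part of the level set that \<open>H\<close> misses, a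
      compact subset of \<open>G\<close>. A function \<open>p\<close> in \<open>G\<close> with
      \<open>p = 1\<close> on \<open>L\<close> leaves a remainder that vanishes off
      \<open>H\<close>.\<close>
    define L where "L = {x. e \<le> f x} \<inter> - H"
    have "closed {x. e \<le> f x}"
      using K(1) by (intro closed_Collect_le continuous_intros)
    then have "closed L"
      using H by (auto simp: L_def)
    moreover have "L \<subseteq> K"
      using e K(3) by (force simp: L_def)
    ultimately have L: "compact L"
      using K(2) by (metis compact_Int_closed inf.absorb_iff2)
    have "L \<subseteq> G"
      using f1(2) e by (force simp: L_def)
    then obtain p where p: "p \<in> Cc" "\<And>x. 0 \<le> p x" "\<And>x. p x \<le> 1" "\<And>x. x \<in> L \<Longrightarrow> p x = 1" "{x. p x \<noteq> 0} \<subseteq> G"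
      using Cc_Urysohn[OF lc L G] by metis
    let ?g1 = "\<lambda>x. p x * ?g x" and ?g2 = "\<lambda>x. (1 - p x) * ?g x"
    have c: "?g1 \<in> Cc" "?g2 \<in> Cc"
      using g p(1) by (auto intro!: Cc_mult_left continuous_intros dest: Cc_continuous)
    have g01: "0 \<le> ?g x" "?g x \<le> 1" for x
      using f1(1)[of x] e by auto
    have "ereal (?g1 x) \<le> indicator G x" for x
    proof (cases "x \<in> G")
      case True
      then show ?thesis
        using mult_le_one[OF p(3) g01] by simp
    next
      case False
      then have "p x = 0"
        using p(5) by auto
      then show ?thesis
        by (simp flip: zero_ereal_def)
    qed
    then have 1: "ereal (\<mu> ?g1) \<le> lsc_integral (indicator G) \<mu>"
      by (rule lsc_integral_upper[OF c(1)])
    have "ereal (?g2 x) \<le> indicator H x" for x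
    proof (cases "x \<in> H")
      case True
      then show ?thesis
        using mult_le_one[of "1 - p x" "?g x"] p(2)[of x] p(3)[of x] g01[of x] by simp
    next
      case False
      then have "p x = 1 \<or> ?g x = 0"
        using p(4)[of x] by (auto simp: L_def)
      then have "?g2 x = 0"
        by auto
      then show ?thesis
        by (simp only: flip: zero_ereal_def) simp
    qed
    then have 2: "ereal (\<mu> ?g2) \<le> lsc_integral (indicator H) \<mu>"
      by (rule lsc_integral_upper[OF c(2)])
    have "\<mu> ?g = \<mu> ?g1 + \<mu> ?g2"
      using radon_add[OF pos_radon_imp_radon[OF \<mu>] c] by (simp add: algebra_simps)
    then have 3: "ereal (\<mu> ?g) \<le> ?X"
      using add_mono[OF 1 2] by simp
    \<comment> \<open>Truncation costs at most \<open>e\<close> on \<open>K\<close>, where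
      \<open>h = 1\<close>, and nothing elsewhere.\<close>
    have "\<mu> f \<le> \<mu> (\<lambda>x. ?g x + e * h x)"
    proof (rule pos_radon_mono[OF \<mu> f(1)])
      show "(\<lambda>x. ?g x + e * h x) \<in> Cc"
        using g h(1) by (intro Cc_add Cc_cmult)
      show "f x \<le> ?g x + e * h x" for x
      proof (cases "x \<in> K")
        case False
        then have "f x = 0"
          using K(3) by auto
        then show ?thesis
          using e h(2)[of x] by simp
      qed (simp add: h(4))
    qed
    also have "\<dots> = \<mu> ?g + e * \<mu> h"
      using radon_add[OF pos_radon_imp_radon[OF \<mu>] g Cc_cmult[OF h(1)]]
        radon_cmult[OF pos_radon_imp_radon[OF \<mu>] h(1)] by simp
    finally have "ereal (\<mu> f) \<le> ereal (\<mu> ?g) + ereal (e * \<mu> h)"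
      by simp
    also have "\<dots> \<le> ?X + ereal (e * \<mu> h)"
      by (intro add_right_mono 3)
    finally show ?thesis .
  qed
  have "0 \<le> ?X"
    by (intro add_nonneg_nonneg lsc_integral_nonneg Cc_mono_pos_radon \<mu>) (auto simp: indicator_def)
  then show "ereal (\<mu> f) \<le> ?X"
  proof (cases "?X")
    case (real x)
    have "\<mu> f \<le> x + d" if d: "0 < d" for d
    proof -
      have "\<mu> f \<le> x + d / (\<mu> h + 1) * \<mu> h"
        using approx[of "d / (\<mu> h + 1)"] d h_nonneg real by simp
      also have "d / (\<mu> h + 1) * \<mu> h \<le> d"
        using d h_nonneg by (simp add: field_simps)
      finally show ?thesis
        by simp
    qed
    then show ?thesis
      using real by (simp add: field_le_epsilon)
  qed auto
qed (simp add: indicator_def)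

lemma radon_outer_Un:
  fixes \<mu> :: "('a::t2_space \<Rightarrow> real) \<Rightarrow> real"
  assumes lc: "locally_compact_space (euclidean :: 'a topology)" and \<mu>: "\<mu> \<in> pos_radon_measures"
  shows "radon_outer \<mu> (Q \<union> R) \<le> radon_outer \<mu> Q + radon_outer \<mu> R"
proof -
  let ?l = "\<lambda>G. lsc_integral (indicator G) \<mu>"
  let ?Q = "{G. open G \<and> Q \<subseteq> G}" and ?R = "{G. open G \<and> R \<subseteq> G}"
  have ne: "?Q \<noteq> {}" "?R \<noteq> {}"
    by auto
  have l: "0 \<le> ?l G" for G
    by (intro lsc_integral_nonneg Cc_mono_pos_radon \<mu>) (auto simp: indicator_def)
  have le: "radon_outer \<mu> (Q \<union> R) \<le> ?l G + ?l H" if "G \<in> ?Q" "H \<in> ?R" for G H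
  proof -
    have "radon_outer \<mu> (Q \<union> R) \<le> ?l (G \<union> H)"
      unfolding radon_outer_def using that by (intro INF_lower) auto
    also have "\<dots> \<le> ?l G + ?l H"
      using that by (intro lsc_integral_indicator_Un lc \<mu>) auto
    finally show ?thesis .
  qed
  have "radon_outer \<mu> (Q \<union> R) \<le> (INF G\<in>?Q. (INF H\<in>?R. ?l G + ?l H))"
    using le by (intro INF_greatest)
  also have "\<dots> = (INF G\<in>?Q. ?l G + radon_outer \<mu> R)"
    unfolding radon_outer_def using l by (intro INF_cong refl INF_ereal_add_right ne) auto
  also have "\<dots> = radon_outer \<mu> Q + radon_outer \<mu> R"
    unfolding radon_outer_def[of \<mu> Q] using l radon_outer_nonneg[OF \<mu>, of R]
    by (intro INF_ereal_add_left ne) auto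
  finally show ?thesis .
qed

lemma radon_outer_cmult:
  assumes c: "0 < c"
  shows "radon_outer (\<lambda>f. c * \<mu> f) Q = ereal c * radon_outer \<mu> Q"
proof -
  have le: "ereal c * radon_outer \<mu> Q \<le> radon_outer (\<lambda>f. c * \<mu> f) Q" if c: "0 < c" for c and \<mu> :: "('a \<Rightarrow> real) \<Rightarrow> real"
    unfolding radon_outer_def[of "\<lambda>f. c * \<mu> f"]
  proof (rule INF_greatest)
    fix G assume G: "G \<in> {G. open G \<and> Q \<subseteq> G}"
    have "radon_outer \<mu> Q \<le> lsc_integral (indicator G) \<mu>"
      unfolding radon_outer_def using G by (rule INF_lower)
    then have "ereal c * radon_outer \<mu> Q \<le> ereal c * lsc_integral (indicator G) \<mu>"
      using c by (intro ereal_mult_left_mono) auto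
    also have "\<dots> = lsc_integral (indicator G) (\<lambda>f. c * \<mu> f)"
      using c by (intro lsc_integral_cmult[symmetric]) (auto simp: indicator_def)
    finally show "ereal c * radon_outer \<mu> Q \<le> lsc_integral (indicator G) (\<lambda>f. c * \<mu> f)" .
  qed
  have "ereal (1 / c) * radon_outer (\<lambda>f. c * \<mu> f) Q \<le> radon_outer (\<lambda>f. (1 / c) * (c * \<mu> f)) Q"
    using c by (intro le) simp
  also have "(\<lambda>f. (1 / c) * (c * \<mu> f)) = \<mu>"
    using c by auto
  finally have "ereal c * (ereal (1 / c) * radon_outer (\<lambda>f. c * \<mu> f) Q) \<le> ereal c * radon_outer \<mu> Q"
    using c by (intro ereal_mult_left_mono) auto
  then have "radon_outer (\<lambda>f. c * \<mu> f) Q \<le> ereal c * radon_outer \<mu> Q"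
    using c by (simp flip: mult.assoc)
  then show ?thesis
    using le[OF c] by (intro order.antisym)
qed

lemma measures_carried_by_Int:
  fixes \<mu> :: "('a::t2_space \<Rightarrow> real) \<Rightarrow> real"
  assumes lc: "locally_compact_space (euclidean :: 'a topology)"
    and Q: "\<mu> \<in> measures_carried_by Q" and R: "\<mu> \<in> measures_carried_by R"
  shows "\<mu> \<in> measures_carried_by (Q \<inter> R)"
proof -
  have \<mu>: "\<mu> \<in> pos_radon_measures"
    using Q by (rule measures_carried_by_pos)
  have "radon_outer \<mu> (- (Q \<inter> R) \<inter> K) = 0" if K: "compact K" for K
  proof -
    have "radon_outer \<mu> (- Q \<inter> K) = 0" "radon_outer \<mu> (- R \<inter> K) = 0"
      using Q R K by (auto simp: measures_carried_by_def locally_negligible_def)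
    moreover have "- (Q \<inter> R) \<inter> K = (- Q \<inter> K) \<union> (- R \<inter> K)"
      by auto
    ultimately show ?thesis
      using radon_outer_Un[OF lc \<mu>, of "- Q \<inter> K" "- R \<inter> K"] radon_outer_nonneg[OF \<mu>, of "- (Q \<inter> R) \<inter> K"]
      by simp
  qed
  then show ?thesis
    using \<mu> by (simp add: measures_carried_by_def locally_negligible_def)
qed

lemma measures_carried_by_cmult:
  assumes "\<mu> \<in> measures_carried_by Q" "0 < c"
  shows "(\<lambda>f. c * \<mu> f) \<in> measures_carried_by Q"
  using assms by (simp add: measures_carried_by_def locally_negligible_def pos_radon_cmult radon_outer_cmult)

section \<open>Multiplication of a measure by a function\<close>

text \<open>The measure with density \<open>p\<close>. For a cutoff \<open>p\<close> its total mass
  is the finite number \<open>\<mu> p\<close>, whereas \<open>\<mu>\<close> itself may have infinite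
  mass.\<close>

definition radon_mult :: "('a::t2_space \<Rightarrow> real) \<Rightarrow> (('a \<Rightarrow> real) \<Rightarrow> real) \<Rightarrow> ('a \<Rightarrow> real) \<Rightarrow> real" where
  "radon_mult p \<mu> f = (if f \<in> Cc then \<mu> (\<lambda>x. p x * f x) else 0)"

context
  fixes p :: "'a::t2_space \<Rightarrow> real" and \<mu> :: "('a \<Rightarrow> real) \<Rightarrow> real"
  assumes lc: "locally_compact_space (euclidean :: 'a topology)"
    and p: "p \<in> Cc" "\<And>x. 0 \<le> p x" "\<And>x. p x \<le> 1"
    and \<mu>: "\<mu> \<in> pos_radon_measures"
begin

lemma Cc_mult_p: "f \<in> Cc \<Longrightarrow> (\<lambda>x. p x * f x) \<in> Cc"
  using p(1) by (intro Cc_mult_left Cc_continuous)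

lemma radon_mult_in_pos_radon: "radon_mult p \<mu> \<in> pos_radon_measures"
proof (rule pos_radonI[OF lc])
  fix f g :: "'a \<Rightarrow> real" assume "f \<in> Cc" "g \<in> Cc"
  then show "radon_mult p \<mu> (\<lambda>x. f x + g x) = radon_mult p \<mu> f + radon_mult p \<mu> g"
    using radon_add[OF pos_radon_imp_radon[OF \<mu>] Cc_mult_p Cc_mult_p, of f g]
    by (simp add: radon_mult_def Cc_add distrib_left)
next
  fix f :: "'a \<Rightarrow> real" and c assume "f \<in> Cc"
  then show "radon_mult p \<mu> (\<lambda>x. c * f x) = c * radon_mult p \<mu> f"
    using radon_cmult[OF pos_radon_imp_radon[OF \<mu>] Cc_mult_p, of f c]
    by (simp add: radon_mult_def Cc_cmult mult.left_commute)
next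
  fix f :: "'a \<Rightarrow> real" assume "f \<in> Cc" "\<And>x. 0 \<le> f x"
  then show "0 \<le> radon_mult p \<mu> f"
    using p(2) pos_radon_nonneg[OF \<mu>, of "\<lambda>x. p x * f x"] by (simp add: radon_mult_def)
qed (simp add: radon_mult_def)

lemma radon_mult_le: "radon_le (radon_mult p \<mu>) \<mu>"
  unfolding radon_le_def
proof (intro ballI impI)
  fix f :: "'a \<Rightarrow> real" assume f: "f \<in> Cc" "\<forall>x. 0 \<le> f x"
  have "\<mu> (\<lambda>x. p x * f x) \<le> \<mu> f"
    using f p by (intro pos_radon_mono[OF \<mu>] Cc_mult_p) (auto intro: mult_left_le_one_le)
  then show "radon_mult p \<mu> f \<le> \<mu> f"
    using f by (simp add: radon_mult_def)
qed

end

text \<open>The normalisation in the capacity concerns the mass of \<open>Q\<close>, so the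
  complement must be shown to be null. Outside \<open>Q\<close> one is either in the compact
  \<open>K\<close>, where being carried by \<open>Q\<close> gives measure 0, or in the open set
  \<open>- K\<close>, where the density vanishes.\<close>

lemma radon_mult_outer:
  fixes p :: "'a::t2_space \<Rightarrow> real" and \<mu> :: "('a \<Rightarrow> real) \<Rightarrow> real"
  assumes lc: "locally_compact_space (euclidean :: 'a topology)"
    and p: "p \<in> Cc" "\<And>x. 0 \<le> p x" "\<And>x. p x \<le> 1"
    and \<mu>: "\<mu> \<in> measures_carried_by Q"
  shows "radon_outer (radon_mult p \<mu>) Q = ereal (\<mu> p)"
proof -
  let ?\<rho> = "radon_mult p \<mu>"
  note \<mu>P = measures_carried_by_pos[OF \<mu>]
  have \<rho>P: "?\<rho> \<in> pos_radon_measures" and \<rho>le: "radon_le ?\<rho> \<mu>"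
    using radon_mult_in_pos_radon[OF lc p \<mu>P] radon_mult_le[OF lc p \<mu>P] by auto
  have \<rho>: "?\<rho> \<in> measures_carried_by Q"
    using measures_carried_by_dominated[OF \<mu> \<rho>P \<rho>le] .
  obtain K where K: "continuous_on UNIV p" "compact K" "{x. p x \<noteq> 0} \<subseteq> K"
    using p(1) by (rule CcE)
  obtain h where h: "h \<in> Cc" "\<And>x. 0 \<le> h x" "\<And>x. h x \<le> 1" "\<And>x. x \<in> K \<Longrightarrow> h x = 1"
    using Cc_Urysohn_compact[OF lc K(2)] by blast
  have "p x * h x = p x" for x
    using h(4)[of x] K(3) by (cases "x \<in> K") auto
  then have "(\<lambda>x. p x * h x) = p"
    by (rule ext)
  then have \<rho>h: "?\<rho> h = \<mu> p"
    using h(1) by (simp add: radon_mult_def)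
  have total: "radon_outer ?\<rho> UNIV = ereal (\<mu> p)"
  proof (rule order.antisym)
    have "lsc_integral (indicator UNIV) ?\<rho> \<le> ereal (\<mu> p)"
    proof (rule lsc_integral_least)
      fix f :: "'a \<Rightarrow> real" assume f: "f \<in> Cc" "\<And>x. ereal (f x) \<le> indicator UNIV x"
      have "p x * f x \<le> p x * 1" for x
        using f(2)[of x] p(2) by (intro mult_left_mono) auto
      then have "\<mu> (\<lambda>x. p x * f x) \<le> \<mu> p"
        using f(1) p(1) K(1) by (intro pos_radon_mono[OF \<mu>P] Cc_mult_left) auto
      then show "ereal (?\<rho> f) \<le> ereal (\<mu> p)"
        using f(1) by (simp add: radon_mult_def)
    qed
    then show "radon_outer ?\<rho> UNIV \<le> ereal (\<mu> p)"
      using radon_outer_open[OF \<rho>P open_UNIV] by simp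
    have "ereal (?\<rho> h) \<le> lsc_integral (indicator UNIV) ?\<rho>"
      using h by (intro lsc_integral_upper) auto
    then show "ereal (\<mu> p) \<le> radon_outer ?\<rho> UNIV"
      using radon_outer_open[OF \<rho>P open_UNIV] \<rho>h by simp
  qed
  have "open (- K)"
    using K(2) by (simp add: compact_imp_closed open_Compl)
  moreover have "lsc_integral (indicator (- K)) ?\<rho> \<le> 0"
  proof (rule lsc_integral_least_nonneg[OF _ Cc_mono_pos_radon[OF \<rho>P]])
    fix f :: "'a \<Rightarrow> real" assume f: "f \<in> Cc" "\<And>x. 0 \<le> f x" "\<And>x. ereal (f x) \<le> indicator (- K) x"
    have "p x * f x = 0" for x
      using f(2)[of x] f(3)[of x] K(3) by (cases "x \<in> K") auto
    then have "(\<lambda>x. p x * f x) = (\<lambda>_. 0)"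
      by (rule ext)
    then show "ereal (?\<rho> f) \<le> 0"
      using f(1) \<mu>P by (simp add: radon_mult_def pos_radon_imp_radon)
  qed (simp add: indicator_def)
  ultimately have "radon_outer ?\<rho> (- K) \<le> 0"
    using radon_outer_open[OF \<rho>P] by simp
  moreover have "radon_outer ?\<rho> (- Q \<inter> K) = 0"
    using \<rho> K(2) by (simp add: measures_carried_by_def locally_negligible_def)
  ultimately have "radon_outer ?\<rho> ((- Q \<inter> K) \<union> - K) \<le> 0"
    using radon_outer_Un[OF lc \<rho>P, of "- Q \<inter> K" "- K"] by simp
  moreover have "radon_outer ?\<rho> (- Q) \<le> radon_outer ?\<rho> ((- Q \<inter> K) \<union> - K)"
    by (intro radon_outer_mono \<rho>P) auto
  ultimately have "radon_outer ?\<rho> (- Q) \<le> 0"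
    by simp
  then have "radon_outer ?\<rho> Q + radon_outer ?\<rho> (- Q) \<le> radon_outer ?\<rho> Q + 0"
    by (rule add_left_mono)
  then have "radon_outer ?\<rho> UNIV \<le> radon_outer ?\<rho> Q"
    using radon_outer_Un[OF lc \<rho>P, of Q "- Q"] by (simp add: Compl_partition)
  moreover have "radon_outer ?\<rho> Q \<le> radon_outer ?\<rho> UNIV"
    by (intro radon_outer_mono \<rho>P) auto
  ultimately show ?thesis
    using total by simp
qed

section \<open>Disjoint measures\<close>

text \<open>Lattice disjointness, phrased through common minorants so that it passes to smaller
  measures without naming an infimum.\<close>

definition radon_disjoint :: "(('a::t2_space \<Rightarrow> real) \<Rightarrow> real) \<Rightarrow> (('a \<Rightarrow> real) \<Rightarrow> real) \<Rightarrow> bool" where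
  "radon_disjoint \<mu> \<nu> \<longleftrightarrow>
     (\<forall>\<tau>\<in>pos_radon_measures. radon_le \<tau> \<mu> \<longrightarrow> radon_le \<tau> \<nu> \<longrightarrow> \<tau> = (\<lambda>_. 0))"

lemma radon_disjoint_le: "radon_disjoint \<mu> \<nu> \<Longrightarrow> radon_le \<mu>' \<mu> \<Longrightarrow> radon_disjoint \<mu>' \<nu>"
  unfolding radon_disjoint_def by (metis radon_le_trans)

text \<open>The part of \<open>\<mu>\<close> below \<open>\<nu>\<close> in the Riesz decomposition
  is a common minorant, hence zero.\<close>

lemma radon_disjoint_cancel:
  fixes \<mu> \<nu> \<rho> :: "('a::t2_space \<Rightarrow> real) \<Rightarrow> real"
  assumes lc: "locally_compact_space (euclidean :: 'a topology)"
    and P: "\<mu> \<in> pos_radon_measures" "\<nu> \<in> pos_radon_measures" "\<rho> \<in> pos_radon_measures"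
    and le: "radon_le \<mu> (\<nu> + \<rho>)" and disj: "radon_disjoint \<mu> \<nu>"
  shows "radon_le \<mu> \<rho>"
proof -
  obtain \<mu>1 \<mu>2 where *: "\<mu>1 \<in> pos_radon_measures" "\<mu>2 \<in> pos_radon_measures" "\<mu> = \<mu>1 + \<mu>2"
    "radon_le \<mu>1 \<nu>" "radon_le \<mu>2 \<rho>"
    using radon_Riesz_decomposition[OF lc P le] .
  then have "\<mu>1 = (\<lambda>_. 0)"
    using disj radon_le_add(1)[of \<mu>2 \<mu>1] by (simp add: radon_disjoint_def)
  then show ?thesis
    using * by (simp add: radon_le_def)
qed

lemma radon_disjoint_cancel_sum:
  fixes \<mu> \<rho> :: "('a::t2_space \<Rightarrow> real) \<Rightarrow> real" and \<nu> :: "'i \<Rightarrow> ('a \<Rightarrow> real) \<Rightarrow> real"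
  assumes lc: "locally_compact_space (euclidean :: 'a topology)"
    and "finite J" and \<mu>: "\<mu> \<in> pos_radon_measures"
    and "\<And>j. j \<in> J \<Longrightarrow> \<nu> j \<in> pos_radon_measures" "\<And>j. j \<in> J \<Longrightarrow> radon_disjoint \<mu> (\<nu> j)"
    and "\<rho> \<in> pos_radon_measures" "radon_le \<mu> (\<lambda>f. (\<Sum>j\<in>J. \<nu> j f) + \<rho> f)"
  shows "radon_le \<mu> \<rho>"
  using assms(2,4-)
\<comment> \<open>The measure \<open>\<rho>\<close> varies because each step absorbs one
  \<open>\<nu> j\<close> into it.\<close>
proof (induction J arbitrary: \<rho>)
  case (insert j J)
  have "radon_le \<mu> (\<nu> j + \<rho>)"
  proof (rule insert.IH)
    show "\<nu> j + \<rho> \<in> pos_radon_measures"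
      using insert.prems by (intro pos_radon_add) auto
    have "(\<lambda>f. (\<Sum>j\<in>J. \<nu> j f) + (\<nu> j + \<rho>) f) = (\<lambda>f. (\<Sum>j\<in>insert j J. \<nu> j f) + \<rho> f)"
      using insert.hyps by (auto simp: algebra_simps)
    then show "radon_le \<mu> (\<lambda>f. (\<Sum>j\<in>J. \<nu> j f) + (\<nu> j + \<rho>) f)"
      using insert.prems(4) by simp
  qed (use insert.prems(1,2) in simp_all)
  then show ?case
    by (rule radon_disjoint_cancel[OF lc \<mu> insert.prems(1)[OF insertI1] insert.prems(3) _
          insert.prems(2)[OF insertI1]])
qed simp

text \<open>Multiplication by a cutoff function reduces the locally finite sums to finite ones.\<close>

lemma radon_sum_eq_imp_le:
  fixes \<mu> \<nu> :: "'i \<Rightarrow> ('a::t2_space \<Rightarrow> real) \<Rightarrow> real"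
  assumes lc: "locally_compact_space (euclidean :: 'a topology)"
    and lf: "locally_finite_family I \<mu>" "locally_finite_family I \<nu>"
    and \<mu>: "\<And>i. i \<in> I \<Longrightarrow> \<mu> i \<in> pos_radon_measures" and \<nu>: "\<And>i. i \<in> I \<Longrightarrow> \<nu> i \<in> pos_radon_measures"
    and eq: "radon_sum I \<mu> = radon_sum I \<nu>"
    and disj: "\<And>j. j \<in> I \<Longrightarrow> j \<noteq> i \<Longrightarrow> radon_disjoint (\<mu> i) (\<nu> j)" and i: "i \<in> I"
  shows "radon_le (\<mu> i) (\<nu> i)"
  unfolding radon_le_def
proof (intro ballI impI)
  fix f :: "'a \<Rightarrow> real" assume f: "f \<in> Cc" "\<forall>x. 0 \<le> f x"
  obtain K where K: "compact K" "{x. f x \<noteq> 0} \<subseteq> K"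
    using f(1) by (rule CcE)
  obtain p where p: "p \<in> Cc" "\<And>x. 0 \<le> p x" "\<And>x. p x \<le> 1" "\<And>x. x \<in> K \<Longrightarrow> p x = 1"
    using Cc_Urysohn_compact[OF lc K(1)] by blast
  \<comment> \<open>Products with \<open>p\<close> vanish off \<open>L\<close> whatever the other
    factor, so one finite \<open>J\<close> serves all test functions; and \<open>p = 1\<close> where
    \<open>f\<close> is nonzero, so the cutoff does not change the value at
    \<open>f\<close>.\<close>
  obtain L where L: "compact L" "{x. p x \<noteq> 0} \<subseteq> L"
    using p(1) by (rule CcE)
  obtain J where J: "finite J" "J \<subseteq> I"
    "\<And>g. g \<in> Cc \<Longrightarrow> {x. g x \<noteq> 0} \<subseteq> L \<Longrightarrow> radon_sum I \<nu> g = (\<Sum>j\<in>J. \<nu> j g)"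
    using locally_finite_familyE[OF lf(2) L(1)] by metis
  let ?\<mu> = "radon_mult p (\<mu> i)"
  have "radon_le ?\<mu> (\<nu> i)"
  proof (rule radon_disjoint_cancel_sum[OF lc, where J = "J - {i}" and \<nu> = \<nu>])
    show "?\<mu> \<in> pos_radon_measures"
      by (rule radon_mult_in_pos_radon[OF lc p(1-3) \<mu>[OF i]])
    show "radon_disjoint ?\<mu> (\<nu> j)" if "j \<in> J - {i}" for j
      using that J(2) by (intro radon_disjoint_le[OF disj radon_mult_le[OF lc p(1-3) \<mu>[OF i]]]) auto
    show "radon_le ?\<mu> (\<lambda>g. (\<Sum>j\<in>J - {i}. \<nu> j g) + \<nu> i g)"
      unfolding radon_le_def
    proof (intro ballI impI)
      fix g :: "'a \<Rightarrow> real" assume g: "g \<in> Cc" "\<forall>x. 0 \<le> g x"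
      let ?g = "\<lambda>x. p x * g x"
      have c: "?g \<in> Cc" "{x. ?g x \<noteq> 0} \<subseteq> L"
        using g(1) p(1) L(2) by (auto intro!: Cc_mult_left Cc_continuous)
      have nonneg: "0 \<le> \<mu> k ?g" "0 \<le> \<nu> k ?g" "0 \<le> \<nu> k g" "\<nu> k ?g \<le> \<nu> k g" if "k \<in> I" for k
        using g p(2,3) by (auto intro!: pos_radon_nonneg[OF \<mu>[OF that]] pos_radon_nonneg[OF \<nu>[OF that]]
            pos_radon_mono[OF \<nu>[OF that]] c(1) mult_left_le_one_le)
      have "?\<mu> g = sum (\<lambda>i. \<mu> i ?g) {i}"
        using g(1) by (simp add: radon_mult_def)
      also have "\<dots> \<le> radon_sum I \<mu> ?g"
        unfolding radon_sum_def using i nonneg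
        by (intro finite_sum_le_infsum finite_nonzero_values_imp_summable_on
            locally_finite_family_finite[OF lf(1) pos_radon_imp_radon[OF \<mu>]]) auto
      also have "\<dots> = (\<Sum>j\<in>J. \<nu> j ?g)"
        unfolding eq by (rule J(3)[OF c])
      also have "\<dots> \<le> (\<Sum>j\<in>J. \<nu> j g)"
        using J(2) nonneg by (intro sum_mono) auto
      \<comment> \<open>The index \<open>i\<close> may be missing from \<open>J\<close>; inserting
        it adds a nonnegative term.\<close>
      also have "\<dots> \<le> (\<Sum>j\<in>insert i J. \<nu> j g)"
        using J(1) i nonneg by (intro sum_mono2) auto
      also have "\<dots> = (\<Sum>j\<in>J - {i}. \<nu> j g) + \<nu> i g"
        using J(1) by (simp add: sum.insert_remove)
      finally show "?\<mu> g \<le> (\<Sum>j\<in>J - {i}. \<nu> j g) + \<nu> i g" .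
    qed
  qed (use J i \<nu> in auto)
  then have "?\<mu> f \<le> \<nu> i f"
    using f by (simp add: radon_leD)
  moreover have "p x * f x = f x" for x
    using p(4)[of x] K(2) by (cases "x \<in> K") auto
  ultimately show "\<mu> i f \<le> \<nu> i f"
    using f(1) by (simp add: radon_mult_def)
qed

section \<open>Sets of inner capacity zero\<close>

context shifted_kernel
begin

text \<open>The inverse in \<open>ereal\<close> vanishes only at \<open>\<infinity>\<close> and
  \<open>- \<infinity>\<close>. Over a nonempty set the infimum is finite, being nonnegative and
  below a finite energy; the value 0 inverts to \<open>\<infinity>\<close>.\<close>

lemma inner_capacity_eq_0_iff:
  "inner_capacity \<kappa> Q = 0 \<longleftrightarrow>
     {\<nu> \<in> finite_energy_measures \<kappa> \<inter> measures_carried_by Q. radon_outer \<nu> Q = 1} = {}"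
  (is "_ \<longleftrightarrow> ?S = {}")
proof
  assume 0: "inner_capacity \<kappa> Q = 0"
  show "?S = {}"
  proof (rule ccontr)
    assume "?S \<noteq> {}"
    then obtain \<nu> where \<nu>: "\<nu> \<in> ?S"
      by blast
    let ?i = "INF \<nu>\<in>?S. mutual_energy \<kappa> \<nu> \<nu>"
    have "?i \<le> mutual_energy \<kappa> \<nu> \<nu>"
      using \<nu> by (rule INF_lower)
    moreover have "mutual_energy \<kappa> \<nu> \<nu> \<noteq> \<infinity>"
      using \<nu> by (auto simp: finite_energy_measures_def)
    moreover have "0 \<le> ?i"
      using pd by (intro INF_greatest) (auto simp: finite_energy_measures_def positive_definite_def)
    ultimately obtain r where "?i = ereal r"
      by (cases ?i) auto
    then show False
      using 0 by (auto simp: inner_capacity_def split: if_splits)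
  qed
next
  assume "?S = {}"
  then show "inner_capacity \<kappa> Q = 0"
    by (simp only: inner_capacity_def image_empty Inf_empty top_ereal_def) simp
qed

text \<open>A nonzero measure may have infinite mass and admit no normalisation. A cutoff leaves a
  nonzero measure of finite mass on the same carrier, and domination preserves finite energy;
  rescaled, it competes in the capacity.\<close>

lemma finite_pos_carried_by_capacity_0:
  assumes \<tau>: "\<tau> \<in> finite_pos" "\<tau> \<in> measures_carried_by Q" and Q: "inner_capacity \<kappa> Q = 0"
  shows "\<tau> = (\<lambda>_. 0)"
proof (rule ccontr)
  assume ne: "\<tau> \<noteq> (\<lambda>_. 0)"
  note P = finite_pos_pos[OF \<tau>(1)]
  obtain f where f: "f \<in> Cc" "\<And>x. 0 \<le> f x" "\<tau> f \<noteq> 0"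
    using radon_eqI[OF pos_radon_imp_radon[OF P] radon_measures_0] ne by blast
  obtain B where B: "0 \<le> B" "\<And>x. \<bar>f x\<bar> \<le> B"
    using Cc_bounded[OF f(1)] by metis
  define p where "p = (\<lambda>x. 1 / (B + 1) * f x)"
  have p: "p \<in> Cc" "\<And>x. 0 \<le> p x" "\<And>x. p x \<le> 1"
  proof -
    show "p \<in> Cc"
      unfolding p_def using f(1) by (rule Cc_cmult)
    show "0 \<le> p x" "p x \<le> 1" for x
      using B(1) B(2)[of x] f(2)[of x] by (auto simp: p_def field_simps)
  qed
  have "0 \<le> \<tau> f"
    by (rule pos_radon_nonneg[OF P f(2)])
  moreover have "\<tau> p = 1 / (B + 1) * \<tau> f"
    unfolding p_def by (rule radon_cmult[OF pos_radon_imp_radon[OF P] f(1)])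
  ultimately have m: "0 < \<tau> p"
    using B(1) f(3) by simp
  let ?\<rho> = "radon_mult p \<tau>" and ?c = "1 / \<tau> p"
  let ?\<nu> = "\<lambda>f. ?c * ?\<rho> f"
  have \<rho>: "?\<rho> \<in> pos_radon_measures" "radon_le ?\<rho> \<tau>"
    using radon_mult_in_pos_radon[OF lc p P] radon_mult_le[OF lc p P] by auto
  have "?\<nu> \<in> finite_energy_measures \<kappa>"
    using m \<rho> \<tau>(1) by (intro finite_pos_finite_energy finite_pos_cmult) (auto intro: finite_pos_dominated)
  moreover have "?\<nu> \<in> measures_carried_by Q"
    using m measures_carried_by_dominated[OF \<tau>(2) \<rho>] by (intro measures_carried_by_cmult) auto
  moreover have "radon_outer ?\<nu> Q = 1"
  proof -
    have "radon_outer ?\<nu> Q = ereal ?c * radon_outer ?\<rho> Q"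
      using m by (intro radon_outer_cmult) simp
    also have "radon_outer ?\<rho> Q = ereal (\<tau> p)"
      by (rule radon_mult_outer[OF lc p \<tau>(2)])
    also have "ereal ?c * ereal (\<tau> p) = 1"
      using m by (simp flip: one_ereal_def)
    finally show ?thesis .
  qed
  ultimately show False
    using Q unfolding inner_capacity_eq_0_iff by blast
qed

end

section \<open>The metric criterion\<close>

context condenser
begin

section \<open>Injectivity of \<open>R\<close> when the intersections have capacity zero\<close>

lemma join_disjoint:
  assumes \<mu>: "\<mu> \<in> \<E>" and \<nu>: "\<nu> \<in> \<E>" and ij: "i \<in> I" "j \<in> I" "inner_capacity \<kappa> (A i \<inter> A j) = 0"
  shows "radon_disjoint (join \<mu> \<nu> i) (join \<nu> \<mu> j)"
  unfolding radon_disjoint_def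
proof (intro ballI impI)
  fix \<tau> assume \<tau>: "\<tau> \<in> pos_radon_measures" "radon_le \<tau> (join \<mu> \<nu> i)" "radon_le \<tau> (join \<nu> \<mu> j)"
  have "\<tau> \<in> finite_pos"
    by (rule finite_pos_dominated[OF \<tau>(1) join_finite_pos[OF \<mu> \<nu> ij(1)] \<tau>(2)])
  moreover have "\<tau> \<in> measures_carried_by (A i \<inter> A j)"
    by (intro measures_carried_by_Int lc
        measures_carried_by_dominated[OF join_carried[OF \<mu> \<nu> ij(1)] \<tau>(1,2)]
        measures_carried_by_dominated[OF join_carried[OF \<nu> \<mu> ij(2)] \<tau>(1,3)])
  ultimately show "\<tau> = (\<lambda>_. 0)"
    using ij(3) by (rule finite_pos_carried_by_capacity_0)
qed

lemma R_inj:
  assumes cap: "\<And>i j. i \<in> I \<Longrightarrow> j \<in> I \<Longrightarrow> i \<noteq> j \<Longrightarrow> inner_capacity \<kappa> (A i \<inter> A j) = 0"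
    and \<mu>: "\<mu> \<in> \<E>" and \<nu>: "\<nu> \<in> \<E>" and R: "R \<mu> - R \<nu> = (\<lambda>_. 0)"
  shows "\<mu> = \<nu>"
proof -
  have eq: "radon_sum I (join \<mu> \<nu>) = radon_sum I (join \<nu> \<mu>)"
    using R unfolding R_diff[OF \<mu> \<nu>] by (simp add: fun_eq_iff)
  have le: "radon_le (join x y i) (join y x i)"
    if "x \<in> \<E>" "y \<in> \<E>" "radon_sum I (join x y) = radon_sum I (join y x)" "i \<in> I" for x y i
    using that cap
    by (intro radon_sum_eq_imp_le[OF lc join_locally_finite[OF that(1,2)] join_locally_finite[OF that(2,1)]
          finite_pos_pos[OF join_finite_pos[OF that(1,2)]] finite_pos_pos[OF join_finite_pos[OF that(2,1)]]]
        join_disjoint) auto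
  have "join \<mu> \<nu> i = join \<nu> \<mu> i" if i: "i \<in> I" for i
    by (intro radon_le_antisym le \<mu> \<nu> eq eq[symmetric] i
        finite_pos_radon[OF join_finite_pos[OF \<mu> \<nu> i]] finite_pos_radon[OF join_finite_pos[OF \<nu> \<mu> i]])
  then have eq: "\<mu> i = \<nu> i" if "i \<in> I" for i
    using that by (metis join_def)
  \<comment> \<open>Equality outside the index set comes from the extensional product.\<close>
  have "\<mu> \<in> (\<Pi>\<^sub>E i\<in>I. measures_carried_by (A i))" "\<nu> \<in> (\<Pi>\<^sub>E i\<in>I. measures_carried_by (A i))"
    using \<mu> \<nu> by (simp_all add: finite_energy_vectors_def vector_measures_def)
  then show ?thesis
    using eq by (rule PiE_ext)
qed

section \<open>Necessity: one measure placed on either of two plates\<close>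

lemma single_finite_energy_vector:
  assumes \<nu>: "\<nu> \<in> finite_pos" "\<nu> \<in> measures_carried_by (A i)" and i: "i \<in> I"
  shows "(\<lambda>k\<in>I. if k = i then \<nu> else (\<lambda>_. 0)) \<in> \<E>" (is "?\<mu> \<in> _")
    and "R (\<lambda>k\<in>I. if k = i then \<nu> else (\<lambda>_. 0)) = (\<lambda>f. s i * \<nu> f)"
proof -
  have \<mu>: "?\<mu> k \<in> finite_pos" if "k \<in> I" for k
    using that \<nu>(1) finite_pos_0 by simp
  have "energy_defined \<kappa> (?\<mu> k) (?\<mu> l)" "\<bar>mutual_energy \<kappa> (?\<mu> k) (?\<mu> l)\<bar> \<noteq> \<infinity>" if "k \<in> I" "l \<in> I" for k l
    using E_diff(1,2)[OF \<mu>[OF that(1)] finite_pos_0 \<mu>[OF that(2)] finite_pos_0] by (simp_all add: fun_diff_def)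
  moreover have "(\<lambda>(k, l). \<bar>s k * s l * E (?\<mu> k) (?\<mu> l)\<bar>) summable_on I \<times> I"
  proof (rule finite_nonzero_values_imp_summable_on, rule finite_subset)
    have 0: "E (\<lambda>_. 0) \<rho> = 0" "E \<rho> (\<lambda>_. 0) = 0" if "\<rho> \<in> finite_pos" for \<rho>
      using that finite_pos_pos[OF that]
      by (simp_all add: mutual_energy_pos pos_radon_0 pos_radon_imp_radon flip: zero_ereal_def)
    show "{x \<in> I \<times> I. (\<lambda>(k, l). \<bar>s k * s l * E (?\<mu> k) (?\<mu> l)\<bar>) x \<noteq> 0} \<subseteq> {(i, i)}"
      using 0[OF \<nu>(1)] 0[OF finite_pos_0] by (auto split: if_splits)
  qed simp
  ultimately have "vector_energy_finite \<kappa> Ipos Ineg ?\<mu>"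
    unfolding vector_energy_finite_def by (intro conjI ballI)
  then show "?\<mu> \<in> \<E>"
    using \<nu>(2) measures_carried_by_0 by (auto simp: finite_energy_vectors_def vector_measures_def)
  show "R ?\<mu> = (\<lambda>f. s i * \<nu> f)"
  proof
    fix f
    have "R ?\<mu> f = (\<Sum>k\<in>{i}. s k * ?\<mu> k f)"
      unfolding condenser_R_def using i by (intro infsum_finite_support) auto
    then show "R ?\<mu> f = s i * \<nu> f"
      using i by simp
  qed
qed

lemma plate_sign_eq:
  assumes "i \<in> I" "j \<in> I" "A i \<inter> A j \<noteq> {}"
  shows "s i = s j"
proof -
  have "\<forall>i\<in>Ipos. \<forall>j\<in>Ineg. A i \<inter> A j = {}" "Ipos \<inter> Ineg = {}"
    using condenser by (auto simp: generalized_condenser_def)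
  then show ?thesis
    using assms unfolding plate_sign_def by (metis Int_commute Un_iff)
qed

lemma Metric_space_imp_capacity_0:
  assumes metric: "Metric_space \<E> (vector_dist \<kappa> Ipos Ineg A)"
    and ij: "i \<in> I" "j \<in> I" "i \<noteq> j"
  shows "inner_capacity \<kappa> (A i \<inter> A j) = 0"
proof (rule ccontr)
  let ?Q = "A i \<inter> A j"
  assume "inner_capacity \<kappa> ?Q \<noteq> 0"
  then obtain \<nu> where \<nu>: "\<nu> \<in> finite_energy_measures \<kappa>" "\<nu> \<in> measures_carried_by ?Q" "radon_outer \<nu> ?Q = 1"
    unfolding inner_capacity_eq_0_iff by blast
  note P = measures_carried_by_pos[OF \<nu>(2)]
  have "\<bar>mutual_energy \<kappa> \<nu> \<nu>\<bar> \<noteq> \<infinity>"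
    using \<nu>(1) by (simp add: finite_energy_measures_def)
  then have fin: "\<nu> \<in> finite_pos"
    using P by (auto simp: finite_pos_def mutual_energy_pos)
  \<comment> \<open>The empty set cannot have mass 1. Hence the plates meet and have equal signs,
    which makes the two images below coincide.\<close>
  have "?Q \<noteq> {}"
  proof
    assume "?Q = {}"
    moreover have "(indicator {} :: 'a \<Rightarrow> ereal) = (\<lambda>_. 0)"
      by (simp add: fun_eq_iff)
    ultimately have "radon_outer \<nu> ?Q = lsc_integral (\<lambda>_. 0) \<nu>"
      using radon_outer_open[OF P open_empty] by simp
    also have "\<dots> \<le> 0"
    proof (rule lsc_integral_least_nonneg[OF _ Cc_mono_pos_radon[OF P]])
      fix f :: "'a \<Rightarrow> real" assume "\<And>x. 0 \<le> f x" "\<And>x. ereal (f x) \<le> 0"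
      then have "f = (\<lambda>_. 0)"
        by (auto intro: order.antisym)
      then show "ereal (\<nu> f) \<le> 0"
        using P by (simp add: pos_radon_imp_radon)
    qed simp
    finally show False
      using \<nu>(3) by simp
  qed
  then have s: "s i = s j"
    using ij by (intro plate_sign_eq)
  have carried: "\<nu> \<in> measures_carried_by (A i)" "\<nu> \<in> measures_carried_by (A j)"
    using \<nu>(2) by (auto intro: measures_carried_by_mono)
  let ?\<mu> = "\<lambda>i. \<lambda>k\<in>I. if k = i then \<nu> else (\<lambda>_. 0)"
  have \<mu>: "?\<mu> i \<in> \<E>" "?\<mu> j \<in> \<E>"
    using single_finite_energy_vector(1)[OF fin] carried ij by auto
  have "R (?\<mu> i) = R (?\<mu> j)"
    using single_finite_energy_vector(2)[OF fin carried(1) ij(1)]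
      single_finite_energy_vector(2)[OF fin carried(2) ij(2)] s by simp
  then have "vector_dist \<kappa> Ipos Ineg A (?\<mu> i) (?\<mu> j) = 0"
    using energy_norm_zero by (simp add: vector_dist_eq[OF \<mu>] zero_fun_def)
  then have "?\<mu> i = ?\<mu> j"
    using Metric_space.zero[OF metric \<mu>] by blast
  \<comment> \<open>At index \<open>i\<close> the second vector is zero, because
    \<open>i \<noteq> j\<close>.\<close>
  then have "?\<mu> i i = ?\<mu> j i"
    by (rule fun_cong)
  then have "\<nu> = (\<lambda>_. 0)"
    using ij by simp
  then show False
    using \<nu>(3) by (simp add: radon_outer_0)
qed

lemma capacity_0_imp_Metric_space:
  assumes spd: "strictly_positive_definite \<kappa>"
    and cap: "\<And>i j. i \<in> I \<Longrightarrow> j \<in> I \<Longrightarrow> i \<noteq> j \<Longrightarrow> inner_capacity \<kappa> (A i \<inter> A j) = 0"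
  shows "Metric_space \<E> (vector_dist \<kappa> Ipos Ineg A)"
proof
  note semi = semimetric_space_vector_dist[unfolded semimetric_space_def]
  let ?d = "vector_dist \<kappa> Ipos Ineg A"
  show "0 \<le> ?d x y" "?d x y = ?d y x" for x y
    using semi by blast+
  show "?d x z \<le> ?d x y + ?d y z" if "x \<in> \<E>" "y \<in> \<E>" "z \<in> \<E>" for x y z
    using semi that by blast
  show "?d x y = 0 \<longleftrightarrow> x = y" if xy: "x \<in> \<E>" "y \<in> \<E>" for x y
  proof
    assume "?d x y = 0"
    then have "R x - R y = (\<lambda>_. 0)"
      using spd R_diff_finite_energy[OF xy] by (simp add: vector_dist_eq[OF xy] strictly_positive_definite_def)
    then show "x = y"
      using R_inj[OF cap xy] by blast
  next
    assume "x = y"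
    then show "?d x y = 0"
      using semi xy by blast
  qed
qed

end

theorem theorem3p16:
  fixes \<kappa> :: "'a::t2_space \<times> 'a \<Rightarrow> ereal"
    and Ipos Ineg :: "'i set"
    and A :: "'i \<Rightarrow> 'a set"
  assumes "locally_compact_space (euclidean :: 'a topology)"
    and "energy_kernel \<kappa>"
    and "positive_definite \<kappa>"
    and "generalized_condenser Ipos Ineg A"
  shows "(\<forall>\<mu>1\<in>finite_energy_vectors \<kappa> Ipos Ineg A. \<forall>\<mu>2\<in>finite_energy_vectors \<kappa> Ipos Ineg A.
            vector_energy_finite \<kappa> Ipos Ineg (\<lambda>i. \<mu>1 i - \<mu>2 i))
       \<and> semimetric_space (finite_energy_vectors \<kappa> Ipos Ineg A) (vector_dist \<kappa> Ipos Ineg A)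
       \<and> condenser_R Ipos Ineg ` finite_energy_vectors \<kappa> Ipos Ineg A \<subseteq> finite_energy_measures \<kappa>
       \<and> (\<forall>\<mu>1\<in>finite_energy_vectors \<kappa> Ipos Ineg A. \<forall>\<mu>2\<in>finite_energy_vectors \<kappa> Ipos Ineg A.
            condenser_R Ipos Ineg \<mu>1 - condenser_R Ipos Ineg \<mu>2 \<in> finite_energy_measures \<kappa> \<and>
            vector_dist \<kappa> Ipos Ineg A \<mu>1 \<mu>2
              = energy_norm \<kappa> (condenser_R Ipos Ineg \<mu>1 - condenser_R Ipos Ineg \<mu>2))
       \<and> (strictly_positive_definite \<kappa> \<longrightarrow>
            (Metric_space (finite_energy_vectors \<kappa> Ipos Ineg A) (vector_dist \<kappa> Ipos Ineg A)
             \<longleftrightarrow> (\<forall>i\<in>Ipos \<union> Ineg. \<forall>j\<in>Ipos \<union> Ineg. i \<noteq> j \<longrightarrow> inner_capacity \<kappa> (A i \<inter> A j) = 0)))"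
proof -
  obtain M where M: "\<And>z. 0 \<le> \<kappa> z + ereal M" "M = 0 \<or> compact (UNIV :: 'a set)"
    using energy_kernel_lower_bound[OF assms(2)] by blast
  interpret condenser \<kappa> M Ipos Ineg A
    using assms M by unfold_locales auto
  show ?thesis
  proof (intro conjI ballI impI)
    show "Metric_space \<E> (vector_dist \<kappa> Ipos Ineg A)
        \<longleftrightarrow> (\<forall>i\<in>I. \<forall>j\<in>I. i \<noteq> j \<longrightarrow> inner_capacity \<kappa> (A i \<inter> A j) = 0)"
      if "strictly_positive_definite \<kappa>"
      using Metric_space_imp_capacity_0 capacity_0_imp_Metric_space[OF that] by blast
  qed (use vector_energy_finite_diff semimetric_space_vector_dist R_finite_energy R_diff_finite_energy
      vector_dist_eq in auto)
qed

end
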